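(* $\mathsf{RCA}_0+\mathsf{I}\Sigma^0_2$ proves: if a countable commutative ring $R$ with unity has no strictly increasing chain of $\Sigma^0_1$-ideals $\mathcal{I}_0\subsetneq\mathcal{I}_1\subsetneq\cdots$, then every chain of $\Sigma^0_1$-ideals $\mathcal{I}_0\subseteq\mathcal{I}_1\subseteq\cdots$ in $R$ eventually stabilises (i.e. there is $n$ with $\mathcal{I}_m=\mathcal{I}_n$ for all $m\ge n$).
   Context: $\mathsf{RCA}_0$ is the subsystem of second-order arithmetic with basic arithmetic axioms, $\Sigma^0_1$-induction and $\Delta^0_1$-comprehension; $\mathsf{I}\Sigma^0_2$ is the induction scheme for $\Sigma^0_2$ formulas. A $\Sigma^0_1$-ideal $\mathcal{I}\subseteq R$ is a sequence $\langle a_0,a_1,\ldots\rangle$ of elements of $R$ such that for all $i,j$ and $r,s\in R$ there is $k$ with $a_k=a_ir+a_js$. For $\mathcal{I}=\langle a_n\rangle$, $\mathcal{J}=\langle b_n\rangle$: $r\in\mathcal{I}$ means $\exists m\, r=a_m$; $\mathcal{I}\subseteq\mathcal{J}$ means every $a_n\in\mathcal{J}$ (no witnessing function required); $\mathcal{I}\subsetneq\mathcal{J}$ means $\mathcal{I}\subseteq\mathcal{J}$ and $\mathcal{J}\not\subseteq\mathcal{I}$; $\mathcal{I}=\mathcal{J}$ means mutual inclusion. A chain of $\Sigma^0_1$-ideals is a single sequence coding the $\Sigma^0_1$-ideals $\mathcal{I}_0,\mathcal{I}_1,\ldots$ uniformly. *)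

theory Defs
  imports Main
begin

section \<open>The language of second-order arithmetic\<close>

text \<open>Number variables and set variables live in separate name spaces. Equality is primitive for
  numbers only, and set variables are the only set terms.\<close>

type_synonym name = string

datatype tm = V name | Zero | One | Plus tm tm (infixl "\<^bold>+" 75) | Times tm tm (infixl "\<^bold>*" 80)

datatype fm =
    Eq tm tm (infix "\<^bold>=" 70)
  | Less tm tm (infix "\<^bold><" 70)
  | Mem tm name (infix "\<^bold>\<in>" 70)
  | Falsity
  | Imp fm fm (infixr "\<^bold>\<longrightarrow>" 55)
  | AllN name fm
  | AllS name fm

abbreviation Neg :: "fm \<Rightarrow> fm" ("\<^bold>\<not> _" [66] 66) where "\<^bold>\<not> \<phi> \<equiv> \<phi> \<^bold>\<longrightarrow> Falsity"
abbreviation And :: "fm \<Rightarrow> fm \<Rightarrow> fm" (infixr "\<^bold>\<and>" 65) where "\<phi> \<^bold>\<and> \<psi> \<equiv> \<^bold>\<not> (\<phi> \<^bold>\<longrightarrow> \<^bold>\<not> \<psi>)"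
abbreviation (input) Or :: "fm \<Rightarrow> fm \<Rightarrow> fm" (infixr "\<^bold>\<or>" 60) where "\<phi> \<^bold>\<or> \<psi> \<equiv> \<^bold>\<not> \<phi> \<^bold>\<longrightarrow> \<psi>"
abbreviation Iff :: "fm \<Rightarrow> fm \<Rightarrow> fm" (infix "\<^bold>\<longleftrightarrow>" 55) where
  "\<phi> \<^bold>\<longleftrightarrow> \<psi> \<equiv> (\<phi> \<^bold>\<longrightarrow> \<psi>) \<^bold>\<and> (\<psi> \<^bold>\<longrightarrow> \<phi>)"
abbreviation ExN :: "name \<Rightarrow> fm \<Rightarrow> fm" where "ExN x \<phi> \<equiv> \<^bold>\<not> AllN x (\<^bold>\<not> \<phi>)"
abbreviation ExS :: "name \<Rightarrow> fm \<Rightarrow> fm" where "ExS X \<phi> \<equiv> \<^bold>\<not> AllS X (\<^bold>\<not> \<phi>)"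
abbreviation AllsN :: "name list \<Rightarrow> fm \<Rightarrow> fm" where "AllsN xs \<phi> \<equiv> foldr AllN xs \<phi>"
abbreviation AllsS :: "name list \<Rightarrow> fm \<Rightarrow> fm" where "AllsS Xs \<phi> \<equiv> foldr AllS Xs \<phi>"
abbreviation ExsN :: "name list \<Rightarrow> fm \<Rightarrow> fm" where "ExsN xs \<phi> \<equiv> foldr ExN xs \<phi>"

primrec vars :: "tm \<Rightarrow> name set" where
  "vars (V x) = {x}"
| "vars Zero = {}"
| "vars One = {}"
| "vars (s \<^bold>+ t) = vars s \<union> vars t"
| "vars (s \<^bold>* t) = vars s \<union> vars t"

primrec fvN :: "fm \<Rightarrow> name set" where
  "fvN (s \<^bold>= t) = vars s \<union> vars t"
| "fvN (s \<^bold>< t) = vars s \<union> vars t"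
| "fvN (t \<^bold>\<in> X) = vars t"
| "fvN Falsity = {}"
| "fvN (\<phi> \<^bold>\<longrightarrow> \<psi>) = fvN \<phi> \<union> fvN \<psi>"
| "fvN (AllN x \<phi>) = fvN \<phi> - {x}"
| "fvN (AllS X \<phi>) = fvN \<phi>"

primrec fvS :: "fm \<Rightarrow> name set" where
  "fvS (s \<^bold>= t) = {}"
| "fvS (s \<^bold>< t) = {}"
| "fvS (t \<^bold>\<in> X) = {X}"
| "fvS Falsity = {}"
| "fvS (\<phi> \<^bold>\<longrightarrow> \<psi>) = fvS \<phi> \<union> fvS \<psi>"
| "fvS (AllN x \<phi>) = fvS \<phi>"
| "fvS (AllS X \<phi>) = fvS \<phi> - {X}"

text \<open>Substitution for free occurrences does not rename bound variables; the predicates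
  \<open>free_forN\<close> and \<open>free_forS\<close> say that no variable of the substituted term is captured.\<close>

primrec sub_tm :: "name \<Rightarrow> tm \<Rightarrow> tm \<Rightarrow> tm" where
  "sub_tm x t (V y) = (if y = x then t else V y)"
| "sub_tm x t Zero = Zero"
| "sub_tm x t One = One"
| "sub_tm x t (u \<^bold>+ v) = sub_tm x t u \<^bold>+ sub_tm x t v"
| "sub_tm x t (u \<^bold>* v) = sub_tm x t u \<^bold>* sub_tm x t v"

primrec subN :: "name \<Rightarrow> tm \<Rightarrow> fm \<Rightarrow> fm" where
  "subN x t (u \<^bold>= v) = (sub_tm x t u \<^bold>= sub_tm x t v)"
| "subN x t (u \<^bold>< v) = (sub_tm x t u \<^bold>< sub_tm x t v)"
| "subN x t (u \<^bold>\<in> X) = (sub_tm x t u \<^bold>\<in> X)"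
| "subN x t Falsity = Falsity"
| "subN x t (\<phi> \<^bold>\<longrightarrow> \<psi>) = (subN x t \<phi> \<^bold>\<longrightarrow> subN x t \<psi>)"
| "subN x t (AllN y \<phi>) = AllN y (if y = x then \<phi> else subN x t \<phi>)"
| "subN x t (AllS Y \<phi>) = AllS Y (subN x t \<phi>)"

primrec subS :: "name \<Rightarrow> name \<Rightarrow> fm \<Rightarrow> fm" where
  "subS X Z (u \<^bold>= v) = (u \<^bold>= v)"
| "subS X Z (u \<^bold>< v) = (u \<^bold>< v)"
| "subS X Z (u \<^bold>\<in> Y) = (u \<^bold>\<in> (if Y = X then Z else Y))"
| "subS X Z Falsity = Falsity"
| "subS X Z (\<phi> \<^bold>\<longrightarrow> \<psi>) = (subS X Z \<phi> \<^bold>\<longrightarrow> subS X Z \<psi>)"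
| "subS X Z (AllN y \<phi>) = AllN y (subS X Z \<phi>)"
| "subS X Z (AllS Y \<phi>) = AllS Y (if Y = X then \<phi> else subS X Z \<phi>)"

primrec free_forN :: "tm \<Rightarrow> name \<Rightarrow> fm \<Rightarrow> bool" where
  "free_forN t x (u \<^bold>= v) \<longleftrightarrow> True"
| "free_forN t x (u \<^bold>< v) \<longleftrightarrow> True"
| "free_forN t x (u \<^bold>\<in> X) \<longleftrightarrow> True"
| "free_forN t x Falsity \<longleftrightarrow> True"
| "free_forN t x (\<phi> \<^bold>\<longrightarrow> \<psi>) \<longleftrightarrow> free_forN t x \<phi> \<and> free_forN t x \<psi>"
| "free_forN t x (AllN y \<phi>) \<longleftrightarrow> x \<notin> fvN (AllN y \<phi>) \<or> (y \<notin> vars t \<and> free_forN t x \<phi>)"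
| "free_forN t x (AllS Y \<phi>) \<longleftrightarrow> free_forN t x \<phi>"

primrec free_forS :: "name \<Rightarrow> name \<Rightarrow> fm \<Rightarrow> bool" where
  "free_forS Z X (u \<^bold>= v) \<longleftrightarrow> True"
| "free_forS Z X (u \<^bold>< v) \<longleftrightarrow> True"
| "free_forS Z X (u \<^bold>\<in> Y) \<longleftrightarrow> True"
| "free_forS Z X Falsity \<longleftrightarrow> True"
| "free_forS Z X (\<phi> \<^bold>\<longrightarrow> \<psi>) \<longleftrightarrow> free_forS Z X \<phi> \<and> free_forS Z X \<psi>"
| "free_forS Z X (AllN y \<phi>) \<longleftrightarrow> free_forS Z X \<phi>"
| "free_forS Z X (AllS Y \<phi>) \<longleftrightarrow> X \<notin> fvS (AllS Y \<phi>) \<or> (Y \<noteq> Z \<and> free_forS Z X \<phi>)"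


section \<open>Provability\<close>

text \<open>A Hilbert calculus for two-sorted classical logic with equality. Generalisation is
  unrestricted, so a non-logical axiom with free variables stands for its universal closure.\<close>

inductive proves :: "fm set \<Rightarrow> fm \<Rightarrow> bool" (infix "\<turnstile>" 50) for T :: "fm set" where
  Axiom: "\<phi> \<in> T \<Longrightarrow> T \<turnstile> \<phi>"
| K: "T \<turnstile> \<phi> \<^bold>\<longrightarrow> \<psi> \<^bold>\<longrightarrow> \<phi>"
| S: "T \<turnstile> (\<phi> \<^bold>\<longrightarrow> \<psi> \<^bold>\<longrightarrow> \<chi>) \<^bold>\<longrightarrow> (\<phi> \<^bold>\<longrightarrow> \<psi>) \<^bold>\<longrightarrow> \<phi> \<^bold>\<longrightarrow> \<chi>"
| DNeg: "T \<turnstile> \<^bold>\<not> (\<^bold>\<not> \<phi>) \<^bold>\<longrightarrow> \<phi>"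
| InstN: "free_forN t x \<phi> \<Longrightarrow> T \<turnstile> AllN x \<phi> \<^bold>\<longrightarrow> subN x t \<phi>"
| InstS: "free_forS Z X \<phi> \<Longrightarrow> T \<turnstile> AllS X \<phi> \<^bold>\<longrightarrow> subS X Z \<phi>"
| DistN: "x \<notin> fvN \<phi> \<Longrightarrow> T \<turnstile> AllN x (\<phi> \<^bold>\<longrightarrow> \<psi>) \<^bold>\<longrightarrow> \<phi> \<^bold>\<longrightarrow> AllN x \<psi>"
| DistS: "X \<notin> fvS \<phi> \<Longrightarrow> T \<turnstile> AllS X (\<phi> \<^bold>\<longrightarrow> \<psi>) \<^bold>\<longrightarrow> \<phi> \<^bold>\<longrightarrow> AllS X \<psi>"
| EqRefl: "T \<turnstile> t \<^bold>= t"
| EqSubst: "free_forN s x \<phi> \<Longrightarrow> free_forN t x \<phi> \<Longrightarrow> T \<turnstile> s \<^bold>= t \<^bold>\<longrightarrow> subN x s \<phi> \<^bold>\<longrightarrow> subN x t \<phi>"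
| MP: "T \<turnstile> \<phi> \<^bold>\<longrightarrow> \<psi> \<Longrightarrow> T \<turnstile> \<phi> \<Longrightarrow> T \<turnstile> \<psi>"
| GenN: "T \<turnstile> \<phi> \<Longrightarrow> T \<turnstile> AllN x \<phi>"
| GenS: "T \<turnstile> \<phi> \<Longrightarrow> T \<turnstile> AllS X \<phi>"


section \<open>The arithmetical hierarchy and the axiom systems\<close>

text \<open>Set parameters are allowed throughout.\<close>

inductive bounded_fm :: "fm \<Rightarrow> bool" where
  "bounded_fm (s \<^bold>= t)"
| "bounded_fm (s \<^bold>< t)"
| "bounded_fm (t \<^bold>\<in> X)"
| "bounded_fm Falsity"
| "bounded_fm \<phi> \<Longrightarrow> bounded_fm \<psi> \<Longrightarrow> bounded_fm (\<phi> \<^bold>\<longrightarrow> \<psi>)"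
| "bounded_fm \<phi> \<Longrightarrow> x \<notin> vars t \<Longrightarrow> bounded_fm (AllN x (V x \<^bold>< t \<^bold>\<longrightarrow> \<phi>))"
| "bounded_fm \<phi> \<Longrightarrow> x \<notin> vars t \<Longrightarrow> bounded_fm (ExN x (V x \<^bold>< t \<^bold>\<and> \<phi>))"

inductive Sigma0 :: "nat \<Rightarrow> fm \<Rightarrow> bool" and Pi0 :: "nat \<Rightarrow> fm \<Rightarrow> bool" where
  "bounded_fm \<phi> \<Longrightarrow> Sigma0 0 \<phi>"
| "bounded_fm \<phi> \<Longrightarrow> Pi0 0 \<phi>"
| "Pi0 k \<phi> \<Longrightarrow> Sigma0 (Suc k) (ExN x \<phi>)"
| "Sigma0 k \<phi> \<Longrightarrow> Pi0 (Suc k) (AllN x \<phi>)"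

definition basic_axioms :: "fm set" where
  "basic_axioms = (let m = V ''m''; n = V ''n'' in
    {\<^bold>\<not> (n \<^bold>+ One \<^bold>= Zero),
     m \<^bold>+ One \<^bold>= n \<^bold>+ One \<^bold>\<longrightarrow> m \<^bold>= n,
     m \<^bold>+ Zero \<^bold>= m,
     m \<^bold>+ (n \<^bold>+ One) \<^bold>= (m \<^bold>+ n) \<^bold>+ One,
     m \<^bold>* Zero \<^bold>= Zero,
     m \<^bold>* (n \<^bold>+ One) \<^bold>= (m \<^bold>* n) \<^bold>+ m,
     \<^bold>\<not> (m \<^bold>< Zero),
     m \<^bold>< n \<^bold>+ One \<^bold>\<longleftrightarrow> (m \<^bold>< n \<^bold>\<or> m \<^bold>= n)})"

definition induction_axiom :: "name \<Rightarrow> fm \<Rightarrow> fm" where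
  "induction_axiom x \<phi> =
    (subN x Zero \<phi> \<^bold>\<and> AllN x (\<phi> \<^bold>\<longrightarrow> subN x (V x \<^bold>+ One) \<phi>) \<^bold>\<longrightarrow> AllN x \<phi>)"

definition Sigma0_induction :: "nat \<Rightarrow> fm set" where
  "Sigma0_induction k = {induction_axiom x \<phi> | x \<phi>. Sigma0 k \<phi>}"

definition Delta01_comprehension :: "fm set" where
  "Delta01_comprehension =
    {AllN x (\<phi> \<^bold>\<longleftrightarrow> \<psi>) \<^bold>\<longrightarrow> ExS X (AllN x (V x \<^bold>\<in> X \<^bold>\<longleftrightarrow> \<phi>)) | x X \<phi> \<psi>.
      Sigma0 1 \<phi> \<and> Pi0 1 \<psi> \<and> X \<notin> fvS \<phi>}"

definition RCA0 :: "fm set" where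
  "RCA0 = basic_axioms \<union> Sigma0_induction 1 \<union> Delta01_comprehension"

definition ISigma02 :: "fm set" where
  "ISigma02 = Sigma0_induction 2"


section \<open>Rings and chains of ideals inside second-order arithmetic\<close>

text \<open>Pairs are coded by \<open>(i, j) = (i + j)\<^sup>2 + i\<close>, and a function is coded by its graph, a set of
  pairs. Since pairing is a term, ``\<open>f x = y\<close>'' is an atomic formula.\<close>

definition pair :: "tm \<Rightarrow> tm \<Rightarrow> tm" where
  "pair s t = (s \<^bold>+ t) \<^bold>* (s \<^bold>+ t) \<^bold>+ s"

definition app1 :: "name \<Rightarrow> tm \<Rightarrow> tm \<Rightarrow> fm" where
  "app1 F s t = (pair s t \<^bold>\<in> F)"

definition app2 :: "name \<Rightarrow> tm \<Rightarrow> tm \<Rightarrow> tm \<Rightarrow> fm" where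
  "app2 F s t u = (pair (pair s t) u \<^bold>\<in> F)"

text \<open>The formulas below use fixed variables for the objects under discussion: the ring has carrier
  \<open>R\<close>, addition \<open>P\<close>, multiplication \<open>T\<close>, negation \<open>M\<close> (set variables), and zero \<open>o\<close> and unity \<open>e\<close>
  (number variables); \<open>C\<close> is the set variable for a chain of ideals.\<close>

abbreviation carrier_fm :: "tm \<Rightarrow> fm" where "carrier_fm t \<equiv> t \<^bold>\<in> ''R''"
abbreviation add_fm :: "tm \<Rightarrow> tm \<Rightarrow> tm \<Rightarrow> fm" where "add_fm \<equiv> app2 ''P''"
abbreviation mul_fm :: "tm \<Rightarrow> tm \<Rightarrow> tm \<Rightarrow> fm" where "mul_fm \<equiv> app2 ''T''"
abbreviation neg_fm :: "tm \<Rightarrow> tm \<Rightarrow> fm" where "neg_fm \<equiv> app1 ''M''"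
abbreviation zero_tm :: tm where "zero_tm \<equiv> V ''o''"
abbreviation one_tm :: tm where "one_tm \<equiv> V ''e''"

definition binary_operation :: "name \<Rightarrow> fm" where
  "binary_operation F = (let x = V ''x''; y = V ''y''; z = V ''z''; w = V ''w'' in
    AllN ''w'' (w \<^bold>\<in> F \<^bold>\<longrightarrow> ExsN [''x'', ''y'', ''z'']
      (carrier_fm x \<^bold>\<and> carrier_fm y \<^bold>\<and> carrier_fm z \<^bold>\<and> w \<^bold>= pair (pair x y) z)) \<^bold>\<and>
    AllsN [''x'', ''y''] (carrier_fm x \<^bold>\<and> carrier_fm y \<^bold>\<longrightarrow> ExN ''z'' (app2 F x y z)) \<^bold>\<and>
    AllsN [''x'', ''y'', ''z'', ''w''] (app2 F x y z \<^bold>\<and> app2 F x y w \<^bold>\<longrightarrow> z \<^bold>= w))"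

definition unary_operation :: "name \<Rightarrow> fm" where
  "unary_operation F = (let x = V ''x''; y = V ''y''; w = V ''w'' in
    AllN ''w'' (w \<^bold>\<in> F \<^bold>\<longrightarrow> ExsN [''x'', ''y'']
      (carrier_fm x \<^bold>\<and> carrier_fm y \<^bold>\<and> w \<^bold>= pair x y)) \<^bold>\<and>
    AllN ''x'' (carrier_fm x \<^bold>\<longrightarrow> ExN ''y'' (app1 F x y)) \<^bold>\<and>
    AllsN [''x'', ''y'', ''w''] (app1 F x y \<^bold>\<and> app1 F x w \<^bold>\<longrightarrow> y \<^bold>= w))"

definition associative :: "name \<Rightarrow> fm" where
  "associative F = (let x = V ''x''; y = V ''y''; z = V ''z''; u = V ''u''; v = V ''v''; w = V ''w'' in
    AllsN [''x'', ''y'', ''z'', ''u'', ''v'', ''w'']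
      (app2 F x y u \<^bold>\<and> app2 F y z v \<^bold>\<and> app2 F u z w \<^bold>\<longrightarrow> app2 F x v w))"

definition commutative :: "name \<Rightarrow> fm" where
  "commutative F = (let x = V ''x''; y = V ''y''; z = V ''z'' in
    AllsN [''x'', ''y'', ''z''] (app2 F x y z \<^bold>\<longrightarrow> app2 F y x z))"

definition distributive :: fm where
  "distributive = (let x = V ''x''; y = V ''y''; z = V ''z'';
      u = V ''u''; v = V ''v''; w = V ''w''; s = V ''s'' in
    AllsN [''x'', ''y'', ''z'', ''u'', ''v'', ''w'', ''s'']
      (add_fm y z s \<^bold>\<and> mul_fm x y u \<^bold>\<and> mul_fm x z v \<^bold>\<and> add_fm u v w \<^bold>\<longrightarrow> mul_fm x s w))"

definition countable_commutative_ring :: fm where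
  "countable_commutative_ring = (let x = V ''x''; y = V ''y'' in
    binary_operation ''P'' \<^bold>\<and> binary_operation ''T'' \<^bold>\<and> unary_operation ''M'' \<^bold>\<and>
    carrier_fm zero_tm \<^bold>\<and> carrier_fm one_tm \<^bold>\<and>
    associative ''P'' \<^bold>\<and> commutative ''P'' \<^bold>\<and>
    AllN ''x'' (carrier_fm x \<^bold>\<longrightarrow> add_fm x zero_tm x) \<^bold>\<and>
    AllsN [''x'', ''y''] (neg_fm x y \<^bold>\<longrightarrow> add_fm x y zero_tm) \<^bold>\<and>
    associative ''T'' \<^bold>\<and> commutative ''T'' \<^bold>\<and>
    AllN ''x'' (carrier_fm x \<^bold>\<longrightarrow> mul_fm x one_tm x) \<^bold>\<and>
    distributive)"

text \<open>A chain of \<open>\<Sigma>\<^sup>0\<^sub>1\<close>-ideals is one function \<open>C : \<nat> \<times> \<nat> \<rightarrow> R\<close>, its \<open>n\<close>-th ideal being the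
  sequence \<open>C (n, 0), C (n, 1), \<dots>\<close>. In the definitions with term arguments these must
  not contain the variables bound there.\<close>

definition double_sequence :: fm where
  "double_sequence = (let n = V ''n''; i = V ''i''; x = V ''x''; y = V ''y''; w = V ''w'' in
    AllN ''w'' (w \<^bold>\<in> ''C'' \<^bold>\<longrightarrow> ExsN [''n'', ''i'', ''x'']
      (carrier_fm x \<^bold>\<and> w \<^bold>= pair (pair n i) x)) \<^bold>\<and>
    AllsN [''n'', ''i''] (ExN ''x'' (app2 ''C'' n i x)) \<^bold>\<and>
    AllsN [''n'', ''i'', ''x'', ''y''] (app2 ''C'' n i x \<^bold>\<and> app2 ''C'' n i y \<^bold>\<longrightarrow> x \<^bold>= y))"

definition is_ideal :: "tm \<Rightarrow> fm" where
  "is_ideal n = (let i = V ''i''; j = V ''j''; k = V ''k''; r = V ''r''; s = V ''s'';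
      a = V ''a''; b = V ''b''; c = V ''c''; u = V ''u''; v = V ''v'' in
    AllsN [''i'', ''j'', ''r'', ''s''] (carrier_fm r \<^bold>\<and> carrier_fm s \<^bold>\<longrightarrow>
      ExsN [''k'', ''a'', ''b'', ''c'', ''u'', ''v'']
        (app2 ''C'' n i a \<^bold>\<and> app2 ''C'' n j b \<^bold>\<and> app2 ''C'' n k c \<^bold>\<and>
         mul_fm a r u \<^bold>\<and> mul_fm b s v \<^bold>\<and> add_fm u v c)))"

definition chain_of_ideals :: fm where
  "chain_of_ideals = double_sequence \<^bold>\<and> AllN ''n'' (is_ideal (V ''n''))"

definition in_ideal :: "tm \<Rightarrow> tm \<Rightarrow> fm" where
  "in_ideal r n = ExN ''l'' (app2 ''C'' n (V ''l'') r)"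

definition ideal_subset :: "tm \<Rightarrow> tm \<Rightarrow> fm" where
  "ideal_subset m n = (let k = V ''k''; a = V ''a'' in
    AllsN [''k'', ''a''] (app2 ''C'' m k a \<^bold>\<longrightarrow> in_ideal a n))"

definition ideal_psubset :: "tm \<Rightarrow> tm \<Rightarrow> fm" where
  "ideal_psubset m n = ideal_subset m n \<^bold>\<and> \<^bold>\<not> ideal_subset n m"

definition ideal_eq :: "tm \<Rightarrow> tm \<Rightarrow> fm" where
  "ideal_eq m n = ideal_subset m n \<^bold>\<and> ideal_subset n m"

definition increasing :: fm where
  "increasing = AllN ''n'' (ideal_subset (V ''n'') (V ''n'' \<^bold>+ One))"

definition strictly_increasing :: fm where
  "strictly_increasing = AllN ''n'' (ideal_psubset (V ''n'') (V ''n'' \<^bold>+ One))"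

definition stabilises :: fm where
  "stabilises = (let m = V ''m''; n = V ''n'' in
    ExN ''n'' (AllN ''m'' (n \<^bold>< m \<^bold>\<or> n \<^bold>= m \<^bold>\<longrightarrow> ideal_eq m n)))"

end

theory Submission
  imports Defs "HOL-Library.Countable_Set"
begin

text \<open>
  By the completeness theorem it suffices to argue inside an arbitrary model of the axioms, whose
  numbers form an ordered semiring. There, let \<open>C\<close> be an increasing chain that never stabilises. The
  numbers \<open>g 0 = 0\<close> and \<open>g (n + 1)\<close>, the least \<open>q > g n\<close> that codes an element of some ideal outside
  the \<open>(g n)\<close>-th one, would give a strictly increasing subchain, but deciding membership in an
  enumerated ideal is not effective. Replacing it by membership up to stage \<open>s\<close> gives approximations
  \<open>index n s\<close>, which increase with \<open>s\<close>; they are obtained by primitive recursion, hence by coding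
  finite sets. The union over \<open>s\<close> of the ideals with number \<open>index n s\<close> is enumerated uniformly in
  \<open>n\<close>. By \<open>\<Sigma>\<^sup>0\<^sub>2\<close>-induction on \<open>n\<close> the approximations are bounded in \<open>s\<close>, so they reach a final value,
  and the chain of these unions is strictly increasing.
\<close>

section \<open>Semantics\<close>

text \<open>Two obstacles shape the proof. A type class instance cannot depend on a hypothesis, so
  the countermodel is moved to one fixed countable type and picked once and for all by choice.
  Substitution does not rename bound variables, so the completeness argument vouches only for axioms
  without reserved names; every axiom instance used later is built without them. In the ring
  argument the correct next index is known only in the limit, and wrong guesses must do no harm.
  They do none because they are only ever too small: an ideal enumerated under a premature guess is
  contained in the final one, so the union over all stages is exactly the ideal at the limit,
  although no stage reveals that the limit has been reached. Guesses err on this side because a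
  number is discarded on finite evidence, such as its element turning up in an earlier ideal, and is
  never taken back. The existence of a limit has the form
  \<open>\<exists>b. \<forall>s. index n s \<le> b\<close>, and this is where the stronger induction
  enters.\<close>

record 'a struct =
  zer :: 'a
  uni :: 'a
  pls :: "'a \<Rightarrow> 'a \<Rightarrow> 'a"
  tms :: "'a \<Rightarrow> 'a \<Rightarrow> 'a"
  les :: "'a \<Rightarrow> 'a \<Rightarrow> bool"
  sts :: "'a set set"

primrec val :: "'a struct \<Rightarrow> tm \<Rightarrow> (name \<Rightarrow> 'a) \<Rightarrow> 'a" where
  "val M (V x) e = e x"
| "val M Zero e = zer M"
| "val M One e = uni M"
| "val M (s \<^bold>+ t) e = pls M (val M s e) (val M t e)"
| "val M (s \<^bold>* t) e = tms M (val M s e) (val M t e)"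

primrec sat :: "'a struct \<Rightarrow> fm \<Rightarrow> (name \<Rightarrow> 'a) \<Rightarrow> (name \<Rightarrow> 'a set) \<Rightarrow> bool" where
  "sat M (s \<^bold>= t) e E \<longleftrightarrow> val M s e = val M t e"
| "sat M (s \<^bold>< t) e E \<longleftrightarrow> les M (val M s e) (val M t e)"
| "sat M (t \<^bold>\<in> X) e E \<longleftrightarrow> val M t e \<in> E X"
| "sat M Falsity e E \<longleftrightarrow> False"
| "sat M (\<phi> \<^bold>\<longrightarrow> \<psi>) e E \<longleftrightarrow> (sat M \<phi> e E \<longrightarrow> sat M \<psi> e E)"
| "sat M (AllN x \<phi>) e E \<longleftrightarrow> (\<forall>a. sat M \<phi> (e(x := a)) E)"
| "sat M (AllS X \<phi>) e E \<longleftrightarrow> (\<forall>A\<in>sts M. sat M \<phi> e (E(X := A)))"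

text \<open>Free variables count as universally quantified, in keeping with unrestricted
  generalisation. Set assignments stay inside \<open>sts\<close>, so a structure without sets would
  validate everything.\<close>

definition valid :: "'a struct \<Rightarrow> fm \<Rightarrow> bool" where
  "valid M \<phi> \<longleftrightarrow> (\<forall>e E. range E \<subseteq> sts M \<longrightarrow> sat M \<phi> e E)"

primrec bnN :: "fm \<Rightarrow> name set" where
  "bnN (s \<^bold>= t) = {}"
| "bnN (s \<^bold>< t) = {}"
| "bnN (t \<^bold>\<in> X) = {}"
| "bnN Falsity = {}"
| "bnN (\<phi> \<^bold>\<longrightarrow> \<psi>) = bnN \<phi> \<union> bnN \<psi>"
| "bnN (AllN x \<phi>) = insert x (bnN \<phi>)"
| "bnN (AllS X \<phi>) = bnN \<phi>"

primrec bnS :: "fm \<Rightarrow> name set" where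
  "bnS (s \<^bold>= t) = {}"
| "bnS (s \<^bold>< t) = {}"
| "bnS (t \<^bold>\<in> X) = {}"
| "bnS Falsity = {}"
| "bnS (\<phi> \<^bold>\<longrightarrow> \<psi>) = bnS \<phi> \<union> bnS \<psi>"
| "bnS (AllN x \<phi>) = bnS \<phi>"
| "bnS (AllS X \<phi>) = insert X (bnS \<phi>)"

lemma finite_vars: "finite (vars t)"
  by (induction t) auto

lemma finite_names: "finite (fvN \<phi>)" "finite (fvS \<phi>)" "finite (bnN \<phi>)" "finite (bnS \<phi>)"
  by (induction \<phi>) (auto simp: finite_vars)

lemma val_cong: "(\<And>x. x \<in> vars t \<Longrightarrow> e x = e' x) \<Longrightarrow> val M t e = val M t e'"
  by (induction t) auto

lemma sat_cong:
  "(\<And>x. x \<in> fvN \<phi> \<Longrightarrow> e x = e' x) \<Longrightarrow> (\<And>X. X \<in> fvS \<phi> \<Longrightarrow> E X = E' X) \<Longrightarrow>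
    sat M \<phi> e E = sat M \<phi> e' E'"
proof (induction \<phi> arbitrary: e e' E E')
  case (Eq s t)
  then show ?case using val_cong[of s e e'] val_cong[of t e e'] by simp
next
  case (Less s t)
  then show ?case using val_cong[of s e e'] val_cong[of t e e'] by simp
next
  case (Mem t X)
  then show ?case using val_cong[of t e e'] by simp
next
  case (Imp \<phi> \<psi>)
  have "sat M \<phi> e E = sat M \<phi> e' E'" "sat M \<psi> e E = sat M \<psi> e' E'"
    using Imp.prems by (auto intro!: Imp.IH)
  then show ?case by simp
next
  case (AllN x \<phi>)
  have "sat M \<phi> (e(x := a)) E = sat M \<phi> (e'(x := a)) E'" for a
    using AllN.prems by (intro AllN.IH) auto
  then show ?case by simp
next
  case (AllS X \<phi>)
  have "sat M \<phi> e (E(X := A)) = sat M \<phi> e' (E'(X := A))" for A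
    using AllS.prems by (intro AllS.IH) auto
  then show ?case by simp
qed simp

lemma val_sub_tm: "val M (sub_tm x t u) e = val M u (e(x := val M t e))"
  by (induction u) auto

lemma subN_idle: "x \<notin> fvN \<phi> \<Longrightarrow> subN x t \<phi> = \<phi>"
proof -
  have sub_tm_idle: "x \<notin> vars u \<Longrightarrow> sub_tm x t u = u" for u by (induction u) auto
  show "x \<notin> fvN \<phi> \<Longrightarrow> subN x t \<phi> = \<phi>" by (induction \<phi>) (auto simp: sub_tm_idle)
qed

lemma subS_idle: "X \<notin> fvS \<phi> \<Longrightarrow> subS X Z \<phi> = \<phi>"
  by (induction \<phi>) auto

lemma sat_subN:
  "free_forN t x \<phi> \<Longrightarrow> sat M (subN x t \<phi>) e E = sat M \<phi> (e(x := val M t e)) E"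
proof (induction \<phi> arbitrary: e E)
  case (AllN y \<phi>)
  show ?case
  proof (cases "x \<in> fvN (AllN y \<phi>)")
    case False
    \<comment> \<open>Here \<open>free_forN\<close> says nothing about capture, but the substitution
      changes nothing.\<close>
    then show ?thesis unfolding subN_idle[OF False] by (intro sat_cong) auto
  next
    case True
    then have xy: "x \<noteq> y" "y \<notin> vars t" "free_forN t x \<phi>" using AllN.prems by auto
    have "sat M (subN x t \<phi>) (e(y := a)) E = sat M \<phi> (e(x := val M t e, y := a)) E" for a
    proof -
      have "val M t (e(y := a)) = val M t e" using xy(2) by (intro val_cong) auto
      then show ?thesis unfolding AllN.IH[OF xy(3)] fun_upd_twist[OF xy(1)] by (rule arg_cong)
    qed
    then show ?thesis using xy(1) by (simp del: fun_upd_apply)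
  qed
next
  case (AllS Y \<phi>)
  then show ?case by simp
next
  case (Imp \<phi> \<psi>)
  then show ?case by simp
qed (simp_all add: val_sub_tm)

lemma sat_subS: "free_forS Z X \<phi> \<Longrightarrow> sat M (subS X Z \<phi>) e E = sat M \<phi> e (E(X := E Z))"
proof (induction \<phi> arbitrary: e E)
  case (AllS Y \<phi>)
  show ?case
  proof (cases "X \<in> fvS (AllS Y \<phi>)")
    case False
    then show ?thesis unfolding subS_idle[OF False] by (intro sat_cong) auto
  next
    case True
    then have XY: "X \<noteq> Y" "Y \<noteq> Z" "free_forS Z X \<phi>" using AllS.prems by auto
    have "sat M (subS X Z \<phi>) e (E(Y := A)) = sat M \<phi> e (E(X := E Z, Y := A))" for A
      unfolding AllS.IH[OF XY(3)] fun_upd_twist[OF XY(1)] using XY(2) by simp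
    then show ?thesis using XY(1) by (simp del: fun_upd_apply)
  qed
next
  case (AllN y \<phi>)
  then show ?case by simp
next
  case (Imp \<phi> \<psi>)
  then show ?case by simp
qed simp_all

section \<open>Fresh variables and renaming back\<close>

lemma free_forN_fresh: "vars t \<inter> bnN \<phi> = {} \<Longrightarrow> free_forN t x \<phi>"
  by (induction \<phi>) auto

lemma free_forS_fresh: "Z \<notin> bnS \<phi> \<Longrightarrow> free_forS Z X \<phi>"
  by (induction \<phi>) auto

lemma free_forN_self: "free_forN (V x) x \<phi>"
  by (induction \<phi>) auto

lemma subN_self: "subN x (V x) \<phi> = \<phi>"
proof -
  have "sub_tm x (V x) u = u" for u by (induction u) auto
  then show ?thesis by (induction \<phi>) auto
qed

lemma free_forS_self: "free_forS X X \<phi>"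
  by (induction \<phi>) auto

lemma subS_self: "subS X X \<phi> = \<phi>"
  by (induction \<phi>) auto

lemma fvN_subN_fresh: "w \<notin> fvN \<phi> \<Longrightarrow> w \<notin> bnN \<phi> \<Longrightarrow> x \<notin> fvN (subN x (V w) \<phi>) \<or> x = w"
proof -
  have "x \<noteq> w \<Longrightarrow> x \<notin> vars (sub_tm x (V w) u)" for u by (induction u) auto
  then show ?thesis by (induction \<phi>) auto
qed

text \<open>This round trip stands in for renaming bound variables: generalise over the fresh
  \<open>w\<close>, instantiate with \<open>x\<close>, and quantify over \<open>x\<close>
  again.\<close>

lemma subN_subN_back:
  assumes "w \<notin> fvN \<phi>" "w \<notin> bnN \<phi>"
  shows "subN w (V x) (subN x (V w) \<phi>) = \<phi>"
proof -
  have "w \<notin> vars u \<Longrightarrow> sub_tm w (V x) (sub_tm x (V w) u) = u" for u by (induction u) auto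
  then show ?thesis using assms by (induction \<phi>) (auto simp: subN_idle)
qed

lemma free_forN_back: "w \<notin> fvN \<phi> \<Longrightarrow> w \<notin> bnN \<phi> \<Longrightarrow> free_forN (V x) w (subN x (V w) \<phi>)"
proof (induction \<phi>)
  case (AllN y \<phi>)
  then show ?case by (cases "y = x") auto
qed auto

lemma fvS_subS_fresh: "X \<noteq> Z \<Longrightarrow> X \<notin> fvS (subS X Z \<phi>)"
  by (induction \<phi>) auto

lemma subS_subS_back: "Z \<notin> fvS \<phi> \<Longrightarrow> Z \<notin> bnS \<phi> \<Longrightarrow> subS Z X (subS X Z \<phi>) = \<phi>"
  by (induction \<phi>) (auto simp: subS_idle)

lemma free_forS_back: "Z \<notin> fvS \<phi> \<Longrightarrow> Z \<notin> bnS \<phi> \<Longrightarrow> free_forS X Z (subS X Z \<phi>)"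
proof (induction \<phi>)
  case (AllS Y \<phi>)
  then show ?case by (cases "Y = X") auto
qed auto

section \<open>Derivability from hypotheses\<close>

text \<open>Added as axioms, hypotheses with free variables would be open to unrestricted
  generalisation and the deduction theorem would fail. Here they are combined by modus ponens
  alone.\<close>

inductive ent :: "fm set \<Rightarrow> fm set \<Rightarrow> fm \<Rightarrow> bool" for T \<Gamma> where
  Thm: "T \<turnstile> \<phi> \<Longrightarrow> ent T \<Gamma> \<phi>"
| Hyp: "\<phi> \<in> \<Gamma> \<Longrightarrow> ent T \<Gamma> \<phi>"
| Mp: "ent T \<Gamma> (\<phi> \<^bold>\<longrightarrow> \<psi>) \<Longrightarrow> ent T \<Gamma> \<phi> \<Longrightarrow> ent T \<Gamma> \<psi>"

lemma proves_imp_refl: "T \<turnstile> \<phi> \<^bold>\<longrightarrow> \<phi>"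
  by (rule proves.MP[OF proves.MP[OF proves.S proves.K] proves.K[of _ _ "\<phi>"]])

lemma ent_empty: "ent T {} \<phi> \<Longrightarrow> T \<turnstile> \<phi>"
  by (induction rule: ent.induct) (auto intro: proves.MP)

lemma ent_mono: "ent T \<Gamma> \<phi> \<Longrightarrow> \<Gamma> \<subseteq> \<Delta> \<Longrightarrow> ent T \<Delta> \<phi>"
  by (induction rule: ent.induct) (auto intro: ent.intros)

lemma ent_imp:
  assumes "ent T (insert \<phi> \<Gamma>) \<psi>"
  shows "ent T \<Gamma> (\<phi> \<^bold>\<longrightarrow> \<psi>)"
  using assms
proof (induction rule: ent.induct)
  case (Thm \<psi>)
  then show ?case by (rule ent.Thm[OF proves.MP[OF proves.K]])
next
  case (Hyp \<psi>)
  then consider "\<psi> = \<phi>" | "\<psi> \<in> \<Gamma>" by auto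
  then show ?case
    by cases (auto intro: ent.Thm proves_imp_refl ent.Mp[OF ent.Thm[OF proves.K]] ent.Hyp)
next
  case (Mp \<psi> \<chi>)
  show ?case by (rule ent.Mp[OF ent.Mp[OF ent.Thm[OF proves.S] Mp.IH(1)] Mp.IH(2)])
qed

lemma ent_finite:
  assumes "ent T \<Gamma> \<phi>"
  shows "\<exists>\<Delta>. finite \<Delta> \<and> \<Delta> \<subseteq> \<Gamma> \<and> ent T \<Delta> \<phi>"
  using assms
proof (induction rule: ent.induct)
  case (Thm \<phi>)
  then show ?case by (auto intro: ent.Thm)
next
  case (Hyp \<phi>)
  then show ?case by (intro exI[of _ "{\<phi>}"]) (auto intro: ent.Hyp)
next
  case (Mp \<phi> \<psi>)
  then obtain \<Delta>1 \<Delta>2 where "finite \<Delta>1" "\<Delta>1 \<subseteq> \<Gamma>" "ent T \<Delta>1 (\<phi> \<^bold>\<longrightarrow> \<psi>)"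
    "finite \<Delta>2" "\<Delta>2 \<subseteq> \<Gamma>" "ent T \<Delta>2 \<phi>" by auto
  then have "ent T (\<Delta>1 \<union> \<Delta>2) \<psi>"
    by (intro ent.Mp[of _ _ \<phi> \<psi>]) (auto elim: ent_mono)
  then show ?case using \<open>finite \<Delta>1\<close> \<open>finite \<Delta>2\<close> \<open>\<Delta>1 \<subseteq> \<Gamma>\<close> \<open>\<Delta>2 \<subseteq> \<Gamma>\<close>
    by (intro exI[of _ "\<Delta>1 \<union> \<Delta>2"]) auto
qed

lemma ent_AllN_elim: "ent T \<Gamma> (AllN x \<phi>) \<Longrightarrow> free_forN t x \<phi> \<Longrightarrow> ent T \<Gamma> (subN x t \<phi>)"
  by (rule ent.Mp[OF ent.Thm[OF proves.InstN]])

lemma ent_AllS_elim: "ent T \<Gamma> (AllS X \<phi>) \<Longrightarrow> free_forS Z X \<phi> \<Longrightarrow> ent T \<Gamma> (subS X Z \<phi>)"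
  by (rule ent.Mp[OF ent.Thm[OF proves.InstS]])

text \<open>\<open>ent\<close> has no generalisation rule of its own. In the modus ponens case the
  quantifier is distributed over the implication by two uses of \<open>DistN\<close>, whose
  antecedents are already quantified over \<open>x\<close>.\<close>

lemma ent_AllN:
  assumes "ent T \<Gamma> \<phi>" "\<forall>\<psi>\<in>\<Gamma>. x \<notin> fvN \<psi>"
  shows "ent T \<Gamma> (AllN x \<phi>)"
  using assms
proof (induction rule: ent.induct)
  case (Thm \<phi>)
  show ?case using Thm.hyps by (rule ent.Thm[OF proves.GenN])
next
  case (Hyp \<phi>)
  then show ?case
    by (intro ent.Mp[OF ent.Thm[OF proves.MP[OF proves.DistN proves.GenN[OF proves_imp_refl]]] ent.Hyp]) auto
next
  case (Mp \<phi> \<psi>)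
  let ?A = "AllN x (\<phi> \<^bold>\<longrightarrow> \<psi>)" and ?B = "AllN x \<phi>"
  have "ent T {?B, ?A} (\<phi> \<^bold>\<longrightarrow> \<psi>)" "ent T {?B, ?A} \<phi>"
    using ent_AllN_elim[of T "{?B, ?A}" x "\<phi> \<^bold>\<longrightarrow> \<psi>" "V x"] ent_AllN_elim[of T "{?B, ?A}" x \<phi> "V x"]
      free_forN_self[of x "\<phi> \<^bold>\<longrightarrow> \<psi>"] free_forN_self[of x \<phi>]
    unfolding subN_self by (auto intro: ent.Hyp)
  then have "ent T {} (?A \<^bold>\<longrightarrow> ?B \<^bold>\<longrightarrow> \<psi>)" by (intro ent_imp) (auto intro: ent.Mp)
  then have "T \<turnstile> ?A \<^bold>\<longrightarrow> ?B \<^bold>\<longrightarrow> \<psi>" by (rule ent_empty)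
  then have 1: "T \<turnstile> ?A \<^bold>\<longrightarrow> AllN x (?B \<^bold>\<longrightarrow> \<psi>)"
    by (rule proves.MP[OF proves.DistN proves.GenN, rotated]) simp
  have 2: "T \<turnstile> AllN x (?B \<^bold>\<longrightarrow> \<psi>) \<^bold>\<longrightarrow> ?B \<^bold>\<longrightarrow> AllN x \<psi>" by (rule proves.DistN) simp
  show ?case
    by (rule ent.Mp[OF ent.Mp[OF ent.Thm[OF 2] ent.Mp[OF ent.Thm[OF 1] Mp.IH(1)[OF Mp.prems]]]
          Mp.IH(2)[OF Mp.prems]])
qed

lemma ent_AllS:
  assumes "ent T \<Gamma> \<phi>" "\<forall>\<psi>\<in>\<Gamma>. X \<notin> fvS \<psi>"
  shows "ent T \<Gamma> (AllS X \<phi>)"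
  using assms
proof (induction rule: ent.induct)
  case (Thm \<phi>)
  show ?case using Thm.hyps by (rule ent.Thm[OF proves.GenS])
next
  case (Hyp \<phi>)
  then show ?case
    by (intro ent.Mp[OF ent.Thm[OF proves.MP[OF proves.DistS proves.GenS[OF proves_imp_refl]]] ent.Hyp]) auto
next
  case (Mp \<phi> \<psi>)
  let ?A = "AllS X (\<phi> \<^bold>\<longrightarrow> \<psi>)" and ?B = "AllS X \<phi>"
  have "ent T {?B, ?A} (\<phi> \<^bold>\<longrightarrow> \<psi>)" "ent T {?B, ?A} \<phi>"
    using ent_AllS_elim[of T "{?B, ?A}" X "\<phi> \<^bold>\<longrightarrow> \<psi>" X] ent_AllS_elim[of T "{?B, ?A}" X \<phi> X]
      free_forS_self[of X "\<phi> \<^bold>\<longrightarrow> \<psi>"] free_forS_self[of X \<phi>]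
    unfolding subS_self by (auto intro: ent.Hyp)
  then have "ent T {} (?A \<^bold>\<longrightarrow> ?B \<^bold>\<longrightarrow> \<psi>)" by (intro ent_imp) (auto intro: ent.Mp)
  then have "T \<turnstile> ?A \<^bold>\<longrightarrow> ?B \<^bold>\<longrightarrow> \<psi>" by (rule ent_empty)
  then have 1: "T \<turnstile> ?A \<^bold>\<longrightarrow> AllS X (?B \<^bold>\<longrightarrow> \<psi>)"
    by (rule proves.MP[OF proves.DistS proves.GenS, rotated]) simp
  have 2: "T \<turnstile> AllS X (?B \<^bold>\<longrightarrow> \<psi>) \<^bold>\<longrightarrow> ?B \<^bold>\<longrightarrow> AllS X \<psi>" by (rule proves.DistS) simp
  show ?case
    by (rule ent.Mp[OF ent.Mp[OF ent.Thm[OF 2] ent.Mp[OF ent.Thm[OF 1] Mp.IH(1)[OF Mp.prems]]]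
          Mp.IH(2)[OF Mp.prems]])
qed

lemma ent_AllN_fresh:
  assumes "ent T \<Gamma> (subN x (V w) \<phi>)" "\<forall>\<psi>\<in>\<Gamma>. w \<notin> fvN \<psi>" "w \<notin> fvN \<phi>" "w \<notin> bnN \<phi>"
  shows "ent T \<Gamma> (AllN x \<phi>)"
proof -
  let ?\<psi> = "AllN w (subN x (V w) \<phi>)"
  have "ent T {?\<psi>} \<phi>"
    using ent_AllN_elim[of T "{?\<psi>}" w "subN x (V w) \<phi>" "V x"] free_forN_back[OF assms(3,4)]
      subN_subN_back[OF assms(3,4)] by (simp add: ent.Hyp)
  moreover have "x \<notin> fvN ?\<psi>" using fvN_subN_fresh[OF assms(3,4)] by auto
  ultimately have "ent T {?\<psi>} (AllN x \<phi>)" by (intro ent_AllN) auto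
  then have "ent T {} (?\<psi> \<^bold>\<longrightarrow> AllN x \<phi>)" by (rule ent_imp)
  then show ?thesis by (rule ent.Mp[OF ent_mono ent_AllN[OF assms(1,2)]]) simp
qed

lemma ent_AllS_fresh:
  assumes "ent T \<Gamma> (subS X Z \<phi>)" "\<forall>\<psi>\<in>\<Gamma>. Z \<notin> fvS \<psi>" "Z \<notin> fvS \<phi>" "Z \<notin> bnS \<phi>"
  shows "ent T \<Gamma> (AllS X \<phi>)"
proof -
  let ?\<psi> = "AllS Z (subS X Z \<phi>)"
  have "ent T {?\<psi>} \<phi>"
    using ent_AllS_elim[of T "{?\<psi>}" Z "subS X Z \<phi>" X] free_forS_back[OF assms(3,4)]
      subS_subS_back[OF assms(3,4)] by (simp add: ent.Hyp)
  moreover have "X \<notin> fvS ?\<psi>" using fvS_subS_fresh[of X Z \<phi>] by auto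
  ultimately have "ent T {?\<psi>} (AllS X \<phi>)" by (intro ent_AllS) auto
  then have "ent T {} (?\<psi> \<^bold>\<longrightarrow> AllS X \<phi>)" by (rule ent_imp)
  then show ?thesis by (rule ent.Mp[OF ent_mono ent_AllS[OF assms(1,2)]]) simp
qed

lemma ent_ccontr: "ent T (insert (\<^bold>\<not> \<phi>) \<Gamma>) Falsity \<Longrightarrow> ent T \<Gamma> \<phi>"
  by (rule ent.Mp[OF ent.Thm[OF proves.DNeg] ent_imp])

section \<open>Completeness\<close>

text \<open>Names beginning with an exclamation mark are reserved for Henkin witnesses. Formulas without
  reserved names never capture a witness, so no renaming of bound variables is needed.\<close>

definition witnesses :: "name set" where
  "witnesses = range (Cons (CHR ''!''))"

definition unreserved :: "fm \<Rightarrow> bool" where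
  "unreserved \<phi> \<longleftrightarrow> (fvN \<phi> \<union> bnN \<phi> \<union> fvS \<phi> \<union> bnS \<phi>) \<inter> witnesses = {}"

instance tm :: countable by countable_datatype
instance fm :: countable by countable_datatype

lemma infinite_witnesses: "infinite witnesses"
proof -
  have "infinite (UNIV :: name set)" by (rule infinite_UNIV_listI)
  then show ?thesis unfolding witnesses_def by (simp add: finite_image_iff)
qed

lemma ex_fresh_witness: "finite A \<Longrightarrow> \<exists>w\<in>witnesses. w \<notin> A"
  using infinite_witnesses by (meson finite_subset subsetI)

text \<open>The counterexample to a refuted universal formula is part of the condition, so a set
  that decides everything is at once complete and equipped with Henkin witnesses. Being monotone,
  the condition survives later extensions.\<close>

definition decides :: "fm set \<Rightarrow> fm \<Rightarrow> bool" where
  "decides H \<phi> \<longleftrightarrow> \<phi> \<in> H \<or> (\<^bold>\<not> \<phi>) \<in> H \<and>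
    (\<forall>x \<psi>. \<phi> = AllN x \<psi> \<longrightarrow> (\<exists>w\<in>witnesses. (\<^bold>\<not> subN x (V w) \<psi>) \<in> H)) \<and>
    (\<forall>X \<psi>. \<phi> = AllS X \<psi> \<longrightarrow> (\<exists>Z\<in>witnesses. (\<^bold>\<not> subS X Z \<psi>) \<in> H))"

lemma decides_mono: "decides G \<phi> \<Longrightarrow> G \<subseteq> H \<Longrightarrow> decides H \<phi>"
  unfolding decides_def by blast

text \<open>A refuted universal formula receives a counterexample under a name not occurring so far.
  If that were inconsistent, the instance at the fresh name would be derivable, and so would the
  universal formula itself.\<close>

lemma ex_decides:
  assumes "finite \<Gamma>" "\<not> ent T \<Gamma> Falsity"
  shows "\<exists>\<Delta>. finite \<Delta> \<and> \<not> ent T \<Delta> Falsity \<and> \<Gamma> \<subseteq> \<Delta> \<and> decides \<Delta> \<phi>"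
proof (cases "ent T (insert \<phi> \<Gamma>) Falsity")
  case False
  then show ?thesis using assms by (intro exI[of _ "insert \<phi> \<Gamma>"]) (auto simp: decides_def)
next
  case True
  let ?\<Gamma> = "insert (\<^bold>\<not> \<phi>) \<Gamma>"
  have neg: "ent T \<Gamma> (\<^bold>\<not> \<phi>)" using True by (rule ent_imp)
  have con: "\<not> ent T ?\<Gamma> Falsity"
    using ent.Mp[OF ent_imp neg] assms(2) by blast
  have con2: "\<not> ent T ?\<Gamma> \<phi>"
    using ent.Mp[of T ?\<Gamma> \<phi> Falsity] ent.Hyp[of "\<^bold>\<not> \<phi>" ?\<Gamma> T] con by auto
  consider (N) x \<psi> where "\<phi> = AllN x \<psi>" | (S) X \<psi> where "\<phi> = AllS X \<psi>"
    | (other) "(\<forall>x \<psi>. \<phi> \<noteq> AllN x \<psi>) \<and> (\<forall>X \<psi>. \<phi> \<noteq> AllS X \<psi>)" by blast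
  then show ?thesis
  proof cases
    case N
    have fin: "finite ((\<Union>\<chi>\<in>?\<Gamma>. fvN \<chi>) \<union> fvN \<psi> \<union> bnN \<psi>)" using assms(1) by (simp add: finite_names)
    obtain w where w: "w \<in> witnesses" "w \<notin> (\<Union>\<chi>\<in>?\<Gamma>. fvN \<chi>) \<union> fvN \<psi> \<union> bnN \<psi>"
      using ex_fresh_witness[OF fin] by (elim bexE)
    have "\<not> ent T (insert (\<^bold>\<not> subN x (V w) \<psi>) ?\<Gamma>) Falsity"
    proof
      assume "ent T (insert (\<^bold>\<not> subN x (V w) \<psi>) ?\<Gamma>) Falsity"
      then have "ent T ?\<Gamma> (subN x (V w) \<psi>)" by (rule ent_ccontr)
      then have "ent T ?\<Gamma> (AllN x \<psi>)" by (rule ent_AllN_fresh) (use w in auto)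
      then show False using con2 N by simp
    qed
    then show ?thesis using assms(1) N w(1)
      by (intro exI[of _ "insert (\<^bold>\<not> subN x (V w) \<psi>) ?\<Gamma>"]) (auto simp: decides_def)
  next
    case S
    have fin: "finite ((\<Union>\<chi>\<in>?\<Gamma>. fvS \<chi>) \<union> fvS \<psi> \<union> bnS \<psi>)" using assms(1) by (simp add: finite_names)
    obtain Z where Z: "Z \<in> witnesses" "Z \<notin> (\<Union>\<chi>\<in>?\<Gamma>. fvS \<chi>) \<union> fvS \<psi> \<union> bnS \<psi>"
      using ex_fresh_witness[OF fin] by (elim bexE)
    have "\<not> ent T (insert (\<^bold>\<not> subS X Z \<psi>) ?\<Gamma>) Falsity"
    proof
      assume "ent T (insert (\<^bold>\<not> subS X Z \<psi>) ?\<Gamma>) Falsity"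
      then have "ent T ?\<Gamma> (subS X Z \<psi>)" by (rule ent_ccontr)
      then have "ent T ?\<Gamma> (AllS X \<psi>)" by (rule ent_AllS_fresh) (use Z in auto)
      then show False using con2 S by simp
    qed
    then show ?thesis using assms(1) S Z(1)
      by (intro exI[of _ "insert (\<^bold>\<not> subS X Z \<psi>) ?\<Gamma>"]) (auto simp: decides_def)
  next
    case other
    then show ?thesis using assms(1) con by (intro exI[of _ ?\<Gamma>]) (auto simp: decides_def)
  qed
qed

lemma ex_henkin_extension:
  assumes "finite \<Gamma>" "\<not> ent T \<Gamma> Falsity"
  shows "\<exists>H. \<Gamma> \<subseteq> H \<and> \<not> ent T H Falsity \<and> (\<forall>\<phi>. decides H \<phi>)"
proof -
  have "\<exists>f. \<forall>n. (finite (f n) \<and> \<not> ent T (f n) Falsity \<and> \<Gamma> \<subseteq> f n) \<and>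
      (f n \<subseteq> f (Suc n) \<and> decides (f (Suc n)) (from_nat n))"
  proof (rule dependent_nat_choice)
    show "\<exists>G. finite G \<and> \<not> ent T G Falsity \<and> \<Gamma> \<subseteq> G" using assms by blast
    show "\<exists>G'. (finite G' \<and> \<not> ent T G' Falsity \<and> \<Gamma> \<subseteq> G') \<and> G \<subseteq> G' \<and> decides G' (from_nat n)"
      if "finite G \<and> \<not> ent T G Falsity \<and> \<Gamma> \<subseteq> G" for G n
    proof -
      have "\<exists>\<Delta>. finite \<Delta> \<and> \<not> ent T \<Delta> Falsity \<and> G \<subseteq> \<Delta> \<and> decides \<Delta> (from_nat n)"
        by (rule ex_decides) (use that in auto)
      then show ?thesis using that by blast
    qed
  qed
  then obtain f where f: "\<And>n. \<not> ent T (f n) Falsity" "\<Gamma> \<subseteq> f 0" "\<And>n. f n \<subseteq> f (Suc n)"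
    "\<And>n. decides (f (Suc n)) (from_nat n)" by blast
  have mono: "mono f" using f(3) by (simp add: mono_iff_le_Suc)
  have "\<not> ent T (\<Union>n. f n) Falsity"
  proof
    assume "ent T (\<Union>n. f n) Falsity"
    from ent_finite[OF this] obtain \<Delta> where
      \<Delta>: "finite \<Delta>" "\<Delta> \<subseteq> (\<Union>n. f n)" "ent T \<Delta> Falsity" by blast
    have "\<exists>n. \<Delta> \<subseteq> f n" using \<Delta>(1,2)
    proof (induction rule: finite_induct)
      case (insert \<phi> \<Delta>)
      then obtain m n where "\<Delta> \<subseteq> f m" "\<phi> \<in> f n" by auto
      then have "insert \<phi> \<Delta> \<subseteq> f (max m n)"
        using monoD[OF mono max.cobounded1[of m n]] monoD[OF mono max.cobounded2[of n m]] by auto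
      then show ?case ..
    qed simp
    then show False using f(1) ent_mono[OF \<Delta>(3)] by blast
  qed
  moreover have "decides (\<Union>n. f n) \<phi>" for \<phi>
    using decides_mono[OF f(4)[of "to_nat \<phi>"]] by auto
  ultimately show ?thesis using f(2) by blast
qed

section \<open>Maximal consistent sets with witnesses\<close>

definition closed_tms :: "tm set" where
  "closed_tms = {t. vars t \<subseteq> witnesses}"

lemma sub_tm_idle: "x \<notin> vars u \<Longrightarrow> sub_tm x t u = u"
  by (induction u) auto

lemma ex_fresh_name: "finite A \<Longrightarrow> \<exists>x::name. x \<notin> A"
  using ex_fresh_witness by blast

locale henkin =
  fixes T H :: "fm set"
  assumes con: "\<not> ent T H Falsity"
    and dec: "decides H \<phi>"
begin

lemma mem_ent: "\<phi> \<in> H \<longleftrightarrow> ent T H \<phi>"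
proof
  assume "ent T H \<phi>"
  then have "(\<^bold>\<not> \<phi>) \<notin> H" using con ent.Mp[OF ent.Hyp[of "\<^bold>\<not> \<phi>"]] by blast
  then show "\<phi> \<in> H" using dec[of \<phi>] by (auto simp: decides_def)
qed (rule ent.Hyp)

lemma mem_thm: "T \<turnstile> \<phi> \<Longrightarrow> \<phi> \<in> H"
  by (simp add: mem_ent ent.Thm)

lemma mem_MP: "(\<phi> \<^bold>\<longrightarrow> \<psi>) \<in> H \<Longrightarrow> \<phi> \<in> H \<Longrightarrow> \<psi> \<in> H"
  unfolding mem_ent by (rule ent.Mp)

lemma Falsity_nmem: "Falsity \<notin> H"
  using con by (simp add: mem_ent)

lemma mem_Imp: "(\<phi> \<^bold>\<longrightarrow> \<psi>) \<in> H \<longleftrightarrow> (\<phi> \<in> H \<longrightarrow> \<psi> \<in> H)"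
proof
  assume "\<phi> \<in> H \<longrightarrow> \<psi> \<in> H"
  then consider "\<psi> \<in> H" | "(\<^bold>\<not> \<phi>) \<in> H" using dec[of \<phi>] by (auto simp: decides_def)
  then show "(\<phi> \<^bold>\<longrightarrow> \<psi>) \<in> H"
  proof cases
    case 1
    then show ?thesis by (rule mem_MP[OF mem_thm[OF proves.K]])
  next
    case 2
    have "ent T (insert \<phi> H) Falsity"
      using 2 by (intro ent.Mp[of _ _ \<phi> Falsity]) (auto intro: ent.Hyp)
    then have "ent T (insert \<phi> H) \<psi>"
      by (rule ent_ccontr[OF ent_mono]) blast
    then show ?thesis unfolding mem_ent by (rule ent_imp)
  qed
qed (auto intro: mem_MP)

lemma mem_AllN_elim: "AllN x \<phi> \<in> H \<Longrightarrow> free_forN t x \<phi> \<Longrightarrow> subN x t \<phi> \<in> H"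
  unfolding mem_ent by (rule ent_AllN_elim)

lemma mem_AllS_elim: "AllS X \<phi> \<in> H \<Longrightarrow> free_forS Z X \<phi> \<Longrightarrow> subS X Z \<phi> \<in> H"
  unfolding mem_ent by (rule ent_AllS_elim)

lemma mem_AllN_intro:
  assumes "\<And>w. w \<in> witnesses \<Longrightarrow> subN x (V w) \<phi> \<in> H"
  shows "AllN x \<phi> \<in> H"
proof (rule ccontr)
  assume "AllN x \<phi> \<notin> H"
  then obtain w where "w \<in> witnesses" "(\<^bold>\<not> subN x (V w) \<phi>) \<in> H"
    using dec[of "AllN x \<phi>"] by (auto simp: decides_def)
  then show False using mem_MP[OF _ assms] Falsity_nmem by blast
qed

lemma mem_AllS_intro:
  assumes "\<And>Z. Z \<in> witnesses \<Longrightarrow> subS X Z \<phi> \<in> H"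
  shows "AllS X \<phi> \<in> H"
proof (rule ccontr)
  assume "AllS X \<phi> \<notin> H"
  then obtain Z where "Z \<in> witnesses" "(\<^bold>\<not> subS X Z \<phi>) \<in> H"
    using dec[of "AllS X \<phi>"] by (auto simp: decides_def)
  then show False using mem_MP[OF _ assms] Falsity_nmem by blast
qed

lemma mem_EqSubst:
  "(s \<^bold>= t) \<in> H \<Longrightarrow> subN x s \<phi> \<in> H \<Longrightarrow> free_forN s x \<phi> \<Longrightarrow> free_forN t x \<phi> \<Longrightarrow> subN x t \<phi> \<in> H"
  by (rule mem_MP[OF mem_MP[OF mem_thm[OF proves.EqSubst]]])

lemma eq_refl: "(t \<^bold>= t) \<in> H"
  by (simp add: mem_thm proves.EqRefl)

lemma eq_sym:
  assumes "(s \<^bold>= t) \<in> H"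
  shows "(t \<^bold>= s) \<in> H"
proof -
  obtain x where x: "x \<notin> vars s" using ex_fresh_name[OF finite_vars] by blast
  then show ?thesis
    using mem_EqSubst[OF assms, of x "V x \<^bold>= s"] eq_refl by (simp add: sub_tm_idle)
qed

lemma eq_trans:
  assumes "(s \<^bold>= t) \<in> H" "(t \<^bold>= u) \<in> H"
  shows "(s \<^bold>= u) \<in> H"
proof -
  obtain x where x: "x \<notin> vars s" using ex_fresh_name[OF finite_vars] by blast
  then show ?thesis
    using mem_EqSubst[OF assms(2), of x "s \<^bold>= V x"] assms(1) by (simp add: sub_tm_idle)
qed

text \<open>The arguments are exchanged one at a time, by substitution in a template that marks the
  place with a fresh variable.\<close>

lemma eq_congs:
  assumes "(s \<^bold>= s') \<in> H" "(t \<^bold>= t') \<in> H"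
  shows "(s \<^bold>+ t \<^bold>= s' \<^bold>+ t') \<in> H" "(s \<^bold>* t \<^bold>= s' \<^bold>* t') \<in> H"
    "(s \<^bold>< t) \<in> H \<Longrightarrow> (s' \<^bold>< t') \<in> H" "(s \<^bold>\<in> X) \<in> H \<Longrightarrow> (s' \<^bold>\<in> X) \<in> H"
proof -
  have "finite (vars s \<union> vars s' \<union> vars t \<union> vars t')" by (simp add: finite_vars)
  from ex_fresh_name[OF this] obtain x where x: "x \<notin> vars s \<union> vars s' \<union> vars t \<union> vars t'" ..
  show "(s \<^bold>+ t \<^bold>= s' \<^bold>+ t') \<in> H"
    using mem_EqSubst[OF assms(1), of x "s \<^bold>+ t \<^bold>= V x \<^bold>+ t"]
      mem_EqSubst[OF assms(2), of x "s \<^bold>+ t \<^bold>= s' \<^bold>+ V x"] eq_refl x by (simp add: sub_tm_idle)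
  show "(s \<^bold>* t \<^bold>= s' \<^bold>* t') \<in> H"
    using mem_EqSubst[OF assms(1), of x "s \<^bold>* t \<^bold>= V x \<^bold>* t"]
      mem_EqSubst[OF assms(2), of x "s \<^bold>* t \<^bold>= s' \<^bold>* V x"] eq_refl x by (simp add: sub_tm_idle)
  show "(s' \<^bold>< t') \<in> H" if "(s \<^bold>< t) \<in> H"
    using mem_EqSubst[OF assms(1), of x "V x \<^bold>< t"]
      mem_EqSubst[OF assms(2), of x "s' \<^bold>< V x"] that x by (simp add: sub_tm_idle)
  show "(s' \<^bold>\<in> X) \<in> H" if "(s \<^bold>\<in> X) \<in> H"
    using mem_EqSubst[OF assms(1), of x "V x \<^bold>\<in> X"] that x by (simp add: sub_tm_idle)
qed

end

section \<open>The term model and its truth lemma\<close>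

primrec depth :: "fm \<Rightarrow> nat" where
  "depth (s \<^bold>= t) = 0"
| "depth (s \<^bold>< t) = 0"
| "depth (t \<^bold>\<in> X) = 0"
| "depth Falsity = 0"
| "depth (\<phi> \<^bold>\<longrightarrow> \<psi>) = Suc (depth \<phi> + depth \<psi>)"
| "depth (AllN x \<phi>) = Suc (depth \<phi>)"
| "depth (AllS X \<phi>) = Suc (depth \<phi>)"

lemma depth_sub [simp]: "depth (subN x t \<phi>) = depth \<phi>" "depth (subS X Z \<phi>) = depth \<phi>"
  by (induction \<phi>) auto

lemma bn_sub [simp]: "bnN (subN x t \<phi>) = bnN \<phi>" "bnS (subN x t \<phi>) = bnS \<phi>"
    "bnN (subS X Z \<phi>) = bnN \<phi>" "bnS (subS X Z \<phi>) = bnS \<phi>"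
  by (induction \<phi>) auto

lemma vars_sub_tm: "y \<in> vars (sub_tm x t u) \<Longrightarrow> y \<in> vars u \<and> y \<noteq> x \<or> y \<in> vars t"
  by (induction u) (auto split: if_splits)

lemma fvN_subN: "fvN (subN x t \<phi>) \<subseteq> (fvN \<phi> - {x}) \<union> vars t"
  by (induction \<phi>) (auto dest!: vars_sub_tm)

lemma fvS_subN [simp]: "fvS (subN x t \<phi>) = fvS \<phi>"
  by (induction \<phi>) auto

lemma fvN_subS [simp]: "fvN (subS X Z \<phi>) = fvN \<phi>"
  by (induction \<phi>) auto

lemma fvS_subS: "fvS (subS X Z \<phi>) \<subseteq> (fvS \<phi> - {X}) \<union> {Z}"
  by (induction \<phi>) auto

text \<open>Free variables act as constants and bound ones are never witnesses, so closed terms can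
  be substituted without capture.\<close>

definition witness_sentence :: "fm \<Rightarrow> bool" where
  "witness_sentence \<phi> \<longleftrightarrow> fvN \<phi> \<subseteq> witnesses \<and> fvS \<phi> \<subseteq> witnesses \<and>
    bnN \<phi> \<inter> witnesses = {} \<and> bnS \<phi> \<inter> witnesses = {}"

text \<open>The quotient by the equations in \<open>H\<close> is presented as a map onto an
  arbitrary type, so that the model can be placed on a prescribed carrier.\<close>

locale term_model = henkin +
  fixes cls :: "tm \<Rightarrow> 'a"
  assumes cls_surj: "\<exists>t\<in>closed_tms. cls t = a"
    and cls_eq: "s \<in> closed_tms \<Longrightarrow> t \<in> closed_tms \<Longrightarrow> cls s = cls t \<longleftrightarrow> (s \<^bold>= t) \<in> H"
begin

definition rep :: "'a \<Rightarrow> tm" where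
  "rep a = (SOME t. t \<in> closed_tms \<and> cls t = a)"

text \<open>Sets need no quotient: the language has no equality of sets, so witnesses with the same
  extension cannot be told apart.\<close>

definition ext :: "name \<Rightarrow> 'a set" where
  "ext X = {cls t | t. t \<in> closed_tms \<and> (t \<^bold>\<in> X) \<in> H}"

definition model :: "'a struct" where
  "model = \<lparr>zer = cls Zero, uni = cls One, pls = (\<lambda>a b. cls (rep a \<^bold>+ rep b)),
    tms = (\<lambda>a b. cls (rep a \<^bold>* rep b)), les = (\<lambda>a b. (rep a \<^bold>< rep b) \<in> H), sts = ext ` witnesses\<rparr>"

lemma rep: "rep a \<in> closed_tms" "cls (rep a) = a"
  using someI_ex[of "\<lambda>t. t \<in> closed_tms \<and> cls t = a"] cls_surj[of a] unfolding rep_def by auto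

lemma rep_cls: "t \<in> closed_tms \<Longrightarrow> (rep (cls t) \<^bold>= t) \<in> H" "t \<in> closed_tms \<Longrightarrow> (t \<^bold>= rep (cls t)) \<in> H"
  using cls_eq rep by metis+

lemma val_model: "t \<in> closed_tms \<Longrightarrow> val model t (\<lambda>x. cls (V x)) = cls t"
proof (induction t)
  case (Plus s t)
  then have "s \<in> closed_tms" "t \<in> closed_tms" by (auto simp: closed_tms_def)
  moreover have "rep (cls s) \<^bold>+ rep (cls t) \<in> closed_tms"
    using rep by (simp add: closed_tms_def)
  ultimately show ?case using Plus eq_congs(1)[OF rep_cls(1) rep_cls(1)]
    by (simp add: model_def cls_eq)
next
  case (Times s t)
  then have "s \<in> closed_tms" "t \<in> closed_tms" by (auto simp: closed_tms_def)
  moreover have "rep (cls s) \<^bold>* rep (cls t) \<in> closed_tms"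
    using rep by (simp add: closed_tms_def)
  ultimately show ?case using Times eq_congs(2)[OF rep_cls(1) rep_cls(1)]
    by (simp add: model_def cls_eq)
qed (auto simp: model_def)

text \<open>Induction on \<open>depth\<close>, because the instances of a quantified formula are not
  its subformulas but have smaller depth.\<close>

lemma sat_model: "witness_sentence \<phi> \<Longrightarrow> sat model \<phi> (\<lambda>x. cls (V x)) ext \<longleftrightarrow> \<phi> \<in> H"
proof (induction "depth \<phi>" arbitrary: \<phi> rule: less_induct)
  case less
  show ?case
  proof (cases \<phi>)
    case (Eq s t)
    then have "s \<in> closed_tms" "t \<in> closed_tms"
      using less.prems by (auto simp: witness_sentence_def closed_tms_def)
    then show ?thesis using Eq by (simp add: val_model cls_eq)
  next
    case (Less s t)
    then have "s \<in> closed_tms" "t \<in> closed_tms"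
      using less.prems by (auto simp: witness_sentence_def closed_tms_def)
    moreover from this have "les model (cls s) (cls t) \<longleftrightarrow> (s \<^bold>< t) \<in> H"
      using eq_congs(3)[OF rep_cls(1) rep_cls(1)] eq_congs(3)[OF rep_cls(2) rep_cls(2)]
      by (auto simp: model_def)
    ultimately show ?thesis using Less by (simp add: val_model)
  next
    case (Mem t X)
    then have t: "t \<in> closed_tms"
      using less.prems by (auto simp: witness_sentence_def closed_tms_def)
    have "(t \<^bold>\<in> X) \<in> H" if mem: "cls t \<in> ext X"
    proof -
      obtain s where s: "s \<in> closed_tms" "cls t = cls s" "(s \<^bold>\<in> X) \<in> H"
        using mem by (auto simp: ext_def)
      then have "(s \<^bold>= t) \<in> H" using cls_eq[OF s(1) t] by simp
      then show ?thesis by (rule eq_congs(4)[OF _ eq_refl s(3)])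
    qed
    then have "cls t \<in> ext X \<longleftrightarrow> (t \<^bold>\<in> X) \<in> H" using t by (auto simp: ext_def)
    then show ?thesis using Mem t by (simp add: val_model)
  next
    case Falsity
    then show ?thesis by (simp add: Falsity_nmem)
  next
    case (Imp \<psi> \<chi>)
    then have "witness_sentence \<psi>" "witness_sentence \<chi>"
      using less.prems by (auto simp: witness_sentence_def)
    then show ?thesis using Imp less.hyps[of \<psi>] less.hyps[of \<chi>] by (simp add: mem_Imp)
  next
    case (AllN x \<psi>)
    have fr: "free_forN t x \<psi>" if "t \<in> closed_tms" for t
      using that less.prems AllN
      by (intro free_forN_fresh) (auto simp: closed_tms_def witness_sentence_def)
    have sub: "sat model \<psi> ((\<lambda>x. cls (V x))(x := cls t)) ext \<longleftrightarrow> subN x t \<psi> \<in> H"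
      if t: "t \<in> closed_tms" for t
    proof -
      have "witness_sentence (subN x t \<psi>)"
        using t less.prems AllN fvN_subN[of x t \<psi>]
        by (auto simp: closed_tms_def witness_sentence_def)
      then have "sat model (subN x t \<psi>) (\<lambda>x. cls (V x)) ext \<longleftrightarrow> subN x t \<psi> \<in> H"
        using AllN by (intro less.hyps) auto
      then show ?thesis using sat_subN[OF fr[OF t]] val_model[OF t] by metis
    qed
    have "sat model \<phi> (\<lambda>x. cls (V x)) ext \<longleftrightarrow> (\<forall>t\<in>closed_tms. subN x t \<psi> \<in> H)"
      unfolding AllN sat.simps using cls_surj sub by metis
    also have "\<dots> \<longleftrightarrow> AllN x \<psi> \<in> H"
    proof
      assume "\<forall>t\<in>closed_tms. subN x t \<psi> \<in> H"
      then show "AllN x \<psi> \<in> H" by (intro mem_AllN_intro) (auto simp: closed_tms_def)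
    qed (auto intro: mem_AllN_elim[OF _ fr])
    finally show ?thesis using AllN by simp
  next
    case (AllS X \<psi>)
    have fr: "free_forS Z X \<psi>" if "Z \<in> witnesses" for Z
      using that less.prems AllS by (intro free_forS_fresh) (auto simp: witness_sentence_def)
    have sub: "sat model \<psi> (\<lambda>x. cls (V x)) (ext(X := ext Z)) \<longleftrightarrow> subS X Z \<psi> \<in> H"
      if Z: "Z \<in> witnesses" for Z
    proof -
      have "witness_sentence (subS X Z \<psi>)"
        using Z less.prems AllS fvS_subS[of X Z \<psi>] by (auto simp: witness_sentence_def)
      then have "sat model (subS X Z \<psi>) (\<lambda>x. cls (V x)) ext \<longleftrightarrow> subS X Z \<psi> \<in> H"
        using AllS by (intro less.hyps) auto
      then show ?thesis using sat_subS[OF fr[OF Z]] by metis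
    qed
    have "sat model \<phi> (\<lambda>x. cls (V x)) ext \<longleftrightarrow> (\<forall>Z\<in>witnesses. subS X Z \<psi> \<in> H)"
      using sub by (simp add: AllS model_def)
    also have "\<dots> \<longleftrightarrow> AllS X \<psi> \<in> H"
      by (auto intro: mem_AllS_intro mem_AllS_elim[OF _ fr])
    finally show ?thesis using AllS by simp
  qed
qed

end

section \<open>Validity of the axioms and the size of the term model\<close>

lemma names_AllsN:
  "fvN (AllsN xs \<phi>) = fvN \<phi> - set xs" "fvS (AllsN xs \<phi>) = fvS \<phi>"
  "bnN (AllsN xs \<phi>) = set xs \<union> bnN \<phi>" "bnS (AllsN xs \<phi>) = bnS \<phi>"
  by (induction xs) auto

lemma names_AllsS:
  "fvN (AllsS Xs \<phi>) = fvN \<phi>" "fvS (AllsS Xs \<phi>) = fvS \<phi> - set Xs"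
  "bnN (AllsS Xs \<phi>) = bnN \<phi>" "bnS (AllsS Xs \<phi>) = set Xs \<union> bnS \<phi>"
  by (induction Xs) auto

lemma proves_AllsN: "T \<turnstile> \<phi> \<Longrightarrow> T \<turnstile> AllsN xs \<phi>"
  by (induction xs) (auto intro: proves.GenN)

lemma proves_AllsS: "T \<turnstile> \<phi> \<Longrightarrow> T \<turnstile> AllsS Xs \<phi>"
  by (induction Xs) (auto intro: proves.GenS)

lemma sat_AllsN_elim:
  "sat M (AllsN xs \<phi>) e E \<Longrightarrow> \<forall>x. x \<notin> set xs \<longrightarrow> e' x = e x \<Longrightarrow> sat M \<phi> e' E"
proof (induction xs arbitrary: e)
  case Nil
  then have "e' = e" by auto
  then show ?case using Nil by simp
next
  case (Cons x xs)
  have "sat M (AllsN xs \<phi>) (e(x := e' x)) E" using Cons.prems(1) by simp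
  then show ?case by (rule Cons.IH) (use Cons.prems(2) in auto)
qed

lemma sat_AllsS_elim:
  "sat M (AllsS Xs \<phi>) e E \<Longrightarrow> \<forall>X. X \<notin> set Xs \<longrightarrow> E' X = E X \<Longrightarrow> range E' \<subseteq> sts M \<Longrightarrow> sat M \<phi> e E'"
proof (induction Xs arbitrary: E)
  case Nil
  then have "E' = E" by auto
  then show ?case using Nil by simp
next
  case (Cons X Xs)
  have "E' X \<in> sts M" using Cons.prems(3) by auto
  then have "sat M (AllsS Xs \<phi>) e (E(X := E' X))" using Cons.prems(1) by simp
  then show ?case by (rule Cons.IH) (use Cons.prems in auto)
qed

text \<open>Truth is compared with \<open>H\<close> only for a \<open>witness_sentence\<close>. The
  axiom is therefore closed by quantifiers and opened again at the given assignment; the absence of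
  reserved names makes the closure such a sentence.\<close>

lemma (in term_model) valid_model:
  assumes "\<phi> \<in> T" "unreserved \<phi>"
  shows "valid model \<phi>"
  unfolding valid_def
proof (intro allI impI)
  fix e :: "name \<Rightarrow> 'a" and E :: "name \<Rightarrow> 'a set"
  assume E: "range E \<subseteq> sts model"
  obtain xs Xs where xs: "set xs = fvN \<phi>" "set Xs = fvS \<phi>"
    using finite_list finite_names by metis
  define \<psi> where "\<psi> = AllsN xs (AllsS Xs \<phi>)"
  have "\<psi> \<in> H" unfolding \<psi>_def
    by (rule mem_thm[OF proves_AllsN[OF proves_AllsS[OF proves.Axiom[OF assms(1)]]]])
  moreover have "witness_sentence \<psi>"
    using assms(2) xs unfolding \<psi>_def
    by (auto simp: witness_sentence_def unreserved_def names_AllsN names_AllsS)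
  ultimately have "sat model \<psi> (\<lambda>x. cls (V x)) ext" by (simp add: sat_model)
  then have 1: "sat model (AllsS Xs \<phi>) (\<lambda>x. if x \<in> set xs then e x else cls (V x)) ext"
    unfolding \<psi>_def by (rule sat_AllsN_elim) simp
  \<comment> \<open>The opened assignment agrees with \<open>e\<close> on the free variables of
    \<open>\<phi>\<close>, which is all that matters. Below, no set variable is free, so
    \<open>E\<close> may replace \<open>ext\<close>.\<close>
  have "sat model (AllsS Xs \<phi>) e ext" using 1
    by (rule iffD1[OF sat_cong, rotated -1]) (auto simp: names_AllsS xs)
  then have "sat model (AllsS Xs \<phi>) e E"
    by (rule iffD1[OF sat_cong, rotated -1]) (auto simp: names_AllsS xs)
  then show "sat model \<phi> e E" by (rule sat_AllsS_elim) (use E in auto)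
qed

primrec numeral_tm :: "nat \<Rightarrow> tm" where
  "numeral_tm 0 = Zero"
| "numeral_tm (Suc n) = numeral_tm n \<^bold>+ One"

lemma vars_numeral_tm [simp]: "vars (numeral_tm n) = {}"
  by (induction n) auto

text \<open>The first two basic axioms keep the numerals apart. Hence the term model is infinite and
  can be matched bijectively with a prescribed infinite countable type.\<close>

lemma (in henkin) numeral_tm_inject:
  assumes "basic_axioms \<subseteq> T" "(numeral_tm i \<^bold>= numeral_tm j) \<in> H"
  shows "i = j"
proof -
  have inst: "T \<turnstile> subN x t \<phi>" if "T \<turnstile> \<phi>" "vars t = {}" for x t \<phi>
    by (rule proves.MP[OF proves.InstN proves.GenN[OF that(1)]])
      (simp add: free_forN_fresh that(2))
  have mem: "subN x t (subN y s \<phi>) \<in> H" if "\<phi> \<in> basic_axioms" "vars s = {}" "vars t = {}" for x y s t \<phi>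
    by (rule mem_thm[OF inst[OF inst[OF proves.Axiom[OF subsetD[OF assms(1)]]]]]) fact+
  have suc0: "(numeral_tm (Suc i) \<^bold>= Zero) \<notin> H" for i
  proof
    assume 1: "(numeral_tm (Suc i) \<^bold>= Zero) \<in> H"
    have "subN ''m'' Zero (subN ''n'' (numeral_tm i) (\<^bold>\<not> (V ''n'' \<^bold>+ One \<^bold>= Zero))) \<in> H"
      by (rule mem) (auto simp: basic_axioms_def Let_def)
    then have "(\<^bold>\<not> (numeral_tm (Suc i) \<^bold>= Zero)) \<in> H" by (simp add: sub_tm_idle)
    from mem_MP[OF this 1] show False using Falsity_nmem by simp
  qed
  have sucsuc: "(numeral_tm i \<^bold>= numeral_tm j) \<in> H"
    if "(numeral_tm (Suc i) \<^bold>= numeral_tm (Suc j)) \<in> H" for i j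
  proof -
    have "subN ''m'' (numeral_tm i) (subN ''n'' (numeral_tm j)
        (V ''m'' \<^bold>+ One \<^bold>= V ''n'' \<^bold>+ One \<^bold>\<longrightarrow> V ''m'' \<^bold>= V ''n'')) \<in> H"
      by (rule mem) (auto simp: basic_axioms_def Let_def)
    then have "(numeral_tm (Suc i) \<^bold>= numeral_tm (Suc j) \<^bold>\<longrightarrow> numeral_tm i \<^bold>= numeral_tm j) \<in> H"
      by (simp add: sub_tm_idle)
    from mem_MP[OF this that] show ?thesis .
  qed
  show ?thesis using assms(2)
  proof (induction i arbitrary: j)
    case 0
    then show ?case using suc0 eq_sym by (cases j) auto
  next
    case (Suc i)
    then show ?case
    proof (cases j)
      case 0
      then show ?thesis using Suc.prems suc0[of i] by simp
    next
      case (Suc j')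
      then show ?thesis using Suc.IH[of j'] Suc.prems sucsuc[of i j'] by simp
    qed
  qed
qed

lemma (in henkin) ex_cls:
  assumes "basic_axioms \<subseteq> T" "infinite (UNIV :: 'a::countable set)"
  shows "\<exists>cls :: tm \<Rightarrow> 'a. (\<forall>a. \<exists>t\<in>closed_tms. cls t = a) \<and>
    (\<forall>s\<in>closed_tms. \<forall>t\<in>closed_tms. cls s = cls t \<longleftrightarrow> (s \<^bold>= t) \<in> H)"
proof -
  define q where "q t = {s. (t \<^bold>= s) \<in> H}" for t
  have q: "q s = q t \<longleftrightarrow> (s \<^bold>= t) \<in> H" for s t
  proof
    assume "q s = q t"
    then have "t \<in> q s" using eq_refl by (simp add: q_def)
    then show "(s \<^bold>= t) \<in> H" by (simp add: q_def)
  next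
    assume st: "(s \<^bold>= t) \<in> H"
    show "q s = q t" unfolding q_def using eq_trans[OF st] eq_trans[OF eq_sym[OF st]] by auto
  qed
  let ?Q = "q ` closed_tms"
  have "inj (\<lambda>n. q (numeral_tm n))"
    using numeral_tm_inject[OF assms(1)] by (auto simp: inj_def q)
  then have "infinite (range (\<lambda>n. q (numeral_tm n)))" by (rule range_inj_infinite)
  moreover have "range (\<lambda>n. q (numeral_tm n)) \<subseteq> ?Q" by (auto simp: closed_tms_def)
  ultimately have inf: "infinite ?Q" using finite_subset by blast
  have "bij_betw (to_nat_on ?Q) ?Q UNIV"
    using inf by (intro to_nat_on_infinite) auto
  moreover have "bij_betw (from_nat_into (UNIV :: 'a set)) UNIV UNIV"
    using assms(2) by (intro bij_betw_from_nat_into) auto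
  ultimately have bij: "bij_betw (from_nat_into (UNIV :: 'a set) \<circ> to_nat_on ?Q) ?Q UNIV"
    by (rule bij_betw_trans)
  define cls :: "tm \<Rightarrow> 'a" where "cls t = (from_nat_into UNIV \<circ> to_nat_on ?Q) (q t)" for t
  have "\<exists>t\<in>closed_tms. cls t = a" for a
  proof -
    have "a \<in> (from_nat_into UNIV \<circ> to_nat_on ?Q) ` ?Q" unfolding bij_betw_imp_surj_on[OF bij] ..
    then show ?thesis by (elim imageE) (auto simp: cls_def)
  qed
  moreover have "cls s = cls t \<longleftrightarrow> (s \<^bold>= t) \<in> H" if "s \<in> closed_tms" "t \<in> closed_tms" for s t
    using inj_on_eq_iff[OF bij_betw_imp_inj_on[OF bij], of "q s" "q t"] that
    unfolding cls_def q by auto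
  ultimately show ?thesis by blast
qed

theorem ex_countermodel:
  assumes "infinite (UNIV :: 'a::countable set)" "basic_axioms \<subseteq> T"
    and "\<not> T \<turnstile> \<phi>" "unreserved \<phi>" "fvN \<phi> = {}" "fvS \<phi> = {}"
  shows "\<exists>M :: 'a struct. (\<forall>\<psi>\<in>T. unreserved \<psi> \<longrightarrow> valid M \<psi>) \<and> \<not> valid M \<phi>"
proof -
  have "\<not> ent T {\<^bold>\<not> \<phi>} Falsity"
    using ent_empty[OF ent_ccontr] assms(3) by blast
  then obtain H where H: "(\<^bold>\<not> \<phi>) \<in> H" "\<not> ent T H Falsity" "\<And>\<psi>. decides H \<psi>"
    using ex_henkin_extension[of "{\<^bold>\<not> \<phi>}" T] by auto
  then interpret henkin T H by unfold_locales
  obtain cls :: "tm \<Rightarrow> 'a" where cls: "\<And>a. \<exists>t\<in>closed_tms. cls t = a"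
    "\<And>s t. s \<in> closed_tms \<Longrightarrow> t \<in> closed_tms \<Longrightarrow> cls s = cls t \<longleftrightarrow> (s \<^bold>= t) \<in> H"
    using ex_cls[OF assms(2,1)] by blast
  interpret term_model T H cls by unfold_locales (use cls in auto)
  have "\<phi> \<notin> H" using mem_MP[OF H(1)] Falsity_nmem by blast
  moreover have "witness_sentence \<phi>"
    using assms(4-6) by (auto simp: witness_sentence_def unreserved_def)
  ultimately have nsat: "\<not> sat model \<phi> (\<lambda>x. cls (V x)) ext" by (simp add: sat_model)
  \<comment> \<open>For names that are not witnesses, \<open>ext\<close> may lie outside
    \<open>sts\<close>. As \<open>\<phi>\<close> is closed, a constant assignment inside
    \<open>sts\<close> refutes it as well.\<close>
  obtain w where w: "w \<in> witnesses" using ex_fresh_witness[of "{}"] by auto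
  have "sat model \<phi> (\<lambda>x. cls (V x)) ext = sat model \<phi> (\<lambda>x. cls (V x)) (\<lambda>_. ext w)"
    by (rule sat_cong) (use assms(5,6) in auto)
  then have "\<not> sat model \<phi> (\<lambda>x. cls (V x)) (\<lambda>_. ext w)" using nsat by simp
  moreover have "range (\<lambda>_. ext w) \<subseteq> sts model" using w by (auto simp: model_def)
  ultimately have "\<not> valid model \<phi>" unfolding valid_def by blast
  then show ?thesis using valid_model by blast
qed

section \<open>A fixed model\<close>

abbreviation chain_theorem :: fm where
  "chain_theorem \<equiv> AllsS [''R'', ''P'', ''T'', ''M''] (AllsN [''o'', ''e''] (
      countable_commutative_ring \<^bold>\<longrightarrow>
      \<^bold>\<not> ExS ''C'' (chain_of_ideals \<^bold>\<and> strictly_increasing) \<^bold>\<longrightarrow>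
      AllS ''C'' (chain_of_ideals \<^bold>\<and> increasing \<^bold>\<longrightarrow> stabilises)))"

text \<open>A copy of \<open>nat\<close>, since this type has to receive the possibly nonstandard
  arithmetic of a countermodel.\<close>

datatype hnat = Hnat (unHnat: nat)

instance hnat :: countable by countable_datatype

lemma infinite_hnat: "infinite (UNIV :: hnat set)"
proof -
  have "inj Hnat" by (simp add: inj_def)
  then have "infinite (range Hnat)" by (rule range_inj_infinite)
  then show ?thesis using finite_subset[OF subset_UNIV] by blast
qed

text \<open>The clause on \<open>sts\<close> excludes structures in which \<open>valid\<close> is
  vacuous.\<close>

definition admissible :: "'a struct \<Rightarrow> bool" where
  "admissible M \<longleftrightarrow> sts M \<noteq> {} \<and> (\<forall>\<phi>\<in>RCA0 \<union> ISigma02. unreserved \<phi> \<longrightarrow> valid M \<phi>)"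

definition standard :: "hnat struct" where
  "standard = \<lparr>zer = Hnat 0, uni = Hnat 1, pls = (\<lambda>a b. Hnat (unHnat a + unHnat b)),
    tms = (\<lambda>a b. Hnat (unHnat a * unHnat b)), les = (\<lambda>a b. unHnat a < unHnat b), sts = UNIV\<rparr>"

lemma free_forN_vars: "vars t \<subseteq> {x} \<Longrightarrow> free_forN t x \<phi>"
  by (induction \<phi>) auto

lemma sat_induction_axiom:
  "sat M (induction_axiom x \<phi>) e E \<longleftrightarrow>
    (sat M \<phi> (e(x := zer M)) E \<longrightarrow>
     (\<forall>a. sat M \<phi> (e(x := a)) E \<longrightarrow> sat M \<phi> (e(x := pls M a (uni M))) E) \<longrightarrow>
     (\<forall>a. sat M \<phi> (e(x := a)) E))"
  by (auto simp: induction_axiom_def sat_subN free_forN_vars)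

text \<open>The choice made in \<open>ambient\<close> needs an admissible structure even when there
  is no countermodel. With all sets of numbers present, induction and comprehension hold for every
  formula.\<close>

lemma admissible_standard: "admissible standard"
proof -
  have "sat standard \<phi> e E" if "\<phi> \<in> basic_axioms" for \<phi> e E
    using that by (auto simp: basic_axioms_def Let_def standard_def hnat.expand)
  moreover have "sat standard (induction_axiom x \<phi>) e E" for x \<phi> e E
    unfolding sat_induction_axiom
  proof (intro impI allI)
    fix a
    assume zero: "sat standard \<phi> (e(x := zer standard)) E"
      and suc: "\<forall>a. sat standard \<phi> (e(x := a)) E \<longrightarrow>
        sat standard \<phi> (e(x := pls standard a (uni standard))) E"
    have "sat standard \<phi> (e(x := Hnat n)) E" for n
    proof (induction n)
      case 0
      show "sat standard \<phi> (e(x := Hnat 0)) E" using zero by (simp add: standard_def)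
    next
      case (Suc n)
      from Suc.IH have "sat standard \<phi> (e(x := Hnat n)) E" .
      then show "sat standard \<phi> (e(x := Hnat (Suc n))) E"
        using suc[rule_format, of "Hnat n"] by (simp add: standard_def)
    qed
    then show "sat standard \<phi> (e(x := a)) E" by (metis hnat.collapse)
  qed
  moreover have "sat standard (ExS X (AllN x (V x \<^bold>\<in> X \<^bold>\<longleftrightarrow> \<phi>))) e E" if "X \<notin> fvS \<phi>" for X x \<phi> e E
  proof -
    let ?A = "{a. sat standard \<phi> (e(x := a)) E}"
    have "sat standard \<phi> (e(x := a)) (E(X := ?A)) \<longleftrightarrow> a \<in> ?A" for a
    proof -
      have "sat standard \<phi> (e(x := a)) (E(X := ?A)) = sat standard \<phi> (e(x := a)) E"
        by (rule sat_cong) (use that in auto)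
      then show ?thesis by simp
    qed
    then have "sat standard (AllN x (V x \<^bold>\<in> X \<^bold>\<longleftrightarrow> \<phi>)) e (E(X := ?A))" by simp
    moreover have "?A \<in> sts standard" by (simp add: standard_def)
    ultimately show ?thesis unfolding sat.simps by blast
  qed
  ultimately show ?thesis
    unfolding admissible_def valid_def RCA0_def ISigma02_def Sigma0_induction_def
      Delta01_comprehension_def by (auto simp: standard_def)
qed

text \<open>The type \<open>hnat\<close> carries a countermodel to the theorem if there is one, so that its arithmetic
  can be turned into an instance of the arithmetic type classes.\<close>

definition ambient :: "hnat struct" where
  "ambient = (SOME M. admissible M \<and>
    (valid M chain_theorem \<longrightarrow> (\<forall>N :: hnat struct. admissible N \<longrightarrow> valid N chain_theorem)))"

lemma ambient: "admissible ambient"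
    "valid ambient chain_theorem \<Longrightarrow> admissible N \<Longrightarrow> valid (N :: hnat struct) chain_theorem"
proof -
  have "\<exists>M :: hnat struct. admissible M \<and>
      (valid M chain_theorem \<longrightarrow> (\<forall>N :: hnat struct. admissible N \<longrightarrow> valid N chain_theorem))"
  proof (cases "\<forall>N :: hnat struct. admissible N \<longrightarrow> valid N chain_theorem")
    case True
    then show ?thesis using admissible_standard by blast
  next
    case False
    then show ?thesis by blast
  qed
  from someI_ex[OF this, folded ambient_def]
  show "admissible ambient"
    "valid ambient chain_theorem \<Longrightarrow> admissible N \<Longrightarrow> valid (N :: hnat struct) chain_theorem"
    by blast+
qed

instantiation hnat :: "{zero, one, plus, times, ord}"
begin
definition zero_hnat :: hnat where "0 = zer ambient"
definition one_hnat :: hnat where "1 = uni ambient"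
definition plus_hnat :: "hnat \<Rightarrow> hnat \<Rightarrow> hnat" where "a + b = pls ambient a b"
definition times_hnat :: "hnat \<Rightarrow> hnat \<Rightarrow> hnat" where "a * b = tms ambient a b"
definition less_hnat :: "hnat \<Rightarrow> hnat \<Rightarrow> bool" where "a < b \<longleftrightarrow> les ambient a b"
definition less_eq_hnat :: "hnat \<Rightarrow> hnat \<Rightarrow> bool" where "(a :: hnat) \<le> b \<longleftrightarrow> a < b \<or> a = b"
instance ..
end

definition hsets :: "hnat set set" where "hsets = sts ambient"

lemmas ambient_ops [simp] = zero_hnat_def [symmetric] one_hnat_def [symmetric]
  plus_hnat_def [symmetric] times_hnat_def [symmetric] less_hnat_def [symmetric] hsets_def [symmetric]

lemma ambient_axiom:
  "\<phi> \<in> RCA0 \<union> ISigma02 \<Longrightarrow> unreserved \<phi> \<Longrightarrow> range E \<subseteq> hsets \<Longrightarrow> sat ambient \<phi> e E"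
  using ambient(1) by (auto simp: admissible_def valid_def)

lemma hsets_nonempty: "\<exists>X. X \<in> hsets"
  using ambient(1) by (auto simp: admissible_def)

section \<open>Definability with parameters\<close>

primrec ren_tm :: "(name \<Rightarrow> name) \<Rightarrow> tm \<Rightarrow> tm" where
  "ren_tm f (V x) = V (f x)"
| "ren_tm f Zero = Zero"
| "ren_tm f One = One"
| "ren_tm f (s \<^bold>+ t) = ren_tm f s \<^bold>+ ren_tm f t"
| "ren_tm f (s \<^bold>* t) = ren_tm f s \<^bold>* ren_tm f t"

primrec ren :: "(name \<Rightarrow> name) \<Rightarrow> (name \<Rightarrow> name) \<Rightarrow> fm \<Rightarrow> fm" where
  "ren f g (s \<^bold>= t) = (ren_tm f s \<^bold>= ren_tm f t)"
| "ren f g (s \<^bold>< t) = (ren_tm f s \<^bold>< ren_tm f t)"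
| "ren f g (t \<^bold>\<in> X) = (ren_tm f t \<^bold>\<in> g X)"
| "ren f g Falsity = Falsity"
| "ren f g (\<phi> \<^bold>\<longrightarrow> \<psi>) = (ren f g \<phi> \<^bold>\<longrightarrow> ren f g \<psi>)"
| "ren f g (AllN x \<phi>) = AllN (f x) (ren f g \<phi>)"
| "ren f g (AllS X \<phi>) = AllS (g X) (ren f g \<phi>)"

lemma vars_ren_tm: "vars (ren_tm f t) = f ` vars t"
  by (induction t) auto

lemma val_ren_tm: "val M (ren_tm f t) e = val M t (e \<circ> f)"
  by (induction t) auto

lemma names_ren:
  "fvN (ren f g \<phi>) \<subseteq> f ` fvN \<phi>" "fvS (ren f g \<phi>) \<subseteq> g ` fvS \<phi>"
  "bnN (ren f g \<phi>) = f ` bnN \<phi>" "bnS (ren f g \<phi>) = g ` bnS \<phi>"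
  by (induction \<phi>) (auto simp: vars_ren_tm)

text \<open>Bound variables are renamed along with the free ones, so injectivity alone prevents
  capture.\<close>

lemma sat_ren:
  assumes "inj f" "inj g"
  shows "sat M (ren f g \<phi>) e E = sat M \<phi> (e \<circ> f) (E \<circ> g)"
proof (induction \<phi> arbitrary: e E)
  case (AllN x \<phi>)
  have "sat M (ren f g \<phi>) (e(f x := a)) E = sat M \<phi> ((e \<circ> f)(x := a)) (E \<circ> g)" for a
  proof -
    have eq: "(e \<circ> f)(x := a) = e(f x := a) \<circ> f" using assms(1) by (auto simp: fun_eq_iff inj_eq)
    show ?thesis unfolding eq by (rule AllN.IH)
  qed
  then show "sat M (ren f g (AllN x \<phi>)) e E = sat M (AllN x \<phi>) (e \<circ> f) (E \<circ> g)" by simp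
next
  case (AllS X \<phi>)
  have "sat M (ren f g \<phi>) e (E(g X := A)) = sat M \<phi> (e \<circ> f) ((E \<circ> g)(X := A))" for A
  proof -
    have eq: "(E \<circ> g)(X := A) = E(g X := A) \<circ> g" using assms(2) by (auto simp: fun_eq_iff inj_eq)
    show ?thesis unfolding eq by (rule AllS.IH)
  qed
  then show "sat M (ren f g (AllS X \<phi>)) e E = sat M (AllS X \<phi>) (e \<circ> f) (E \<circ> g)" by simp
qed (auto simp: val_ren_tm)

lemma bounded_fm_ren: "bounded_fm \<phi> \<Longrightarrow> inj f \<Longrightarrow> bounded_fm (ren f g \<phi>)"
  by (induction rule: bounded_fm.induct) (auto intro: bounded_fm.intros simp: vars_ren_tm inj_image_mem_iff)

lemma unreserved_ren:
  assumes "unreserved \<phi>" "\<And>x. x \<notin> witnesses \<Longrightarrow> f x \<notin> witnesses" "\<And>x. x \<notin> witnesses \<Longrightarrow> g x \<notin> witnesses"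
  shows "unreserved (ren f g \<phi>)"
proof -
  have f: "f ` A \<inter> witnesses = {}" if "A \<inter> witnesses = {}" for A using that assms(2) by auto
  have g: "g ` A \<inter> witnesses = {}" if "A \<inter> witnesses = {}" for A using that assms(3) by auto
  show ?thesis
    using assms(1) f[of "fvN \<phi>"] f[of "bnN \<phi>"] g[of "fvS \<phi>"] g[of "bnS \<phi>"] names_ren(1,2)[of f g \<phi>]
    unfolding unreserved_def names_ren(3,4) Int_Un_distrib2 Un_empty by (simp add: disjoint_iff subset_iff)
qed

text \<open>Predicates are taken on sequences: the \<open>i\<close>-th entry interprets the variable \<open>coord i\<close>, and all
  other variables are parameters. Under a quantifier the sequence is shifted, as with de Bruijn
  indices.\<close>

definition coord :: "nat \<Rightarrow> name" where
  "coord i = CHR ''x'' # replicate i (CHR ''x'')"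

lemma coord_eq [simp]: "coord i = coord j \<longleftrightarrow> i = j"
  by (auto simp: coord_def dest: arg_cong[of _ _ length])

lemma length_coord [simp]: "length (coord i) = Suc i"
  by (simp add: coord_def)

lemma Cons_coord: "c \<noteq> CHR ''x'' \<Longrightarrow> c # s \<noteq> coord i" "c \<noteq> CHR ''x'' \<Longrightarrow> c # s \<notin> range coord"
  by (auto simp: coord_def)

lemma witnesses_Cons [simp]: "c # s \<in> witnesses \<longleftrightarrow> c = CHR ''!''"
  by (auto simp: witnesses_def)

lemma coord_witnesses [simp]: "coord i \<notin> witnesses"
  by (simp add: coord_def)

definition env :: "(nat \<Rightarrow> 'a) \<Rightarrow> (name \<Rightarrow> 'a) \<Rightarrow> name \<Rightarrow> 'a" where
  "env e p s = (if s \<in> range coord then e (length s - 1) else p s)"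

lemma env_coord [simp]: "env e p (coord i) = e i"
  by (simp add: env_def)

lemma env_param [simp]: "s \<notin> range coord \<Longrightarrow> env e p s = p s"
  by (simp add: env_def)

lemma env_upd: "(env e p)(coord i := a) = env (e(i := a)) p"
  by (auto simp: env_def fun_eq_iff)

definition recoord :: "(nat \<Rightarrow> name) \<Rightarrow> (name \<Rightarrow> name) \<Rightarrow> name \<Rightarrow> name" where
  "recoord h k s = (if s \<in> range coord then h (length s - 1) else k s)"

lemma recoord_coord [simp]: "recoord h k (coord i) = h i"
  by (simp add: recoord_def)

lemma recoord_param [simp]: "s \<notin> range coord \<Longrightarrow> recoord h k s = k s"
  by (simp add: recoord_def)

lemma inj_recoord:
  assumes "inj h" "inj k" "\<And>i s. s \<notin> range coord \<Longrightarrow> h i \<noteq> k s"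
  shows "inj (recoord h k)"
proof (rule injI)
  fix s t
  assume eq: "recoord h k s = recoord h k t"
  show "s = t"
  proof (cases "s \<in> range coord"; cases "t \<in> range coord")
    assume "s \<in> range coord" "t \<in> range coord"
    then show ?thesis using eq assms(1) by (auto simp: inj_eq)
  next
    assume "s \<in> range coord" "t \<notin> range coord"
    then show ?thesis using eq assms(3) by auto
  next
    assume "s \<notin> range coord" "t \<in> range coord"
    then show ?thesis using eq assms(3)[of s] by (auto simp: eq_commute)
  next
    assume "s \<notin> range coord" "t \<notin> range coord"
    then show ?thesis using eq assms(2) by (simp add: inj_eq)
  qed
qed

lemma recoord_witnesses:
  "(\<And>i. h i \<notin> witnesses) \<Longrightarrow> (\<And>s. s \<notin> witnesses \<Longrightarrow> k s \<notin> witnesses) \<Longrightarrow> s \<notin> witnesses \<Longrightarrow>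
    recoord h k s \<notin> witnesses"
  by (auto simp: recoord_def)

definition rep_tm :: "(name \<Rightarrow> hnat) \<Rightarrow> tm \<Rightarrow> ((nat \<Rightarrow> hnat) \<Rightarrow> hnat) \<Rightarrow> bool" where
  "rep_tm p t f \<longleftrightarrow> vars t \<inter> witnesses = {} \<and> (\<forall>e. val ambient t (env e p) = f e)"

definition rep_fm ::
    "(name \<Rightarrow> hnat) \<Rightarrow> (name \<Rightarrow> hnat set) \<Rightarrow> fm \<Rightarrow> ((nat \<Rightarrow> hnat) \<Rightarrow> bool) \<Rightarrow> bool" where
  "rep_fm p E \<phi> P \<longleftrightarrow> bounded_fm \<phi> \<and> unreserved \<phi> \<and> range E \<subseteq> hsets \<and>
    (\<forall>e. sat ambient \<phi> (env e p) E = P e)"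

definition Tm :: "((nat \<Rightarrow> hnat) \<Rightarrow> hnat) \<Rightarrow> bool" where
  "Tm f \<longleftrightarrow> (\<exists>p t. rep_tm p t f)"

text \<open>Hiding the formula and its parameters lets closure properties be proved for predicates.
  Absence of reserved names is built in, so the axioms formed from these formulas hold in
  \<open>ambient\<close>.\<close>

definition Def0 :: "((nat \<Rightarrow> hnat) \<Rightarrow> bool) \<Rightarrow> bool" where
  "Def0 P \<longleftrightarrow> (\<exists>p E \<phi>. rep_fm p E \<phi> P)"

text \<open>Brings two formulas with unrelated parameters under one assignment: the parameter names
  of one get the prefix \<open>a\<close>, those of the other the prefix \<open>b\<close>.\<close>

definition merge :: "(name \<Rightarrow> 'a) \<Rightarrow> (name \<Rightarrow> 'a) \<Rightarrow> name \<Rightarrow> 'a" where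
  "merge u v s = (case s of [] \<Rightarrow> u [] | c # s' \<Rightarrow> if c = CHR ''a'' then u s' else v s')"

lemma merge_simps [simp]:
  "merge u v (CHR ''a'' # s) = u s" "merge u v (CHR ''b'' # s) = v s"
  by (auto simp: merge_def)

lemma range_merge: "range u \<subseteq> A \<Longrightarrow> range v \<subseteq> A \<Longrightarrow> range (merge u v) \<subseteq> A"
  by (auto simp: merge_def image_subset_iff split: list.split)

abbreviation tag :: "char \<Rightarrow> name \<Rightarrow> name" where
  "tag c \<equiv> recoord coord (Cons c)"

lemma inj_tag: "c \<noteq> CHR ''x'' \<Longrightarrow> inj (tag c)"
  by (rule inj_recoord) (auto simp: inj_def Cons_coord(1)[symmetric])

lemma env_merge_tag:
  "env e (merge p q) \<circ> tag (CHR ''a'') = env e p" "env e (merge p q) \<circ> tag (CHR ''b'') = env e q"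
  by (auto simp: fun_eq_iff recoord_def Cons_coord env_def)

lemma merge_Cons: "merge u v \<circ> Cons (CHR ''a'') = u" "merge u v \<circ> Cons (CHR ''b'') = v"
  by (auto simp: fun_eq_iff)

lemma tag_witnesses: "c \<noteq> CHR ''!'' \<Longrightarrow> s \<notin> witnesses \<Longrightarrow> tag c s \<notin> witnesses"
  by (rule recoord_witnesses) auto

lemma rep_tm_merge:
  "rep_tm p t f \<Longrightarrow> rep_tm (merge p q) (ren_tm (tag (CHR ''a'')) t) f"
  "rep_tm q t f \<Longrightarrow> rep_tm (merge p q) (ren_tm (tag (CHR ''b'')) t) f"
  using tag_witnesses
  by (auto simp: rep_tm_def val_ren_tm vars_ren_tm env_merge_tag disjoint_iff)

lemma rep_fm_ren:
  assumes "rep_fm p E \<phi> P" "inj f" "inj g" "\<And>x. x \<notin> witnesses \<Longrightarrow> f x \<notin> witnesses"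
    "\<And>x. x \<notin> witnesses \<Longrightarrow> g x \<notin> witnesses"
    "range F \<subseteq> hsets" "F \<circ> g = E" "\<And>e. env e q \<circ> f = env (\<sigma> e) p"
  shows "rep_fm q F (ren f g \<phi>) (\<lambda>e. P (\<sigma> e))"
proof -
  have "bounded_fm (ren f g \<phi>)" using assms(1,2) bounded_fm_ren by (simp add: rep_fm_def)
  moreover have "unreserved (ren f g \<phi>)"
    by (rule unreserved_ren) (use assms in \<open>simp_all add: rep_fm_def\<close>)
  moreover have "sat ambient (ren f g \<phi>) (env e q) F = P (\<sigma> e)" for e
    unfolding sat_ren[OF assms(2,3)] assms(7,8) using assms(1) by (simp add: rep_fm_def)
  ultimately show ?thesis using assms(6) by (simp add: rep_fm_def)
qed

lemma rep_fm_merge: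
  assumes "range E \<subseteq> hsets" "range F \<subseteq> hsets"
  shows "rep_fm p E \<phi> P \<Longrightarrow>
      rep_fm (merge p q) (merge E F) (ren (tag (CHR ''a'')) (Cons (CHR ''a'')) \<phi>) P"
    "rep_fm q F \<phi> P \<Longrightarrow>
      rep_fm (merge p q) (merge E F) (ren (tag (CHR ''b'')) (Cons (CHR ''b'')) \<phi>) P"
  using range_merge[OF assms]
  by (auto intro!: rep_fm_ren[where \<sigma> = "\<lambda>e. e"] simp: inj_tag merge_Cons env_merge_tag tag_witnesses)

lemma rep_fm_common:
  assumes "Def0 P" "Def0 Q"
  shows "\<exists>p E \<phi> \<psi>. rep_fm p E \<phi> P \<and> rep_fm p E \<psi> Q"
proof -
  obtain p E \<phi> q F \<psi> where 1: "rep_fm p E \<phi> P" and 2: "rep_fm q F \<psi> Q"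
    using assms by (auto simp: Def0_def)
  have R: "range E \<subseteq> hsets" "range F \<subseteq> hsets" using 1 2 by (auto simp: rep_fm_def)
  show ?thesis
    by (intro exI conjI) (rule rep_fm_merge(1)[OF R 1], rule rep_fm_merge(2)[OF R 2])
qed

lemma rep_tm_common:
  assumes "Tm f" "Tm g"
  shows "\<exists>p s t. rep_tm p s f \<and> rep_tm p t g"
proof -
  obtain p s q t where 1: "rep_tm p s f" and 2: "rep_tm q t g" using assms by (auto simp: Tm_def)
  show ?thesis
    by (intro exI conjI) (rule rep_tm_merge(1)[OF 1], rule rep_tm_merge(2)[OF 2])
qed

lemma rep_tm_fm_common:
  assumes "Tm f" "Def0 Q"
  shows "\<exists>p E t \<psi>. rep_tm p t f \<and> rep_fm p E \<psi> Q"
proof -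
  obtain p t q F \<psi> where 1: "rep_tm p t f" and 2: "rep_fm q F \<psi> Q"
    using assms by (auto simp: Def0_def Tm_def)
  have F: "range F \<subseteq> hsets" using 2 by (auto simp: rep_fm_def)
  show ?thesis
    by (intro exI conjI) (rule rep_tm_merge(1)[OF 1], rule rep_fm_merge(2)[OF F F 2])
qed

lemma Tm_var: "Tm (\<lambda>e. e i)"
  unfolding Tm_def rep_tm_def by (intro exI[of _ "\<lambda>_. 0"] exI[of _ "V (coord i)"]) simp

lemma Tm_const: "Tm (\<lambda>e. a)"
  unfolding Tm_def rep_tm_def by (intro exI[of _ "\<lambda>_. a"] exI[of _ "V ''a''"]) (simp add: Cons_coord)

lemma Tm_plus: "Tm f \<Longrightarrow> Tm g \<Longrightarrow> Tm (\<lambda>e. f e + g e)"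
proof -
  assume "Tm f" "Tm g"
  then obtain p s t where "rep_tm p s f" "rep_tm p t g" by (auto dest: rep_tm_common)
  then have "rep_tm p (s \<^bold>+ t) (\<lambda>e. f e + g e)" by (auto simp: rep_tm_def)
  then show ?thesis unfolding Tm_def by blast
qed

lemma Tm_times: "Tm f \<Longrightarrow> Tm g \<Longrightarrow> Tm (\<lambda>e. f e * g e)"
proof -
  assume "Tm f" "Tm g"
  then obtain p s t where "rep_tm p s f" "rep_tm p t g" by (auto dest: rep_tm_common)
  then have "rep_tm p (s \<^bold>* t) (\<lambda>e. f e * g e)" by (auto simp: rep_tm_def)
  then show ?thesis unfolding Tm_def by blast
qed

lemmas Tm_intros = Tm_var Tm_const Tm_plus Tm_times

lemma unreserved_simps [simp]:
  "unreserved (s \<^bold>= t) \<longleftrightarrow> vars s \<inter> witnesses = {} \<and> vars t \<inter> witnesses = {}"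
  "unreserved (s \<^bold>< t) \<longleftrightarrow> vars s \<inter> witnesses = {} \<and> vars t \<inter> witnesses = {}"
  "unreserved (t \<^bold>\<in> X) \<longleftrightarrow> vars t \<inter> witnesses = {} \<and> X \<notin> witnesses"
  "unreserved Falsity"
  "unreserved (\<phi> \<^bold>\<longrightarrow> \<psi>) \<longleftrightarrow> unreserved \<phi> \<and> unreserved \<psi>"
  "x \<notin> witnesses \<Longrightarrow> unreserved (AllN x \<phi>) \<longleftrightarrow> unreserved \<phi>"
  "X \<notin> witnesses \<Longrightarrow> unreserved (AllS X \<phi>) \<longleftrightarrow> unreserved \<phi>"
  by (auto simp: unreserved_def)

lemma unreserved_subN: "unreserved \<phi> \<Longrightarrow> vars t \<inter> witnesses = {} \<Longrightarrow> unreserved (subN x t \<phi>)"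
  using fvN_subN[of x t \<phi>] by (auto simp: unreserved_def)

lemma Def0_False: "Def0 (\<lambda>e. False)"
proof -
  \<comment> \<open>Even without set parameters an assignment into \<open>hsets\<close> must be
    supplied; any set will do.\<close>
  obtain X where "X \<in> hsets" using hsets_nonempty by blast
  then have "rep_fm p (\<lambda>_. X) Falsity (\<lambda>e. False)" for p
    by (auto simp: rep_fm_def intro: bounded_fm.intros)
  then show ?thesis unfolding Def0_def by blast
qed

lemma Def0_eq: "Tm f \<Longrightarrow> Tm g \<Longrightarrow> Def0 (\<lambda>e. f e = g e)"
proof -
  assume "Tm f" "Tm g"
  then obtain p s t where "rep_tm p s f" "rep_tm p t g" by (auto dest: rep_tm_common)
  moreover obtain X where "X \<in> hsets" using hsets_nonempty by blast
  ultimately have "rep_fm p (\<lambda>_. X) (s \<^bold>= t) (\<lambda>e. f e = g e)"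
    by (auto simp: rep_tm_def rep_fm_def intro: bounded_fm.intros)
  then show ?thesis unfolding Def0_def by blast
qed

lemma Def0_less: "Tm f \<Longrightarrow> Tm g \<Longrightarrow> Def0 (\<lambda>e. f e < g e)"
proof -
  assume "Tm f" "Tm g"
  then obtain p s t where "rep_tm p s f" "rep_tm p t g" by (auto dest: rep_tm_common)
  moreover obtain X where "X \<in> hsets" using hsets_nonempty by blast
  ultimately have "rep_fm p (\<lambda>_. X) (s \<^bold>< t) (\<lambda>e. f e < g e)"
    by (auto simp: rep_tm_def rep_fm_def intro: bounded_fm.intros)
  then show ?thesis unfolding Def0_def by blast
qed

lemma Def0_mem: "X \<in> hsets \<Longrightarrow> Tm f \<Longrightarrow> Def0 (\<lambda>e. f e \<in> X)"
proof -
  assume X: "X \<in> hsets" and "Tm f"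
  then obtain p t where "rep_tm p t f" by (auto simp: Tm_def)
  with X have "rep_fm p (\<lambda>_. X) (t \<^bold>\<in> ''a'') (\<lambda>e. f e \<in> X)"
    by (auto simp: rep_tm_def rep_fm_def intro: bounded_fm.intros)
  then show ?thesis unfolding Def0_def by blast
qed

lemma Def0_imp: "Def0 P \<Longrightarrow> Def0 Q \<Longrightarrow> Def0 (\<lambda>e. P e \<longrightarrow> Q e)"
proof -
  assume "Def0 P" "Def0 Q"
  then obtain p E \<phi> \<psi> where "rep_fm p E \<phi> P" "rep_fm p E \<psi> Q" by (auto dest: rep_fm_common)
  then have "rep_fm p E (\<phi> \<^bold>\<longrightarrow> \<psi>) (\<lambda>e. P e \<longrightarrow> Q e)"
    by (auto simp: rep_fm_def intro: bounded_fm.intros)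
  then show ?thesis unfolding Def0_def by blast
qed

lemma Def0_not: "Def0 P \<Longrightarrow> Def0 (\<lambda>e. \<not> P e)"
  using Def0_imp[OF _ Def0_False] by simp

lemma Def0_conj: "Def0 P \<Longrightarrow> Def0 Q \<Longrightarrow> Def0 (\<lambda>e. P e \<and> Q e)"
  using Def0_not[OF Def0_imp[OF _ Def0_not]] by simp

lemma Def0_disj: "Def0 P \<Longrightarrow> Def0 Q \<Longrightarrow> Def0 (\<lambda>e. P e \<or> Q e)"
  using Def0_imp[OF Def0_not, of P Q] by (simp add: disj_imp)

lemma Def0_le: "Tm f \<Longrightarrow> Tm g \<Longrightarrow> Def0 (\<lambda>e. f e \<le> g e)"
  unfolding less_eq_hnat_def by (intro Def0_disj Def0_less Def0_eq)

lemma Def0_reindex: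
  assumes "Def0 P" "inj h"
  shows "Def0 (\<lambda>e. P (\<lambda>i. e (h i)))"
proof -
  obtain p E \<phi> where \<phi>: "rep_fm p E \<phi> P" using assms by (auto simp: Def0_def)
  let ?f = "recoord (coord \<circ> h) id"
  have inj: "inj ?f"
    using assms(2) by (intro inj_recoord) (auto simp: inj_def)
  have "env e p \<circ> ?f = env (\<lambda>i. e (h i)) p" for e
    by (auto simp: fun_eq_iff recoord_def env_def)
  then have "rep_fm p E (ren ?f id \<phi>) (\<lambda>e. P (\<lambda>i. e (h i)))"
    using \<phi> inj by (intro rep_fm_ren[OF \<phi>]) (auto simp: rep_fm_def recoord_def)
  then show ?thesis unfolding Def0_def by blast
qed

lemma Def0_all:
  assumes "Tm f" "Def0 (\<lambda>e. Q (\<lambda>i. e (Suc i)) (e 0))"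
  shows "Def0 (\<lambda>e. \<forall>y. y < f e \<longrightarrow> Q e y)"
proof -
  obtain p E t \<phi> where t: "rep_tm p t f" and \<phi>: "rep_fm p E \<phi> (\<lambda>e. Q (\<lambda>i. e (Suc i)) (e 0))"
    using rep_tm_fm_common[OF assms] by blast
  let ?up = "recoord (\<lambda>i. coord (Suc i)) id"
  \<comment> \<open>In \<open>?\<psi>\<close> the bound variable occupies \<open>coord 0\<close>.
    Moving it to a name that is not a coordinate lets the other coordinates drop by one; the
    parameters get a prefix to avoid it, which \<open>p \<circ> tl\<close> strips again.\<close>
  let ?down = "recoord (case_nat (CHR ''c'' # coord 0) coord) (Cons (CHR ''c''))"
  let ?\<psi> = "AllN (coord 0) (V (coord 0) \<^bold>< ren_tm ?up t \<^bold>\<longrightarrow> \<phi>)"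
  have inj: "inj ?down"
    by (rule inj_recoord)
      (auto simp: inj_def Cons_coord Cons_coord(1)[symmetric] split: nat.splits)
  have up: "env e q \<circ> ?up = env (\<lambda>i. e (Suc i)) q" for e :: "nat \<Rightarrow> hnat" and q
    by (auto simp: fun_eq_iff recoord_def env_def)
  have down: "(env e (p \<circ> tl) \<circ> ?down)(coord 0 := a) = env (case_nat a e) p" for e a
    by (auto simp: fun_eq_iff recoord_def env_def Cons_coord split: nat.splits)
  have "coord 0 \<notin> vars (ren_tm ?up t)"
    by (auto simp: vars_ren_tm recoord_def split: if_splits)
  then have "bounded_fm ?\<psi>" using \<phi> by (auto simp: rep_fm_def intro: bounded_fm.intros)
  then have "bounded_fm (ren ?down id ?\<psi>)" using inj by (rule bounded_fm_ren)
  moreover have "unreserved ?\<psi>"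
  proof -
    have "vars (ren_tm ?up t) \<inter> witnesses = {}"
      using t by (auto simp: vars_ren_tm rep_tm_def recoord_def)
    then show ?thesis using \<phi> by (simp add: rep_fm_def)
  qed
  then have "unreserved (ren ?down id ?\<psi>)"
    by (rule unreserved_ren) (auto simp: recoord_def split: nat.split)
  moreover have "sat ambient (ren ?down id ?\<psi>) (env e (p \<circ> tl)) E \<longleftrightarrow> (\<forall>y. y < f e \<longrightarrow> Q e y)" for e
  proof -
    have "sat ambient (ren ?down id ?\<psi>) (env e (p \<circ> tl)) E \<longleftrightarrow>
        (\<forall>a. sat ambient (V (coord 0) \<^bold>< ren_tm ?up t \<^bold>\<longrightarrow> \<phi>) (env (case_nat a e) p) E)"
      unfolding sat_ren[OF inj inj_on_id] sat.simps(6) down comp_id ..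
    then show ?thesis using t \<phi> by (simp add: val_ren_tm up rep_tm_def rep_fm_def)
  qed
  ultimately have "rep_fm (p \<circ> tl) E (ren ?down id ?\<psi>) (\<lambda>e. \<forall>y. y < f e \<longrightarrow> Q e y)"
    using \<phi> unfolding rep_fm_def by blast
  then show ?thesis unfolding Def0_def by blast
qed

lemma Def0_ex:
  assumes "Tm f" "Def0 (\<lambda>e. Q (\<lambda>i. e (Suc i)) (e 0))"
  shows "Def0 (\<lambda>e. \<exists>y. y < f e \<and> Q e y)"
  using Def0_not[OF Def0_all[OF assms(1), of "\<lambda>e y. \<not> Q e y"]] Def0_not[OF assms(2)] by simp

section \<open>\<open>\<Sigma>\<^sup>0\<^sub>1\<close> predicates: induction and
  comprehension\<close>

definition Sig :: "((nat \<Rightarrow> hnat) \<Rightarrow> bool) \<Rightarrow> bool" where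
  "Sig P \<longleftrightarrow> (\<exists>Q. Def0 (\<lambda>e. Q (\<lambda>i. e (Suc i)) (e 0)) \<and> (\<forall>e. P e \<longleftrightarrow> (\<exists>y. Q e y)))"

lemma Def0_Sig: "Def0 P \<Longrightarrow> Sig P"
  unfolding Sig_def by (rule exI[of _ "\<lambda>e y. P e"]) (simp add: Def0_reindex)

lemma Sig_induct:
  assumes "Sig (\<lambda>e. P (e 0))" "P 0" "\<And>a. P a \<Longrightarrow> P (a + 1)"
  shows "P a"
proof -
  obtain Q where Q: "Def0 (\<lambda>e. Q (\<lambda>i. e (Suc i)) (e 0))" "\<And>e. P (e 0) \<longleftrightarrow> (\<exists>y. Q e y)"
    using assms(1) by (auto simp: Sig_def)
  obtain p E \<phi> where \<phi>: "rep_fm p E \<phi> (\<lambda>e. Q (\<lambda>i. e (Suc i)) (e 0))"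
    using Q(1) by (auto simp: Def0_def)
  \<comment> \<open>The existential witness takes \<open>coord 0\<close>, which moves the induction
    variable to \<open>coord 1\<close>; all further coordinates are frozen at 0.\<close>
  let ?\<psi> = "ExN (coord 0) \<phi>"
  let ?e = "env (\<lambda>_. 0) p"
  have P: "P a \<longleftrightarrow> sat ambient ?\<psi> (?e(coord 1 := a)) E" for a
    using \<phi> Q(2)[of "\<lambda>_. a"] Q(2)[of "\<lambda>i. ((\<lambda>_. 0)(1 := a)) (Suc i)"]
    by (simp add: env_upd rep_fm_def)
  have "Sigma0 1 ?\<psi>" using \<phi> unfolding rep_fm_def One_nat_def
    by (intro Sigma0_Pi0.intros) auto
  then have "induction_axiom (coord 1) ?\<psi> \<in> RCA0"
    by (auto simp: RCA0_def Sigma0_induction_def)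
  moreover have "unreserved (induction_axiom (coord 1) ?\<psi>)"
    using \<phi> by (simp add: induction_axiom_def rep_fm_def unreserved_subN del: subN.simps)
  ultimately have "sat ambient (induction_axiom (coord 1) ?\<psi>) ?e E"
    using \<phi> by (intro ambient_axiom) (auto simp: rep_fm_def)
  then show ?thesis using assms(2,3) unfolding sat_induction_axiom P[symmetric] by simp
qed

text \<open>\<open>Sigma0 2\<close> is a syntactic class: two unbounded quantifiers in front of a
  bounded formula. Hence the matrix must be \<open>Def0\<close>; a merely decidable one has to be
  turned into membership in a set beforehand.\<close>

lemma Sig2_induct:
  assumes "Def0 (\<lambda>e. Q (e 2) (e 1) (e 0))" "\<exists>y. \<forall>z. Q 0 y z"
    "\<And>a. \<exists>y. \<forall>z. Q a y z \<Longrightarrow> \<exists>y. \<forall>z. Q (a + 1) y z"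
  shows "\<exists>y. \<forall>z. Q a y z"
proof -
  obtain p E \<phi> where \<phi>: "rep_fm p E \<phi> (\<lambda>e. Q (e 2) (e 1) (e 0))"
    using assms(1) by (auto simp: Def0_def)
  let ?\<psi> = "ExN (coord 1) (AllN (coord 0) \<phi>)"
  let ?e = "env (\<lambda>_. 0) p"
  have P: "(\<exists>y. \<forall>z. Q a y z) \<longleftrightarrow> sat ambient ?\<psi> (?e(coord 2 := a)) E" for a
    using \<phi> by (simp add: env_upd rep_fm_def)
  have "Sigma0 2 ?\<psi>" using \<phi> unfolding rep_fm_def numeral_2_eq_2
    by (intro Sigma0_Pi0.intros) auto
  then have "induction_axiom (coord 2) ?\<psi> \<in> ISigma02"
    by (auto simp: ISigma02_def Sigma0_induction_def)
  moreover have "unreserved (induction_axiom (coord 2) ?\<psi>)"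
    using \<phi> by (simp add: induction_axiom_def rep_fm_def unreserved_subN del: subN.simps)
  ultimately have "sat ambient (induction_axiom (coord 2) ?\<psi>) ?e E"
    using \<phi> by (intro ambient_axiom) (auto simp: rep_fm_def)
  then show ?thesis using assms(2,3) unfolding sat_induction_axiom P[symmetric] by simp
qed

lemma comprehension:
  assumes "Sig (\<lambda>e. P (e 0))" "Sig (\<lambda>e. \<not> P (e 0))"
  shows "{a. P a} \<in> hsets"
proof -
  obtain Q Q' where Q: "Def0 (\<lambda>e. Q (\<lambda>i. e (Suc i)) (e 0))" "\<And>e. P (e 0) \<longleftrightarrow> (\<exists>y. Q e y)"
    and Q': "Def0 (\<lambda>e. Q' (\<lambda>i. e (Suc i)) (e 0))" "\<And>e. \<not> P (e 0) \<longleftrightarrow> (\<exists>y. Q' e y)"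
    using assms unfolding Sig_def by blast
  obtain p E \<phi> \<psi> where \<phi>: "rep_fm p E \<phi> (\<lambda>e. Q (\<lambda>i. e (Suc i)) (e 0))"
    and \<psi>: "rep_fm p E \<psi> (\<lambda>e. Q' (\<lambda>i. e (Suc i)) (e 0))"
    using rep_fm_common[OF Q(1) Q'(1)] by blast
  \<comment> \<open>The axiom needs a set variable that is neither free in \<open>\<phi>\<close> nor
    reserved; infinitely many names start with \<open>X\<close>.\<close>
  have "inj (Cons (CHR ''X''))" by (simp add: inj_def)
  then have "infinite (range (Cons (CHR ''X'')))"
    by (simp add: finite_image_iff infinite_UNIV_listI)
  then obtain X where X: "X \<in> range (Cons (CHR ''X''))" "X \<notin> fvS \<phi>"
    using finite_subset[OF _ finite_names(2)[of \<phi>]] by blast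
  \<comment> \<open>The universal form of the predicate is the negated existential form of its
    complement.\<close>
  let ?\<phi> = "ExN (coord 0) \<phi>" and ?\<psi> = "AllN (coord 0) (\<^bold>\<not> \<psi>)"
  let ?e = "env (\<lambda>_. 0) p"
  have P1: "sat ambient ?\<phi> (?e(coord 1 := a)) E \<longleftrightarrow> P a" for a
    using \<phi> Q(2)[of "\<lambda>_. a"] Q(2)[of "\<lambda>i. ((\<lambda>_. 0)(1 := a)) (Suc i)"]
    by (simp add: env_upd rep_fm_def)
  have P2: "sat ambient ?\<psi> (?e(coord 1 := a)) E \<longleftrightarrow> P a" for a
    using \<psi> Q'(2)[of "\<lambda>_. a"] Q'(2)[of "\<lambda>i. ((\<lambda>_. 0)(1 := a)) (Suc i)"]
    by (auto simp: env_upd rep_fm_def)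
  have "Sigma0 1 ?\<phi>" "Pi0 1 ?\<psi>" using \<phi> \<psi> unfolding rep_fm_def One_nat_def
    by (auto intro!: Sigma0_Pi0.intros bounded_fm.intros)
  then have "AllN (coord 1) (?\<phi> \<^bold>\<longleftrightarrow> ?\<psi>) \<^bold>\<longrightarrow> ExS X (AllN (coord 1) (V (coord 1) \<^bold>\<in> X \<^bold>\<longleftrightarrow> ?\<phi>)) \<in> RCA0"
    (is "?ax \<in> _") unfolding RCA0_def Delta01_comprehension_def using X(2) by fastforce
  moreover have "unreserved ?ax" using \<phi> \<psi> X(1) by (auto simp: rep_fm_def)
  ultimately have "sat ambient ?ax ?e E" using \<phi> by (intro ambient_axiom) (auto simp: rep_fm_def)
  moreover have "sat ambient (AllN (coord 1) (?\<phi> \<^bold>\<longleftrightarrow> ?\<psi>)) ?e E" using P1 P2 by simp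
  ultimately have "sat ambient (ExS X (AllN (coord 1) (V (coord 1) \<^bold>\<in> X \<^bold>\<longleftrightarrow> ?\<phi>))) ?e E"
    unfolding sat.simps(5)[of _ "AllN (coord 1) (?\<phi> \<^bold>\<longleftrightarrow> ?\<psi>)"] by (rule mp)
  then have "\<exists>A\<in>hsets. \<forall>a. a \<in> A \<longleftrightarrow> sat ambient ?\<phi> (?e(coord 1 := a)) (E(X := A))"
    unfolding sat.simps hsets_def val.simps fun_upd_same by blast
  then obtain A where A: "A \<in> hsets"
    "\<And>a. a \<in> A \<longleftrightarrow> sat ambient ?\<phi> (?e(coord 1 := a)) (E(X := A))" by blast
  have "sat ambient ?\<phi> (?e(coord 1 := a)) (E(X := A)) = sat ambient ?\<phi> (?e(coord 1 := a)) E" for a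
    by (rule sat_cong) (use X(2) in auto)
  then have "A = {a. P a}" using A(2) P1 by blast
  then show ?thesis using A(1) by simp
qed

section \<open>Arithmetic\<close>

lemmas Def0_intros = Def0_eq Def0_less Def0_le Def0_False Def0_imp Def0_not Def0_conj Def0_disj
  Def0_all Def0_ex Tm_intros

lemma hnat_basic:
  fixes a b :: hnat
  shows "a + 1 \<noteq> 0" "a + 1 = b + 1 \<Longrightarrow> a = b" "a + 0 = a" "a + (b + 1) = (a + b) + 1"
    "a * 0 = 0" "a * (b + 1) = a * b + a" "\<not> a < 0" "a < b + 1 \<longleftrightarrow> a < b \<or> a = b"
proof -
  obtain X where "X \<in> hsets" using hsets_nonempty by blast
  then have *: "sat ambient \<phi> ((\<lambda>_. a)(''m'' := a, ''n'' := b)) (\<lambda>_. X)"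
    "sat ambient \<phi> ((\<lambda>_. a)(''m'' := a, ''n'' := a)) (\<lambda>_. X)"
    if "\<phi> \<in> basic_axioms" "unreserved \<phi>" for \<phi>
    using that by (auto intro!: ambient_axiom simp: RCA0_def)
  show "a + 1 \<noteq> 0" using *(2)[of "\<^bold>\<not> (V ''n'' \<^bold>+ One \<^bold>= Zero)"] by (simp add: basic_axioms_def Let_def)
  show "a = b" if "a + 1 = b + 1"
    using *(1)[of "V ''m'' \<^bold>+ One \<^bold>= V ''n'' \<^bold>+ One \<^bold>\<longrightarrow> V ''m'' \<^bold>= V ''n''"] that
    by (simp add: basic_axioms_def Let_def)
  show "a + 0 = a" using *(1)[of "V ''m'' \<^bold>+ Zero \<^bold>= V ''m''"] by (simp add: basic_axioms_def Let_def)
  show "a + (b + 1) = (a + b) + 1"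
    using *(1)[of "V ''m'' \<^bold>+ (V ''n'' \<^bold>+ One) \<^bold>= (V ''m'' \<^bold>+ V ''n'') \<^bold>+ One"]
    by (simp add: basic_axioms_def Let_def)
  show "a * 0 = 0" using *(1)[of "V ''m'' \<^bold>* Zero \<^bold>= Zero"] by (simp add: basic_axioms_def Let_def)
  show "a * (b + 1) = a * b + a"
    using *(1)[of "V ''m'' \<^bold>* (V ''n'' \<^bold>+ One) \<^bold>= (V ''m'' \<^bold>* V ''n'') \<^bold>+ V ''m''"]
    by (simp add: basic_axioms_def Let_def)
  show "\<not> a < 0" using *(1)[of "\<^bold>\<not> (V ''m'' \<^bold>< Zero)"] by (simp add: basic_axioms_def Let_def)
  show "a < b + 1 \<longleftrightarrow> a < b \<or> a = b"
    using *(1)[of "V ''m'' \<^bold>< V ''n'' \<^bold>+ One \<^bold>\<longleftrightarrow>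
        (\<^bold>\<not> (V ''m'' \<^bold>< V ''n'') \<^bold>\<longrightarrow> V ''m'' \<^bold>= V ''n'')"]
    by (auto simp: basic_axioms_def Let_def)
qed

lemma Def0_induct:
  "Def0 (\<lambda>e. P (e 0)) \<Longrightarrow> P 0 \<Longrightarrow> (\<And>a. P a \<Longrightarrow> P (a + 1)) \<Longrightarrow> P a"
  by (rule Sig_induct[OF Def0_Sig])

lemma Sig_ex0: "Def0 (\<lambda>e. Q (\<lambda>i. e (Suc i)) (e 0)) \<Longrightarrow> Sig (\<lambda>e. \<exists>y. Q e y)"
  unfolding Sig_def by blast

lemma hnat_add_assoc: "(a + b) + c = a + (b + c :: hnat)"
  by (rule Def0_induct[of "\<lambda>c. (a + b) + c = a + (b + c)"]) (intro Def0_intros | simp add: hnat_basic(1,3-8))+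

lemma hnat_zero_add: "0 + a = (a :: hnat)"
  by (rule Def0_induct[of "\<lambda>a. 0 + a = a"]) (intro Def0_intros | simp add: hnat_basic(1,3-8))+

lemma hnat_suc_add: "(a + 1) + b = (a + b) + (1 :: hnat)"
  by (rule Def0_induct[of "\<lambda>b. (a + 1) + b = (a + b) + 1"]) (intro Def0_intros | simp add: hnat_basic(1,3-8))+

lemma hnat_add_commute: "a + b = b + (a :: hnat)"
  by (rule Def0_induct[of "\<lambda>b. a + b = b + a"])
    (intro Def0_intros | simp add: hnat_basic(1,3-8) hnat_zero_add hnat_suc_add)+

lemma hnat_add_left_commute: "b + (a + c) = a + (b + c :: hnat)"
  using hnat_add_assoc hnat_add_commute by metis

lemma hnat_zero_mult: "0 * a = (0 :: hnat)"
  by (rule Def0_induct[of "\<lambda>a. 0 * a = 0"]) (intro Def0_intros | simp add: hnat_basic(1,3-8))+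

lemma hnat_suc_mult: "(a + 1) * b = a * b + (b :: hnat)"
  by (rule Def0_induct[of "\<lambda>b. (a + 1) * b = a * b + b"])
    (intro Def0_intros | simp add: hnat_basic(1,3-8) hnat_add_assoc hnat_add_commute hnat_add_left_commute)+

lemma hnat_mult_commute: "a * b = b * (a :: hnat)"
  by (rule Def0_induct[of "\<lambda>b. a * b = b * a"])
    (intro Def0_intros | simp add: hnat_basic(1,3-8) hnat_zero_mult hnat_suc_mult)+

lemma hnat_distrib: "(a + b) * c = a * c + b * (c :: hnat)"
  by (rule Def0_induct[of "\<lambda>c. (a + b) * c = a * c + b * c"])
    (intro Def0_intros | simp add: hnat_basic(1,3-8) hnat_add_assoc hnat_add_commute hnat_add_left_commute)+

lemma hnat_mult_assoc: "(a * b) * c = a * (b * c :: hnat)"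
proof (rule Def0_induct[of "\<lambda>c. (a * b) * c = a * (b * c)"])
  fix c
  assume "(a * b) * c = a * (b * c)"
  moreover have "a * (b * c + b) = a * (b * c) + a * b"
    using hnat_distrib[of "b * c" b a] by (simp add: hnat_mult_commute)
  ultimately show "(a * b) * (c + 1) = a * (b * (c + 1))" by (simp add: hnat_basic(1,3-8))
qed (intro Def0_intros | simp add: hnat_basic(1,3-8))+

lemma hnat_add_cancel: "a + c = b + c \<Longrightarrow> a = (b :: hnat)"
proof -
  have "a + c = b + c \<longrightarrow> a = b"
    by (rule Def0_induct[of "\<lambda>c. a + c = b + c \<longrightarrow> a = b"])
      (intro Def0_intros | simp add: hnat_basic(3) | metis hnat_basic(2,4))+
  then show "a + c = b + c \<Longrightarrow> a = b" by blast
qed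

lemma hnat_cases: "a = 0 \<or> (\<exists>b::hnat. a = b + 1)"
proof -
  have "\<exists>b. a = 0 \<or> a = b + 1"
    by (rule Sig_induct[of "\<lambda>a. \<exists>b. a = 0 \<or> a = b + 1"])
      (intro Sig_ex0 Def0_intros | blast)+
  then show ?thesis by blast
qed

text \<open>The axioms fix the order only at zero and successors. Its additive description needs an
  existential induction, and the order laws follow from it.\<close>

lemma hnat_less_iff: "a < b \<longleftrightarrow> (\<exists>c::hnat. b = a + (c + 1))"
proof
  assume "\<exists>c. b = a + (c + 1)"
  then obtain c where "b = a + (c + 1)" ..
  moreover have "a < a + (c + 1)"
    by (rule Def0_induct[of "\<lambda>c. a < a + (c + 1)"])
      (intro Def0_intros | simp add: hnat_basic(1,3-8) hnat_zero_add)+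
  ultimately show "a < b" by simp
next
  have "\<exists>c. a < b \<longrightarrow> b = a + (c + 1)"
  proof (rule Sig_induct[of "\<lambda>b. \<exists>c. a < b \<longrightarrow> b = a + (c + 1)"])
    fix b
    assume "\<exists>c. a < b \<longrightarrow> b = a + (c + 1)"
    then obtain c where c: "a < b \<longrightarrow> b = a + (c + 1)" ..
    consider "a < b" | "a = b" | "\<not> a < b + 1" using hnat_basic(8) by blast
    then show "\<exists>c. a < b + 1 \<longrightarrow> b + 1 = a + (c + 1)"
    proof cases
      case 1
      then have "b + 1 = a + ((c + 1) + 1)" using c by (simp add: hnat_basic(1,3-8))
      then show ?thesis by blast
    next
      case 2
      then have "b + 1 = a + (0 + 1)" by (simp add: hnat_zero_add)
      then show ?thesis by blast
    qed simp
  qed (intro Sig_ex0 Def0_intros | simp add: hnat_basic(1,3-8))+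
  then show "a < b \<Longrightarrow> \<exists>c. b = a + (c + 1)" by blast
qed

lemma hnat_le_iff: "a \<le> b \<longleftrightarrow> (\<exists>c::hnat. b = a + c)"
  using hnat_cases by (metis hnat_basic(3) hnat_less_iff less_eq_hnat_def)

lemma hnat_less_irrefl: "\<not> a < (a :: hnat)"
proof
  assume "a < a"
  then obtain c where "a = a + (c + 1)" unfolding hnat_less_iff ..
  then have "0 + a = (c + 1) + a" by (simp only: hnat_zero_add hnat_add_commute[of "c + 1" a])
  then show False using hnat_add_cancel hnat_basic(1) by metis
qed

lemma hnat_less_trans: "a < b \<Longrightarrow> b < c \<Longrightarrow> a < (c :: hnat)"
  unfolding hnat_less_iff by (metis hnat_add_assoc)

lemma hnat_less_linear: "a < b \<or> a = b \<or> b < (a :: hnat)"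
proof (rule Def0_induct[of "\<lambda>a. a < b \<or> a = b \<or> b < a"])
  show "0 < b \<or> 0 = b \<or> b < 0"
    using hnat_cases[of b] hnat_less_iff[of 0 b] by (auto simp: hnat_zero_add)
next
  fix a
  assume "a < b \<or> a = b \<or> b < a"
  then consider "a < b" | "b < a + 1" using hnat_basic(8) by auto
  then show "a + 1 < b \<or> a + 1 = b \<or> b < a + 1"
  proof cases
    case 1
    then obtain c where c: "b = a + (c + 1)" using hnat_less_iff by blast
    show ?thesis
    proof (cases "c = 0")
      case True
      then show ?thesis using c by (simp add: hnat_zero_add)
    next
      case False
      then obtain d where "c = d + 1" using hnat_cases by blast
      then have "b = (a + 1) + (d + 1)" using c by (simp only: hnat_basic(4) hnat_suc_add[of a d])
      then show ?thesis using hnat_less_iff by blast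
    qed
  qed simp
qed (intro Def0_intros)

lemma hnat_add_eq_0: "a + b = 0 \<Longrightarrow> a = (0 :: hnat)"
  by (metis hnat_add_assoc hnat_add_commute hnat_basic(1) hnat_cases)

lemma hnat_mult_eq_0: "a * b = 0 \<Longrightarrow> a = 0 \<or> b = (0 :: hnat)"
  by (metis hnat_add_commute hnat_add_eq_0 hnat_basic(6) hnat_cases)

section \<open>The model as an ordered semiring with truncated subtraction\<close>

instantiation hnat :: linordered_semidom
begin

definition minus_hnat :: "hnat \<Rightarrow> hnat \<Rightarrow> hnat" where
  "(a :: hnat) - b = (if b \<le> a then THE c. a = b + c else 0)"

lemma hnat_add_diff: "(a + b) - a = (b :: hnat)"
proof -
  have "(THE c. a + b = a + c) = b"
    by (rule the_equality) (metis hnat_add_cancel hnat_add_commute)+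
  moreover have "a \<le> a + b" using hnat_le_iff by blast
  ultimately show ?thesis by (simp add: minus_hnat_def)
qed

lemma hnat_diff_eq_0: "\<not> b \<le> a \<Longrightarrow> a - b = (0 :: hnat)"
  by (simp add: minus_hnat_def)

lemma hnat_diff_le_0: "a \<le> b \<Longrightarrow> a - b = (0 :: hnat)"
proof (cases "b \<le> a")
  case True
  assume "a \<le> b"
  then have "a = b" using True hnat_less_trans hnat_less_irrefl by (metis less_eq_hnat_def)
  then show ?thesis using hnat_add_diff[of a 0] by (simp add: hnat_basic(1,3-8))
qed (simp add: hnat_diff_eq_0)

lemma hnat_linear: "a \<le> b \<or> b \<le> (a :: hnat)"
  using hnat_less_linear by (metis less_eq_hnat_def)

instance
proof
  fix a b c :: hnat
  show "a + b + c = a + (b + c)" by (rule hnat_add_assoc)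
  show "a + b = b + a" by (rule hnat_add_commute)
  show "0 + a = a" by (rule hnat_zero_add)
  show "(a + b) - a = b" by (rule hnat_add_diff)
  show "a - b - c = a - (b + c)"
  proof (cases "b + c \<le> a")
    case True
    then obtain d where "a = b + (c + d)" using hnat_le_iff hnat_add_assoc by metis
    then show ?thesis using hnat_add_diff hnat_add_assoc by metis
  next
    case False
    show ?thesis
    proof (cases "b \<le> a")
      case True
      then obtain d where d: "a = b + d" using hnat_le_iff by blast
      then have "\<not> c \<le> d" using False hnat_le_iff hnat_add_assoc by metis
      then show ?thesis using False d by (simp add: hnat_diff_eq_0 hnat_add_diff)
    next
      case bF: False
      have "0 \<le> c" unfolding hnat_le_iff using hnat_zero_add by metis
      then show ?thesis using bF False by (simp add: hnat_diff_eq_0 hnat_diff_le_0)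
    qed
  qed
  show "a * b * c = a * (b * c)" by (rule hnat_mult_assoc)
  show "a * b = b * a" by (rule hnat_mult_commute)
  show "1 * a = a" using hnat_suc_mult[of 0 a] by (simp add: hnat_zero_add hnat_zero_mult)
  show "(a + b) * c = a * c + b * c" by (rule hnat_distrib)
  show "a * (b + c) = a * b + a * c" using hnat_distrib[of b c a] by (simp add: hnat_mult_commute)
  show "0 * a = 0" by (rule hnat_zero_mult)
  show "a * 0 = 0" by (rule hnat_basic(5))
  show "a * (b - c) = a * b - a * c"
  proof (cases "c \<le> b")
    case True
    then obtain d where "b = c + d" using hnat_le_iff by blast
    then show ?thesis by (metis hnat_add_diff hnat_distrib hnat_mult_commute)
  next
    case False
    then have "b \<le> c" using hnat_linear by blast
    then obtain d where "c = b + d" using hnat_le_iff by blast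
    then have "a * b \<le> a * c" unfolding hnat_le_iff using hnat_distrib hnat_mult_commute by metis
    then show ?thesis using \<open>b \<le> c\<close> by (simp add: hnat_diff_le_0 hnat_basic)
  qed
  show "0 \<noteq> (1 :: hnat)" using hnat_basic(1)[of 0] by (simp add: hnat_zero_add)
  show "(0 :: hnat) < 1" using hnat_less_iff hnat_zero_add by metis
  show "(a < b) = (a \<le> b \<and> \<not> b \<le> a)"
    using hnat_less_trans hnat_less_irrefl by (metis less_eq_hnat_def)
  show "a \<le> a" by (simp add: less_eq_hnat_def)
  show "a \<le> b \<Longrightarrow> b \<le> c \<Longrightarrow> a \<le> c" using hnat_less_trans by (auto simp: less_eq_hnat_def)
  show "a \<le> b \<Longrightarrow> b \<le> a \<Longrightarrow> a = b"
    using hnat_less_trans hnat_less_irrefl by (metis less_eq_hnat_def)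
  show "a \<le> b \<or> b \<le> a" by (rule hnat_linear)
  show "a \<le> b \<Longrightarrow> c + a \<le> c + b" unfolding hnat_le_iff by (metis hnat_add_assoc)
  show "a < b \<Longrightarrow> 0 < c \<Longrightarrow> c * a < c * b"
  proof -
    assume "a < b" "0 < c"
    then obtain d k where d: "b = a + (d + 1)" "c = k + 1"
      unfolding hnat_less_iff hnat_zero_add by blast
    have "c * b = c * a + c * (d + 1)" using d(1) by (metis hnat_distrib hnat_mult_commute)
    also have "c * (d + 1) = c * d + c" by (rule hnat_basic(6))
    also have "c * d + c = c * d + (k + 1)" using d(2) by (rule arg_cong)
    also have "c * a + (c * d + (k + 1)) = c * a + ((c * d + k) + 1)"
      by (rule arg_cong[OF hnat_basic(4)])
    finally show "c * a < c * b" unfolding hnat_less_iff by blast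
  qed
  show "a \<noteq> 0 \<Longrightarrow> b \<noteq> 0 \<Longrightarrow> a * b \<noteq> 0" using hnat_mult_eq_0 by blast
  show "b \<le> a \<Longrightarrow> a - b + b = a"
    unfolding hnat_le_iff by (metis hnat_add_commute hnat_add_diff)
qed

end

lemma hnat_less_add_1: "a < b + 1 \<longleftrightarrow> a \<le> (b :: hnat)"
  by (simp add: hnat_basic(8) less_eq_hnat_def)

lemma hnat_add_1_le: "a + 1 \<le> b \<longleftrightarrow> a < (b :: hnat)"
  by (metis hnat_less_add_1 leD not_le_imp_less)

lemma hnat_zero_le: "0 \<le> (a :: hnat)"
  using hnat_basic(7) not_le_imp_less by blast

section \<open>Recursive functions and relations\<close>

text \<open>The coordinates from \<open>k\<close> on become parameters, named by prefixing a letter.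
  Inductions inside a predicate of sequences use this, because all but the first few arguments are
  constants there.\<close>

lemma Def0_fix:
  assumes "Def0 P"
  shows "Def0 (\<lambda>e. P (\<lambda>i. if i < k then e i else d i))"
proof -
  obtain p E \<phi> where \<phi>: "rep_fm p E \<phi> P" using assms by (auto simp: Def0_def)
  let ?f = "recoord (\<lambda>i. if i < k then coord i else CHR ''a'' # coord i) (Cons (CHR ''b''))"
  let ?q = "merge (\<lambda>s. d (length s - 1)) p"
  have "inj ?f"
    by (rule inj_recoord) (auto simp: inj_def Cons_coord Cons_coord(1)[symmetric] split: if_splits)
  moreover have "env e ?q \<circ> ?f = env (\<lambda>i. if i < k then e i else d i) p" for e
    by (auto simp: fun_eq_iff recoord_def env_def Cons_coord)
  ultimately have "rep_fm ?q E (ren ?f id \<phi>) (\<lambda>e. P (\<lambda>i. if i < k then e i else d i))"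
    using \<phi> by (intro rep_fm_ren[OF \<phi>]) (auto simp: rep_fm_def recoord_def)
  then show ?thesis unfolding Def0_def by blast
qed

lemma Def0_shift:
  assumes "Def0 (\<lambda>e. Q (\<lambda>i. e (Suc i)) (e 0))" "inj (case_nat j k)"
  shows "Def0 (\<lambda>e. Q (\<lambda>i. e (k i)) (e j))"
  using Def0_reindex[OF assms] by simp

lemma inj_case_nat: "inj (case_nat j k) \<longleftrightarrow> inj k \<and> (\<forall>i. k i \<noteq> j)"
proof
  assume inj: "inj (case_nat j k)"
  have "inj (case_nat j k \<circ> Suc)" by (intro inj_compose inj inj_Suc)
  then have "inj k" by (simp add: comp_def)
  moreover have "k i \<noteq> j" for i using injD[OF inj, of "Suc i" 0] by auto
  ultimately show "inj k \<and> (\<forall>i. k i \<noteq> j)" by blast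
next
  assume k: "inj k \<and> (\<forall>i. k i \<noteq> j)"
  show "inj (case_nat j k)"
  proof (rule injI)
    fix x y
    assume "case_nat j k x = case_nat j k y"
    then show "x = y" using k by (cases x; cases y) (auto dest: injD simp: eq_commute[of j])
  qed
qed

lemma inj_Suc_comp: "inj k \<Longrightarrow> inj (\<lambda>i. Suc (k i))"
  by (simp add: inj_def)

lemma inj_insert_coord: "inj (case_nat 0 (case_nat (Suc 0) (\<lambda>i. Suc (Suc (Suc i)))))"
  by (simp add: inj_case_nat inj_Suc_comp split: nat.split)

lemma Sig_reindex:
  assumes "Sig P" "inj h"
  shows "Sig (\<lambda>e. P (\<lambda>i. e (h i)))"
proof -
  obtain Q where Q: "Def0 (\<lambda>e. Q (\<lambda>i. e (Suc i)) (e 0))" "\<And>e. P e \<longleftrightarrow> (\<exists>y. Q e y)"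
    using assms(1) by (auto simp: Sig_def)
  have "inj (case_nat 0 (\<lambda>i. Suc (h i)))" using assms(2) by (simp add: inj_case_nat inj_Suc_comp)
  from Def0_shift[OF Q(1) this] show ?thesis unfolding Q(2)
    by (intro Sig_ex0[of "\<lambda>e y. Q (\<lambda>i. e (h i)) y"]) simp
qed

lemma Sig_shift:
  assumes "Sig (\<lambda>e. P (\<lambda>i. e (Suc i)) (e 0))" "inj (case_nat j k)"
  shows "Sig (\<lambda>e. P (\<lambda>i. e (k i)) (e j))"
  using Sig_reindex[OF assms] by simp

lemma Tm_reindex: "Tm f \<Longrightarrow> Tm (\<lambda>e. f (\<lambda>i. e (h i)))"
proof -
  assume "Tm f"
  then obtain p t where t: "rep_tm p t f" by (auto simp: Tm_def)
  let ?f = "recoord (\<lambda>i. coord (h i)) id"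
  have "env e p \<circ> ?f = env (\<lambda>i. e (h i)) p" for e
    by (auto simp: fun_eq_iff recoord_def env_def)
  then have "rep_tm p (ren_tm ?f t) (\<lambda>e. f (\<lambda>i. e (h i)))"
    using t by (auto simp: rep_tm_def val_ren_tm vars_ren_tm recoord_def)
  then show ?thesis unfolding Tm_def by blast
qed

text \<open>A common bound \<open>z\<close> for the two witnesses leaves a single unbounded
  quantifier in front of bounded ones.\<close>

lemma Sig_conj:
  assumes "Sig P" "Sig P'"
  shows "Sig (\<lambda>e. P e \<and> P' e)"
proof -
  obtain Q Q' where Q: "Def0 (\<lambda>e. Q (\<lambda>i. e (Suc i)) (e 0))" "\<And>e. P e \<longleftrightarrow> (\<exists>y. Q e y)"
    and Q': "Def0 (\<lambda>e. Q' (\<lambda>i. e (Suc i)) (e 0))" "\<And>e. P' e \<longleftrightarrow> (\<exists>y. Q' e y)"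
    using assms by (auto simp: Sig_def)
  have "P e \<and> P' e \<longleftrightarrow> (\<exists>z. (\<exists>y. y < z + 1 \<and> Q e y) \<and> (\<exists>y. y < z + 1 \<and> Q' e y))" for e
  proof
    assume "P e \<and> P' e"
    then obtain y y' where "Q e y" "Q' e y'" using Q(2) Q'(2) by blast
    then show "\<exists>z. (\<exists>y. y < z + 1 \<and> Q e y) \<and> (\<exists>y. y < z + 1 \<and> Q' e y)"
      by (intro exI[of _ "max y y'"] conjI exI[of _ y] exI[of _ y']) (auto simp: hnat_less_add_1)
  qed (use Q(2) Q'(2) in blast)
  moreover have "inj (case_nat 0 (\<lambda>i. Suc (Suc i)))" by (simp add: inj_case_nat inj_Suc_comp)
  then have "Sig (\<lambda>e. \<exists>z. (\<exists>y. y < z + 1 \<and> Q e y) \<and> (\<exists>y. y < z + 1 \<and> Q' e y))"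
    by (intro Sig_ex0 Def0_conj Def0_ex Tm_intros Def0_shift[OF Q(1)] Def0_shift[OF Q'(1)])
  ultimately show ?thesis by simp
qed

lemma Sig_disj:
  assumes "Sig P" "Sig P'"
  shows "Sig (\<lambda>e. P e \<or> P' e)"
proof -
  obtain Q Q' where Q: "Def0 (\<lambda>e. Q (\<lambda>i. e (Suc i)) (e 0))" "\<And>e. P e \<longleftrightarrow> (\<exists>y. Q e y)"
    and Q': "Def0 (\<lambda>e. Q' (\<lambda>i. e (Suc i)) (e 0))" "\<And>e. P' e \<longleftrightarrow> (\<exists>y. Q' e y)"
    using assms by (auto simp: Sig_def)
  have "P e \<or> P' e \<longleftrightarrow> (\<exists>y. Q e y \<or> Q' e y)" for e using Q(2) Q'(2) by blast
  then show ?thesis using Sig_ex0[OF Def0_disj[OF Q(1) Q'(1)]] by simp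
qed

text \<open>The matrix is offered in two forms: with its witness and its distinguished argument at
  arbitrary coordinates, for moving quantifiers, and with everything else frozen at
  \<open>d\<close>, for inductions.\<close>

lemma Sig_matrix:
  assumes "Sig (\<lambda>e. P (\<lambda>i. e (Suc i)) (e 0))"
  obtains Q where "\<And>e x. P e x \<longleftrightarrow> (\<exists>y. Q e x y)"
    "\<And>j l k. inj (case_nat j (case_nat l k)) \<Longrightarrow> Def0 (\<lambda>e. Q (\<lambda>i. e (k i)) (e l) (e j))"
    "\<And>d. Def0 (\<lambda>e. Q d (e 1) (e 0))"
proof -
  obtain Q where Q: "Def0 (\<lambda>e. Q (\<lambda>i. e (Suc i)) (e 0))"
    "\<And>e. P (\<lambda>i. e (Suc i)) (e 0) \<longleftrightarrow> (\<exists>y. Q e y)"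
    using assms by (auto simp: Sig_def)
  show ?thesis
  proof
    show "P e x \<longleftrightarrow> (\<exists>y. Q (case_nat x e) y)" for e x using Q(2)[of "case_nat x e"] by simp
    fix j l :: nat and k
    assume "inj (case_nat j (case_nat l k))"
    from Def0_shift[OF Q(1) this] have "Def0 (\<lambda>e. Q (\<lambda>i. e (case_nat l k i)) (e j))" .
    moreover have "(\<lambda>i. e (case_nat l k i)) = case_nat (e l) (\<lambda>i. e (k i))" for e :: "nat \<Rightarrow> hnat"
      by (auto split: nat.split)
    ultimately show "Def0 (\<lambda>e. Q (case_nat (e l) (\<lambda>i. e (k i))) (e j))" by simp
  next
    fix d
    have "Def0 (\<lambda>e. Q (\<lambda>i. if Suc i < 2 then e (Suc i) else d (Suc i - 2)) (if 0 < (2::nat) then e 0 else d 0))"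
      using Def0_fix[OF Q(1), of 2 "\<lambda>i. d (i - 2)"] by simp
    moreover have "(\<lambda>i. if Suc i < 2 then e (Suc i) else d (Suc i - 2)) = case_nat (e 1) d" for e
      by (auto split: nat.split)
    ultimately show "Def0 (\<lambda>e. Q (case_nat (e 1) d) (e 0))" by simp
  qed
qed

lemma Sig_ex:
  assumes "Sig (\<lambda>e. P (\<lambda>i. e (Suc i)) (e 0))"
  shows "Sig (\<lambda>e. \<exists>x. P e x)"
proof -
  obtain Q where Q: "\<And>e x. P e x \<longleftrightarrow> (\<exists>y. Q e x y)"
    "\<And>j l k. inj (case_nat j (case_nat l k)) \<Longrightarrow> Def0 (\<lambda>e. Q (\<lambda>i. e (k i)) (e l) (e j))"
    "\<And>d. Def0 (\<lambda>e. Q d (e 1) (e 0))"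
    by (rule Sig_matrix[of P, OF assms that])
  have "(\<exists>x. P e x) \<longleftrightarrow> (\<exists>z x. x < z + 1 \<and> (\<exists>y. y < z + 1 \<and> Q e x y))" for e
  proof
    assume "\<exists>x. P e x"
    then obtain x y where "Q e x y" using Q(1) by blast
    then show "\<exists>z x. x < z + 1 \<and> (\<exists>y. y < z + 1 \<and> Q e x y)"
      by (intro exI[of _ "max x y"] exI[of _ x] conjI exI[of _ y]) (auto simp: hnat_less_add_1)
  qed (use Q(1) in blast)
  moreover have "Sig (\<lambda>e. \<exists>z x. x < z + 1 \<and> (\<exists>y. y < z + 1 \<and> Q e x y))"
    by (intro Sig_ex0 Def0_ex Tm_intros Q(2) inj_insert_coord)
  ultimately show ?thesis by simp
qed

text \<open>This is \<open>\<Sigma>\<^sup>0\<^sub>1\<close> collection: witnesses for all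
  \<open>x\<close> below a number have a common bound, so the bounded quantifier can be moved inside
  the unbounded one.\<close>

lemma Sig_all0:
  assumes "Tm f" "Sig (\<lambda>e. P (\<lambda>i. e (Suc i)) (e 0))"
  shows "Sig (\<lambda>e. \<forall>x. x < f e \<longrightarrow> P e x)"
proof -
  obtain Q where Q: "\<And>e x. P e x \<longleftrightarrow> (\<exists>y. Q e x y)"
    "\<And>j l k. inj (case_nat j (case_nat l k)) \<Longrightarrow> Def0 (\<lambda>e. Q (\<lambda>i. e (k i)) (e l) (e j))"
    "\<And>d. Def0 (\<lambda>e. Q d (e 1) (e 0))"
    by (rule Sig_matrix[of P, OF assms(2) that])
  have Qd: "Def0 (\<lambda>e. Q d (e (Suc 0)) (e 0))" for d using Q(3) by simp
  have collect: "\<exists>b. \<forall>x. x < a \<longrightarrow> (\<exists>y. y < b \<and> Q e x y)" if a: "\<forall>x. x < a \<longrightarrow> P e x" for a e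
  proof -
    \<comment> \<open>The extra premise \<open>x < a\<close> makes the claim true for every
      \<open>c\<close>, so plain induction on \<open>c\<close> applies.\<close>
    have "\<exists>b. \<forall>x. x < c \<longrightarrow> x < a \<longrightarrow> (\<exists>y. y < b \<and> Q e x y)" for c
    proof (rule Sig_induct[of "\<lambda>c. \<exists>b. \<forall>x. x < c \<longrightarrow> x < a \<longrightarrow> (\<exists>y. y < b \<and> Q e x y)"])
      show "Sig (\<lambda>e'. \<exists>b. \<forall>x. x < e' 0 \<longrightarrow> x < a \<longrightarrow> (\<exists>y. y < b \<and> Q e x y))"
        by (intro Sig_ex0 Def0_all Def0_imp Def0_less Def0_ex Tm_intros Qd)
      fix c
      assume "\<exists>b. \<forall>x. x < c \<longrightarrow> x < a \<longrightarrow> (\<exists>y. y < b \<and> Q e x y)"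
      then obtain b where b: "\<And>x. x < c \<Longrightarrow> x < a \<Longrightarrow> \<exists>y. y < b \<and> Q e x y" by blast
      obtain y where y: "c < a \<longrightarrow> Q e c y" using a Q(1) by blast
      have "\<exists>y'. y' < max b (y + 1) \<and> Q e x y'" if x: "x < c + 1" "x < a" for x
      proof (cases "x = c")
        case True
        then show ?thesis using y x by (intro exI[of _ y]) (auto simp: less_max_iff_disj hnat_less_add_1)
      next
        case False
        then have "x < c" using x(1) by (simp add: hnat_less_add_1)
        then show ?thesis using b x(2) by (auto simp: less_max_iff_disj)
      qed
      then show "\<exists>b. \<forall>x. x < c + 1 \<longrightarrow> x < a \<longrightarrow> (\<exists>y. y < b \<and> Q e x y)" by blast
    qed (simp add: hnat_basic(7))
    from this[of a] show ?thesis by blast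
  qed
  have "(\<forall>x. x < f e \<longrightarrow> P e x) \<longleftrightarrow> (\<exists>b. \<forall>x. x < f e \<longrightarrow> (\<exists>y. y < b \<and> Q e x y))" for e
    using collect[of "f e" e] Q(1) by blast
  moreover have "Tm (\<lambda>e. f (\<lambda>i. e (Suc i)))" by (rule Tm_reindex[OF assms(1)])
  then have "Sig (\<lambda>e. \<exists>b. \<forall>x. x < f e \<longrightarrow> (\<exists>y. y < b \<and> Q e x y))"
    by (intro Sig_ex0 Def0_all Def0_ex Tm_intros Q(2) inj_insert_coord)
  ultimately show ?thesis by simp
qed

section \<open>Decidable predicates and recursive functions\<close>

definition Dec :: "((nat \<Rightarrow> hnat) \<Rightarrow> bool) \<Rightarrow> bool" where
  "Dec P \<longleftrightarrow> Sig P \<and> Sig (\<lambda>e. \<not> P e)"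

text \<open>An existential graph suffices, since \<open>f\<close> is total: a negated condition on
  \<open>f e\<close> also says that some value equals \<open>f e\<close> and violates the
  condition.\<close>

definition Rec :: "((nat \<Rightarrow> hnat) \<Rightarrow> hnat) \<Rightarrow> bool" where
  "Rec f \<longleftrightarrow> Sig (\<lambda>e. f (\<lambda>i. e (Suc i)) = e 0)"

lemma Dec_Sig: "Dec P \<Longrightarrow> Sig P"
  by (simp add: Dec_def)

lemma Rec_Tm: "Tm f \<Longrightarrow> Rec f"
  unfolding Rec_def by (intro Def0_Sig Def0_eq[OF Tm_reindex Tm_var])

lemma Rec_shift:
  assumes "Rec f" "inj (case_nat j k)"
  shows "Sig (\<lambda>e. f (\<lambda>i. e (k i)) = e j)"
  using Sig_shift[of "\<lambda>e x. f e = x", OF assms(1)[unfolded Rec_def] assms(2)] .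

lemma inj_shift:
  "inj (case_nat 0 Suc)" "inj (case_nat 0 (\<lambda>i. Suc (Suc i)))"
  "inj (case_nat (Suc 0) (\<lambda>i. Suc (Suc i)))"
  "inj (case_nat 0 (\<lambda>i. Suc (Suc (Suc i))))" "inj (case_nat (Suc 0) (\<lambda>i. Suc (Suc (Suc i))))"
  by (simp_all add: inj_case_nat inj_Suc_comp)

text \<open>The values are guessed by new variables in front of the shifted sequence, so that only
  injective reindexing occurs, even if \<open>f\<close> and \<open>g\<close> share
  coordinates.\<close>

lemma Sig_rel:
  assumes "Rec f" "Rec g" "\<And>i j. Sig (\<lambda>e. R (e i) (e j))"
  shows "Sig (\<lambda>e. R (f e) (g e))"
proof -
  have "Sig (\<lambda>e. \<exists>x y. f e = x \<and> g e = y \<and> R x y)"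
    by (intro Sig_ex Sig_conj assms(3) Rec_shift[OF assms(1)] Rec_shift[OF assms(2)] inj_shift)
  then show ?thesis by simp
qed

lemma Dec_rel:
  assumes "Rec f" "Rec g" "\<And>i j. Def0 (\<lambda>e. R (e i) (e j))"
  shows "Dec (\<lambda>e. R (f e) (g e))"
  unfolding Dec_def
  by (intro conjI Sig_rel[OF assms(1,2), of R] Sig_rel[OF assms(1,2), of "\<lambda>x y. \<not> R x y"]
      Def0_Sig Def0_not assms(3))

lemma Dec_eq: "Rec f \<Longrightarrow> Rec g \<Longrightarrow> Dec (\<lambda>e. f e = g e)"
  by (rule Dec_rel) (assumption | intro Def0_eq Tm_intros)+

lemma Dec_less: "Rec f \<Longrightarrow> Rec g \<Longrightarrow> Dec (\<lambda>e. f e < g e)"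
  by (rule Dec_rel) (assumption | intro Def0_less Tm_intros)+

lemma Dec_le: "Rec f \<Longrightarrow> Rec g \<Longrightarrow> Dec (\<lambda>e. f e \<le> g e)"
  by (rule Dec_rel) (assumption | intro Def0_le Tm_intros)+

definition Rec1 :: "(hnat \<Rightarrow> hnat) \<Rightarrow> bool" where
  "Rec1 h \<longleftrightarrow> (\<forall>i j. Sig (\<lambda>e. h (e i) = e j))"

definition Rec2 :: "(hnat \<Rightarrow> hnat \<Rightarrow> hnat) \<Rightarrow> bool" where
  "Rec2 h \<longleftrightarrow> (\<forall>i j l. Sig (\<lambda>e. h (e i) (e j) = e l))"

lemma Rec_op:
  assumes "Rec2 h" "Rec f" "Rec g"
  shows "Rec (\<lambda>e. h (f e) (g e))"
proof -
  have "Sig (\<lambda>e. \<exists>x y. f (\<lambda>i. e (Suc i)) = x \<and> g (\<lambda>i. e (Suc i)) = y \<and> h x y = e 0)"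
    by (intro Sig_ex Sig_conj assms(1)[unfolded Rec2_def, rule_format] Rec_shift[OF assms(2)]
        Rec_shift[OF assms(3)] inj_shift)
  then show ?thesis by (simp add: Rec_def)
qed

lemma Rec_fun:
  assumes "Rec1 h" "Rec f"
  shows "Rec (\<lambda>e. h (f e))"
  using Rec_op[of "\<lambda>x y. h x", OF _ assms(2,2)] assms(1) by (simp add: Rec1_def Rec2_def)

lemma Rec_plus: "Rec f \<Longrightarrow> Rec g \<Longrightarrow> Rec (\<lambda>e. f e + g e)"
  by (rule Rec_op) (assumption | unfold Rec2_def | intro allI Def0_Sig Def0_eq Tm_intros)+

lemma Rec_times: "Rec f \<Longrightarrow> Rec g \<Longrightarrow> Rec (\<lambda>e. f e * g e)"
  by (rule Rec_op) (assumption | unfold Rec2_def | intro allI Def0_Sig Def0_eq Tm_intros)+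

lemmas Rec_intros = Rec_Tm[OF Tm_var] Rec_Tm[OF Tm_const] Rec_plus Rec_times

lemma Dec_not: "Dec P \<Longrightarrow> Dec (\<lambda>e. \<not> P e)"
  by (simp add: Dec_def)

lemma Dec_conj: "Dec P \<Longrightarrow> Dec Q \<Longrightarrow> Dec (\<lambda>e. P e \<and> Q e)"
  unfolding Dec_def de_Morgan_conj by (intro conjI Sig_conj Sig_disj) simp_all

lemma Dec_disj: "Dec P \<Longrightarrow> Dec Q \<Longrightarrow> Dec (\<lambda>e. P e \<or> Q e)"
  unfolding Dec_def de_Morgan_disj by (intro conjI Sig_conj Sig_disj) simp_all

lemma Dec_imp: "Dec P \<Longrightarrow> Dec Q \<Longrightarrow> Dec (\<lambda>e. P e \<longrightarrow> Q e)"
  unfolding imp_conv_disj by (intro Dec_disj Dec_not)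

lemma Dec_iff: "Dec P \<Longrightarrow> Dec Q \<Longrightarrow> Dec (\<lambda>e. P e \<longleftrightarrow> Q e)"
  unfolding iff_conv_conj_imp by (intro Dec_conj Dec_imp)

lemma Sig_all:
  assumes "Rec f" "Sig (\<lambda>e. P (\<lambda>i. e (Suc i)) (e 0))"
  shows "Sig (\<lambda>e. \<forall>x. x < f e \<longrightarrow> P e x)"
proof -
  have "Sig (\<lambda>e. \<exists>b. f e = b \<and> (\<forall>x. x < b \<longrightarrow> P e x))"
    by (intro Sig_ex Sig_conj Sig_all0 Tm_intros Rec_shift[OF assms(1)]
        Sig_shift[of P, OF assms(2)] inj_shift)
  then show ?thesis by simp
qed

lemma Dec_all:
  assumes "Rec f" "Dec (\<lambda>e. P (\<lambda>i. e (Suc i)) (e 0))"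
  shows "Dec (\<lambda>e. \<forall>x. x < f e \<longrightarrow> P e x)"
proof -
  have N: "Sig (\<lambda>e. \<not> P (\<lambda>i. e (Suc i)) (e 0))" using assms(2) by (simp add: Dec_def)
  have "Sig (\<lambda>e. \<exists>b x. f e = b \<and> x < b \<and> \<not> P e x)"
    by (intro Sig_ex Sig_conj Rec_shift[OF assms(1)] Dec_Sig[OF Dec_less] Rec_intros
        Sig_shift[of "\<lambda>e x. \<not> P e x", OF N] inj_shift)
  then have "Sig (\<lambda>e. \<not> (\<forall>x. x < f e \<longrightarrow> P e x))" by simp
  then show ?thesis unfolding Dec_def using Sig_all[of f P, OF assms(1)] assms(2) by (simp add: Dec_def)
qed

lemma Dec_ex:
  assumes "Rec f" "Dec (\<lambda>e. P (\<lambda>i. e (Suc i)) (e 0))"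
  shows "Dec (\<lambda>e. \<exists>x. x < f e \<and> P e x)"
  using Dec_not[OF Dec_all[of f "\<lambda>e x. \<not> P e x", OF assms(1)]] Dec_not[OF assms(2)] by simp

lemma Dec_all_le:
  assumes "Rec f" "Dec (\<lambda>e. P (\<lambda>i. e (Suc i)) (e 0))"
  shows "Dec (\<lambda>e. \<forall>x. x \<le> f e \<longrightarrow> P e x)"
  using Dec_all[of "\<lambda>e. f e + 1" P] assms Rec_intros by (simp add: hnat_less_add_1)

lemma Dec_ex_le:
  assumes "Rec f" "Dec (\<lambda>e. P (\<lambda>i. e (Suc i)) (e 0))"
  shows "Dec (\<lambda>e. \<exists>x. x \<le> f e \<and> P e x)"
  using Dec_ex[of "\<lambda>e. f e + 1" P] assms Rec_intros by (simp add: hnat_less_add_1)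

lemmas Dec_intros = Dec_eq Dec_less Dec_le Dec_conj Dec_disj Dec_imp Dec_iff Dec_not
  Dec_all Dec_ex Dec_all_le Dec_ex_le

text \<open>Induction shows that nothing below \<open>n\<close> satisfies \<open>P\<close>, which is
  existential by collection. So it is the complement of \<open>P\<close> whose complexity
  counts.\<close>

lemma least_hnat:
  assumes "Sig (\<lambda>e. \<not> P (e 0))" "P a"
  shows "\<exists>m. P m \<and> (\<forall>x. x < m \<longrightarrow> \<not> P x)"
proof (rule ccontr)
  assume none: "\<not> ?thesis"
  have "\<forall>x. x < n \<longrightarrow> \<not> P x" for n
  proof (rule Sig_induct[of "\<lambda>n. \<forall>x. x < n \<longrightarrow> \<not> P x"])
    show "Sig (\<lambda>e. \<forall>x. x < e 0 \<longrightarrow> \<not> P x)"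
      by (intro Sig_all Rec_intros assms(1))
    show "\<forall>x. x < n + 1 \<longrightarrow> \<not> P x" if "\<forall>x. x < n \<longrightarrow> \<not> P x" for n
      using that none by (metis hnat_basic(8))
  qed (simp add: hnat_basic(7))
  then show False using assms(2) hnat_less_add_1[of a a] by blast
qed

section \<open>Finite sets and iteration\<close>

definition hpair :: "hnat \<Rightarrow> hnat \<Rightarrow> hnat" where
  "hpair i j = (i + j) * (i + j) + i"

lemma Rec_hpair: "Rec f \<Longrightarrow> Rec g \<Longrightarrow> Rec (\<lambda>e. hpair (f e) (g e))"
  unfolding hpair_def by (intro Rec_intros)

lemma hpair_ge: "i \<le> hpair i j" "j \<le> hpair i j"
proof -
  show "i \<le> hpair i j" by (simp add: hpair_def hnat_zero_le)
  have "i + j \<le> (i + j) * (i + j)"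
  proof (cases "i + j = 0")
    case False
    then have "1 \<le> i + j" using hnat_add_1_le[of 0 "i + j"] hnat_zero_le[of "i + j"] by simp
    then show ?thesis using mult_left_mono[of 1 "i + j" "i + j"] hnat_zero_le by simp
  qed simp
  moreover have "j \<le> i + j" by (simp add: hnat_zero_le)
  moreover have "(i + j) * (i + j) \<le> hpair i j" by (simp add: hpair_def hnat_zero_le)
  ultimately show "j \<le> hpair i j" by order
qed

text \<open>\<open>hpair i j\<close> lies between the squares of \<open>i + j\<close> and
  \<open>i + j + 1\<close>, so pairs with different sums never meet.\<close>

lemma hpair_inject: "hpair i j = hpair k l \<longleftrightarrow> i = k \<and> j = l"
proof -
  have lt: "hpair i j < hpair k l" if "i + j < k + l" for i j k l
  proof -
    let ?s = "i + j"
    have "hpair i j \<le> ?s * ?s + ?s" by (simp add: hpair_def hnat_zero_le)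
    also have "\<dots> < (?s + 1) * (?s + 1)"
    proof -
      have "(?s + 1) * (?s + 1) = (?s * ?s + ?s + ?s) + 1" by (simp add: algebra_simps)
      then show ?thesis by (simp add: hnat_less_add_1 hnat_zero_le)
    qed
    also have "\<dots> \<le> (k + l) * (k + l)"
      using that hnat_zero_le by (intro mult_mono) (simp_all add: hnat_add_1_le)
    also have "\<dots> \<le> hpair k l" by (simp add: hpair_def hnat_zero_le)
    finally show ?thesis .
  qed
  show ?thesis
  proof
    assume eq: "hpair i j = hpair k l"
    then have "i + j = k + l" using lt[of i j k l] lt[of k l i j] by (metis less_irrefl neqE)
    then show "i = k \<and> j = l" using eq by (auto simp: hpair_def)
  qed simp
qed

text \<open>Membership as in Goedel's beta function: \<open>c\<close> codes those \<open>i\<close>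
  whose modulus divides it. Bounding the quotient keeps the relation decidable.\<close>

definition incode :: "hnat \<Rightarrow> hnat \<Rightarrow> hnat \<Rightarrow> bool" where
  "incode m c i \<longleftrightarrow> (\<exists>d. d \<le> c \<and> c = (m * (i + 1) + 1) * d)"

lemma incode_iff_dvd: "incode m c i \<longleftrightarrow> m * (i + 1) + 1 dvd c"
proof
  assume "m * (i + 1) + 1 dvd c"
  then obtain d where d: "c = (m * (i + 1) + 1) * d" by (auto simp: dvd_def)
  have "1 * d \<le> (m * (i + 1) + 1) * d"
    by (intro mult_right_mono hnat_zero_le) (simp add: hnat_zero_le)
  then show "incode m c i" using d by (auto simp: incode_def)
qed (auto simp: incode_def)

lemma hnat_dvd_cancel: "(a::hnat) dvd b \<Longrightarrow> a dvd b + c \<Longrightarrow> a dvd c"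
proof -
  assume "a dvd b" "a dvd b + c"
  then obtain x y where x: "b = a * x" "b + c = a * y" by (auto simp: dvd_def)
  have "c = (b + c) - b" by simp
  also have "\<dots> = a * (y - x)" using x by (simp add: right_diff_distrib')
  finally show ?thesis by simp
qed

text \<open>The moduli \<open>m * (i + 1) + 1\<close> are pairwise coprime if every positive number up to the bound
  divides \<open>m\<close>; this is the form of coprimality that is needed.\<close>

lemma incode_cancel:
  assumes m: "\<And>i. i < k \<Longrightarrow> i + 1 dvd m" and ij: "i < k" "j < k" "i \<noteq> j"
    and inc: "incode m (c * (m * (j + 1) + 1)) i"
  shows "incode m c i"
proof -
  define p i' j' where "p = m * (i + 1) + 1" and "i' = i + 1" and "j' = j + 1"
  have p: "p = m * i' + 1" by (simp add: p_def i'_def)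
  have "p dvd c * (m * j' + 1)" using inc by (simp add: incode_iff_dvd p_def j'_def)
  \<comment> \<open>The two multiples of \<open>p\<close> share the term
    \<open>c * m * i' * j'\<close>. Their difference is \<open>c\<close> times the distance of
    \<open>i\<close> and \<open>j\<close>, the order of which decides which multiple is
    larger.\<close>
  then have 1: "p dvd c * (m * j' + 1) * i'" by (rule dvd_mult2)
  have 2: "p dvd c * j' * p" by simp
  have lt: "d < a + (d + 1)" for a d :: hnat
    using hnat_zero_le[of a] by (simp add: hnat_less_add_1 flip: add.assoc)
  have "\<exists>d. d < k \<and> p dvd c * (d + 1)"
  proof (cases "i < j")
    case True
    then obtain d where d: "j = i + (d + 1)" unfolding hnat_less_iff ..
    have eq: "c * j' * p = c * (m * j' + 1) * i' + c * (d + 1)"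
      unfolding p i'_def j'_def d by (simp add: algebra_simps)
    have "p dvd c * (d + 1)" by (rule hnat_dvd_cancel[OF 1 2[unfolded eq]])
    moreover have "d < k" using hnat_less_trans[OF lt ij(2)[unfolded d]] .
    ultimately show ?thesis by blast
  next
    case False
    then have "j < i" using ij(3) by simp
    then obtain d where d: "i = j + (d + 1)" unfolding hnat_less_iff ..
    have eq: "c * (m * j' + 1) * i' = c * j' * p + c * (d + 1)"
      unfolding p i'_def j'_def d by (simp add: algebra_simps)
    have "p dvd c * (d + 1)" by (rule hnat_dvd_cancel[OF 2 1[unfolded eq]])
    moreover have "d < k" using hnat_less_trans[OF lt ij(1)[unfolded d]] .
    ultimately show ?thesis by blast
  qed
  then obtain d where d: "d < k" "p dvd c * (d + 1)" by blast
  \<comment> \<open>As \<open>d + 1\<close> divides \<open>m\<close>, also \<open>p\<close> divides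
    \<open>c * m * i'\<close>, which differs from \<open>c * p\<close> by exactly
    \<open>c\<close>.\<close>
  obtain q where "m = (d + 1) * q" using m[OF d(1)] by (auto simp: dvd_def)
  then have "c * m * i' = c * (d + 1) * (q * i')" by (simp add: mult.assoc)
  then have "p dvd c * m * i'" using d(2) by simp
  moreover have "p dvd c * m * i' + c"
  proof -
    have "c * m * i' + c = c * p" unfolding p by (simp add: algebra_simps)
    then show ?thesis by simp
  qed
  ultimately have "p dvd c" by (rule hnat_dvd_cancel)
  then show ?thesis by (simp add: incode_iff_dvd p_def)
qed

text \<open>A factorial without recursion: passing from \<open>k\<close> to \<open>k + 1\<close>
  multiplies \<open>m\<close> by \<open>k + 1\<close>. The quotients are bounded to keep the
  induction statement existential.\<close>

lemma ex_common_multiple: "\<exists>m::hnat. 0 < m \<and> (\<forall>i. i < k \<longrightarrow> i + 1 dvd m)"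
proof -
  have "\<exists>m::hnat. 0 < m \<and> (\<forall>i. i < k \<longrightarrow> (\<exists>d. d \<le> m \<and> m = (i + 1) * d))"
  proof (rule Sig_induct[of "\<lambda>k. \<exists>m::hnat. 0 < m \<and> (\<forall>i. i < k \<longrightarrow> (\<exists>d. d \<le> m \<and> m = (i + 1) * d))"])
    show "Sig (\<lambda>e. \<exists>m::hnat. 0 < m \<and> (\<forall>i. i < e 0 \<longrightarrow> (\<exists>d. d \<le> m \<and> m = (i + 1) * d)))"
      by (intro Sig_ex Dec_Sig Dec_intros Rec_intros)
    show "\<exists>m::hnat. 0 < m \<and> (\<forall>i. i < 0 \<longrightarrow> (\<exists>d. d \<le> m \<and> m = (i + 1) * d))"
      by (intro exI[of _ 1]) (simp add: hnat_basic(7))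
  next
    fix k
    assume "\<exists>m::hnat. 0 < m \<and> (\<forall>i. i < k \<longrightarrow> (\<exists>d. d \<le> m \<and> m = (i + 1) * d))"
    then obtain m where m: "0 < m" "\<And>i. i < k \<Longrightarrow> \<exists>d. d \<le> m \<and> m = (i + 1) * d" by blast
    let ?m = "m * (k + 1)"
    have pos: "0 < k + 1" using hnat_zero_le[of k] by (simp add: hnat_less_add_1)
    have le: "d \<le> ?m" if "?m = (i + 1) * d" for d i
    proof -
      have "1 * d \<le> (i + 1) * d" by (intro mult_right_mono hnat_zero_le) (simp add: hnat_zero_le)
      then show ?thesis using that by simp
    qed
    have "\<exists>d. d \<le> ?m \<and> ?m = (i + 1) * d" if "i < k + 1" for i
    proof (cases "i = k")
      case True
      then have "?m = (i + 1) * m" by (simp add: mult.commute)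
      then show ?thesis using le by blast
    next
      case False
      then have "i < k" using that by (simp add: hnat_less_add_1)
      then obtain d where "m = (i + 1) * d" using m(2) by blast
      then have "?m = (i + 1) * (d * (k + 1))" by (simp only: mult.assoc)
      then show ?thesis using le by blast
    qed
    moreover have "0 < ?m" using m(1) pos by simp
    ultimately show "\<exists>m::hnat. 0 < m \<and> (\<forall>i. i < k + 1 \<longrightarrow> (\<exists>d. d \<le> m \<and> m = (i + 1) * d))" by blast
  qed
  then show ?thesis by (auto simp: dvd_def)
qed

text \<open>\<open>c\<close> is the product of the moduli of the members below \<open>j\<close>,
  built by induction on \<open>j\<close>. A new factor leaves the other memberships alone by
  coprimality, and the empty product 1 has no member because \<open>m\<close> is positive.\<close>

lemma ex_incode:
  assumes Q: "\<And>k. Dec (\<lambda>e. Q (e k))"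
  shows "\<exists>m c. \<forall>i. i < k \<longrightarrow> (incode m c i \<longleftrightarrow> Q i)"
proof -
  obtain m where m: "0 < m" "\<And>i. i < k \<Longrightarrow> i + 1 dvd m" using ex_common_multiple by blast
  have "\<exists>c. \<forall>i. i < k \<longrightarrow> (incode m c i \<longleftrightarrow> i < j \<and> Q i)" for j
  proof (rule Sig_induct[of "\<lambda>j. \<exists>c. \<forall>i. i < k \<longrightarrow> (incode m c i \<longleftrightarrow> i < j \<and> Q i)"])
    show "Sig (\<lambda>e. \<exists>c. \<forall>i. i < k \<longrightarrow> (incode m c i \<longleftrightarrow> i < e 0 \<and> Q i))"
      unfolding incode_def by (intro Sig_ex Dec_Sig Dec_intros Rec_intros Q)
    have "\<not> incode m 1 i" for i
    proof
      assume "incode m 1 i"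
      then obtain d where d: "d \<le> 1" "1 = (m * (i + 1) + 1) * d" by (auto simp: incode_def)
      have "d \<noteq> 0" using d(2) by auto
      then have "1 \<le> d" using hnat_add_1_le[of 0 d] hnat_zero_le[of d] by simp
      then have "d = 1" using d(1) by simp
      then have "m * (i + 1) = 0" using d(2) by simp
      moreover have "i + 1 \<noteq> 0" by (rule hnat_basic(1))
      ultimately show False using m(1) by simp
    qed
    then show "\<exists>c. \<forall>i. i < k \<longrightarrow> (incode m c i \<longleftrightarrow> i < 0 \<and> Q i)"
      by (intro exI[of _ 1]) (simp add: hnat_basic(7))
  next
    fix j
    assume "\<exists>c. \<forall>i. i < k \<longrightarrow> (incode m c i \<longleftrightarrow> i < j \<and> Q i)"
    then obtain c where c: "\<And>i. i < k \<Longrightarrow> incode m c i \<longleftrightarrow> i < j \<and> Q i" by blast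
    show "\<exists>c. \<forall>i. i < k \<longrightarrow> (incode m c i \<longleftrightarrow> i < j + 1 \<and> Q i)"
    proof (cases "j < k \<and> Q j")
      case True
      let ?c = "c * (m * (j + 1) + 1)"
      have "incode m ?c i \<longleftrightarrow> i < j + 1 \<and> Q i" if i: "i < k" for i
      proof (cases "i = j")
        case True
        then show ?thesis using \<open>j < k \<and> Q j\<close> by (simp add: incode_iff_dvd hnat_less_add_1)
      next
        case False
        have "j < k" using True by blast
        have "incode m ?c i \<longleftrightarrow> incode m c i"
        proof
          show "incode m ?c i \<Longrightarrow> incode m c i" by (rule incode_cancel[OF m(2) i \<open>j < k\<close> False])
          show "incode m c i \<Longrightarrow> incode m ?c i" unfolding incode_iff_dvd by (rule dvd_mult2)
        qed
        then show ?thesis using c[OF i] False by (simp add: hnat_basic(8))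
      qed
      then show ?thesis by blast
    next
      case False
      then have "incode m c i \<longleftrightarrow> i < j + 1 \<and> Q i" if "i < k" for i
        using c[OF that] that by (auto simp: hnat_basic(8))
      then show ?thesis by blast
    qed
  qed
  from this[of k] show ?thesis by blast
qed

section \<open>Iteration of a recursive function by coded traces\<close>

definition code_mem :: "hnat \<Rightarrow> hnat \<Rightarrow> hnat \<Rightarrow> hnat \<Rightarrow> bool" where
  "code_mem k m c z \<longleftrightarrow> z < k \<and> incode m c z"

text \<open>The coded set consists of pairs \<open>(i, u)\<close> such that iterating \<open>F\<close> on \<open>x\<close> leads to \<open>u\<close> after
  \<open>i\<close> steps, as witnessed by the set itself.\<close>

definition trace :: "(hnat \<Rightarrow> hnat) \<Rightarrow> hnat \<Rightarrow> hnat \<Rightarrow> hnat \<Rightarrow> hnat \<Rightarrow> bool" where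
  "trace F x k m c \<longleftrightarrow> (\<forall>z. z < k \<longrightarrow> code_mem k m c z \<longrightarrow>
    (\<exists>i. i \<le> z \<and> (\<exists>u. u \<le> z \<and> z = hpair i u \<and> (i = 0 \<and> u = x \<or>
      (\<exists>i'. i' \<le> z \<and> (\<exists>u'. u' \<le> k \<and> i = i' + 1 \<and> code_mem k m c (hpair i' u') \<and> F u' = u))))))"

definition iterates :: "(hnat \<Rightarrow> hnat) \<Rightarrow> hnat \<Rightarrow> hnat \<Rightarrow> hnat \<Rightarrow> bool" where
  "iterates F n x v \<longleftrightarrow> (\<exists>k m c. trace F x k m c \<and> code_mem k m c (hpair n v))"

lemma trace_cases:
  assumes "trace F x k m c" "code_mem k m c (hpair i u)"
  shows "i = 0 \<and> u = x \<or> (\<exists>i' u'. i = i' + 1 \<and> code_mem k m c (hpair i' u') \<and> F u' = u)"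
proof -
  have "hpair i u < k" using assms(2) by (simp add: code_mem_def)
  then obtain i1 u1 where "hpair i u = hpair i1 u1" "i1 = 0 \<and> u1 = x \<or>
      (\<exists>i' u'. i1 = i' + 1 \<and> code_mem k m c (hpair i' u') \<and> F u' = u1)"
    using assms unfolding trace_def by blast
  then show ?thesis by (simp add: hpair_inject)
qed

text \<open>The bounds that make \<open>trace\<close> decidable hold automatically, because the
  components of a pair do not exceed it.\<close>

lemma trace_intro:
  assumes "\<And>z. code_mem k m c z \<Longrightarrow> \<exists>i u. z = hpair i u \<and> (i = 0 \<and> u = x \<or>
      (\<exists>i' u'. i = i' + 1 \<and> code_mem k m c (hpair i' u') \<and> F u' = u))"
  shows "trace F x k m c"
  unfolding trace_def
proof (intro allI impI)
  fix z
  assume "code_mem k m c z"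
  from assms[OF this] obtain i u where z: "z = hpair i u" and
    *: "i = 0 \<and> u = x \<or> (\<exists>i' u'. i = i' + 1 \<and> code_mem k m c (hpair i' u') \<and> F u' = u)" by blast
  have "i = 0 \<and> u = x \<or>
      (\<exists>i'. i' \<le> z \<and> (\<exists>u'. u' \<le> k \<and> i = i' + 1 \<and> code_mem k m c (hpair i' u') \<and> F u' = u))"
    using *
  proof
    assume "\<exists>i' u'. i = i' + 1 \<and> code_mem k m c (hpair i' u') \<and> F u' = u"
    then obtain i' u' where iu: "i = i' + 1" "code_mem k m c (hpair i' u')" "F u' = u" by blast
    have "i' + 1 \<le> z" using hpair_ge(1)[of i u] z iu(1) by simp
    then have "i' \<le> z" by (simp add: hnat_add_1_le)
    moreover have "u' \<le> k"
      using hpair_ge(2)[of u' i'] iu(2) unfolding code_mem_def by (meson le_less_trans less_imp_le)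
    ultimately show ?thesis using iu by blast
  qed blast
  then show "\<exists>i. i \<le> z \<and> (\<exists>u. u \<le> z \<and> z = hpair i u \<and> (i = 0 \<and> u = x \<or>
      (\<exists>i'. i' \<le> z \<and> (\<exists>u'. u' \<le> k \<and> i = i' + 1 \<and> code_mem k m c (hpair i' u') \<and> F u' = u))))"
    using z hpair_ge by blast
qed

lemma Dec_code_mem:
  assumes "Rec k" "Rec m" "Rec c" "Rec z"
  shows "Dec (\<lambda>e. code_mem (k e) (m e) (c e) (z e))"
proof -
  have sig: "Sig (\<lambda>e. \<exists>k1 m1 c1 z1. k e = k1 \<and> m e = m1 \<and> c e = c1 \<and> z e = z1 \<and> R k1 m1 c1 z1)"
    if R: "Sig (\<lambda>e. R (e 3) (e 2) (e 1) (e 0))" for R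
  proof -
    have R': "Sig (\<lambda>e. R (e (Suc (Suc (Suc 0)))) (e (Suc (Suc 0))) (e (Suc 0)) (e 0))"
      using R by (simp add: numeral_3_eq_3 numeral_2_eq_2)
    have "inj (case_nat j (\<lambda>i. Suc (Suc (Suc (Suc i)))))" if "j < 4" for j
      using that by (auto simp: inj_case_nat inj_Suc_comp)
    then show ?thesis
      by (intro Sig_ex Sig_conj R' Rec_shift[OF assms(1)] Rec_shift[OF assms(2)]
          Rec_shift[OF assms(3)] Rec_shift[OF assms(4)]) simp_all
  qed
  have "Dec (\<lambda>e. code_mem (e 3) (e 2) (e 1) (e 0))"
    unfolding code_mem_def incode_def by (intro Dec_intros Rec_intros)
  then show ?thesis using sig[of code_mem] sig[of "\<lambda>k m c z. \<not> code_mem k m c z"]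
    by (simp add: Dec_def)
qed

context
  fixes F :: "hnat \<Rightarrow> hnat"
  assumes F: "Rec1 F"
begin

lemma Sig_iterates: "Sig (\<lambda>e. iterates F (e i) (e j) (e l))"
  unfolding iterates_def trace_def
  by (intro Sig_ex Sig_conj Dec_Sig Dec_intros Dec_code_mem Rec_hpair Rec_fun[OF F] Rec_intros)

text \<open>Two fixed traces agree level by level. The values they contain are bounded by the codes,
  so the induction statement is decidable.\<close>

lemma iterates_unique:
  assumes "iterates F n x v" "iterates F n x v'"
  shows "v = v'"
proof -
  obtain k m c k' m' c' where tr: "trace F x k m c" "trace F x k' m' c'"
    and mem: "code_mem k m c (hpair n v)" "code_mem k' m' c' (hpair n v')"
    using assms by (auto simp: iterates_def)
  have "\<forall>u. u \<le> k \<longrightarrow> (\<forall>u'. u' \<le> k' \<longrightarrow>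
      code_mem k m c (hpair i u) \<longrightarrow> code_mem k' m' c' (hpair i u') \<longrightarrow> u = u')" for i
  proof (rule Sig_induct[of "\<lambda>i. \<forall>u. u \<le> k \<longrightarrow> (\<forall>u'. u' \<le> k' \<longrightarrow>
      code_mem k m c (hpair i u) \<longrightarrow> code_mem k' m' c' (hpair i u') \<longrightarrow> u = u')"])
    show "Sig (\<lambda>e. \<forall>u. u \<le> k \<longrightarrow> (\<forall>u'. u' \<le> k' \<longrightarrow>
      code_mem k m c (hpair (e 0) u) \<longrightarrow> code_mem k' m' c' (hpair (e 0) u') \<longrightarrow> u = u'))"
      by (intro Dec_Sig Dec_intros Dec_code_mem Rec_hpair Rec_intros)
    have 0: "u = x" if "code_mem k m c (hpair 0 u) \<or> code_mem k' m' c' (hpair 0 u)" for u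
      using that trace_cases[OF tr(1), of 0 u] trace_cases[OF tr(2), of 0 u] hnat_basic(1) by metis
    then show "\<forall>u. u \<le> k \<longrightarrow> (\<forall>u'. u' \<le> k' \<longrightarrow>
      code_mem k m c (hpair 0 u) \<longrightarrow> code_mem k' m' c' (hpair 0 u') \<longrightarrow> u = u')" by blast
  next
    fix i
    assume IH: "\<forall>u. u \<le> k \<longrightarrow> (\<forall>u'. u' \<le> k' \<longrightarrow>
      code_mem k m c (hpair i u) \<longrightarrow> code_mem k' m' c' (hpair i u') \<longrightarrow> u = u')"
    have step: "\<exists>w. w \<le> k \<and> code_mem k m c (hpair i w) \<and> F w = u"
      if tr: "trace F x k m c" and mem: "code_mem k m c (hpair (i + 1) u)" for k m c u
    proof -
      obtain i' w where w: "i + 1 = i' + 1" "code_mem k m c (hpair i' w)" "F w = u"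
        using trace_cases[OF tr mem] hnat_basic(1)[of i] by blast
      have "hpair i' w < k" using w(2) by (simp add: code_mem_def)
      then have "w \<le> k" using hpair_ge(2)[of w i'] by order
      then show ?thesis using w by auto
    qed
    show "\<forall>u. u \<le> k \<longrightarrow> (\<forall>u'. u' \<le> k' \<longrightarrow>
      code_mem k m c (hpair (i + 1) u) \<longrightarrow> code_mem k' m' c' (hpair (i + 1) u') \<longrightarrow> u = u')"
    proof (intro allI impI)
      fix u u'
      assume "code_mem k m c (hpair (i + 1) u)" "code_mem k' m' c' (hpair (i + 1) u')"
      then obtain w w' where "w \<le> k" "code_mem k m c (hpair i w)" "F w = u"
        "w' \<le> k'" "code_mem k' m' c' (hpair i w')" "F w' = u'"
        using step[OF tr(1)] step[OF tr(2)] by meson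
      then show "u = u'" using IH by blast
    qed
  qed
  moreover have "v \<le> k" "v' \<le> k'"
    using mem hpair_ge(2)[of v n] hpair_ge(2)[of v' n] unfolding code_mem_def
    by (meson le_less_trans less_imp_le)+
  ultimately show ?thesis using mem by blast
qed

lemma iterates_0: "iterates F 0 x x"
proof -
  let ?z = "hpair 0 x"
  have "Dec (\<lambda>e. e k = ?z)" for k by (intro Dec_intros Rec_intros)
  from ex_incode[of "\<lambda>z. z = ?z" "?z + 1", OF this]
  obtain m c where mc: "\<And>z. z < ?z + 1 \<Longrightarrow> incode m c z \<longleftrightarrow> z = ?z" by blast
  have mem: "code_mem (?z + 1) m c z \<longleftrightarrow> z = ?z" for z
    using mc[of z] by (auto simp: code_mem_def hnat_less_add_1)
  have "trace F x (?z + 1) m c"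
    by (rule trace_intro) (auto simp: mem)
  moreover have "code_mem (?z + 1) m c ?z" by (simp add: mem)
  ultimately show ?thesis unfolding iterates_def by blast
qed

text \<open>The old trace together with one more pair is decidable and hence coded again. Old pairs
  stay justified because the coded set only grows.\<close>

lemma iterates_Suc:
  assumes "iterates F n x v"
  shows "iterates F (n + 1) x (F v)"
proof -
  obtain k m c where tr: "trace F x k m c" and nv: "code_mem k m c (hpair n v)"
    using assms by (auto simp: iterates_def)
  let ?z = "hpair (n + 1) (F v)" and ?Q = "\<lambda>z. code_mem k m c z \<or> z = hpair (n + 1) (F v)"
  let ?k = "max k (?z + 1)"
  have "Dec (\<lambda>e. ?Q (e l))" for l
    by (intro Dec_intros Dec_code_mem Rec_intros)
  from ex_incode[of ?Q ?k, OF this]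
  obtain m' c' where mc: "\<And>z. z < ?k \<Longrightarrow> incode m' c' z \<longleftrightarrow> ?Q z" by blast
  have mem: "code_mem ?k m' c' z \<longleftrightarrow> ?Q z" for z
    using mc[of z] by (auto simp: code_mem_def less_max_iff_disj hnat_less_add_1)
  have "trace F x ?k m' c'"
  proof (rule trace_intro)
    fix z
    assume "code_mem ?k m' c' z"
    then consider "code_mem k m c z" | "z = ?z" using mem by blast
    then show "\<exists>i u. z = hpair i u \<and> (i = 0 \<and> u = x \<or>
        (\<exists>i' u'. i = i' + 1 \<and> code_mem ?k m' c' (hpair i' u') \<and> F u' = u))"
    proof cases
      case 1
      then obtain i u where z: "z = hpair i u" using tr unfolding trace_def code_mem_def by blast
      from trace_cases[OF tr 1[unfolded z]] show ?thesis unfolding mem z by blast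
    next
      case 2
      then show ?thesis unfolding mem using nv by blast
    qed
  qed
  moreover have "code_mem ?k m' c' ?z" unfolding mem by blast
  ultimately show ?thesis unfolding iterates_def by blast
qed

lemma ex_iteration:
  obtains G where "\<And>x. G 0 x = x" "\<And>n x. G (n + 1) x = F (G n x)" "Rec2 G"
proof
  define G where "G n x = (THE v. iterates F n x v)" for n x
  have ex: "\<exists>v. iterates F n x v" for n x
  proof (rule Sig_induct[of "\<lambda>n. \<exists>v. iterates F n x v"])
    \<comment> \<open>\<open>Sig_iterates\<close> reads its arguments from coordinates, so the
      constant \<open>x\<close> enters as a quantified variable equal to it.\<close>
    have "Sig (\<lambda>e. \<exists>x'. x' = x \<and> (\<exists>v. iterates F (e 0) x' v))"
      by (intro Sig_ex Sig_conj Sig_iterates Dec_Sig Dec_intros Rec_intros)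
    then show "Sig (\<lambda>e. \<exists>v. iterates F (e 0) x v)" by simp
  qed (use iterates_0 iterates_Suc in blast)+
  have G: "G n x = v \<longleftrightarrow> iterates F n x v" for n x v
    unfolding G_def using ex[of n x] iterates_unique by (metis the_equality)
  show "G 0 x = x" for x using G iterates_0 by blast
  show "G (n + 1) x = F (G n x)" for n x using G iterates_Suc by blast
  show "Rec2 G" unfolding Rec2_def G by (intro allI Sig_iterates)
qed

end

text \<open>The arguments are bounded by the code of their pair, so the graph of a recursive
  function is decidable and comprehension makes it a set.\<close>

lemma graph_set:
  assumes "Rec2 f"
  shows "\<exists>X\<in>hsets. \<forall>z. z \<in> X \<longleftrightarrow> (\<exists>n i. z = hpair (hpair n i) (f n i))"
proof -
  let ?P = "\<lambda>z. \<exists>p. p \<le> z \<and> (\<exists>n. n \<le> p \<and> (\<exists>i. i \<le> p \<and> p = hpair n i \<and> z = hpair p (f n i)))"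
  have "Dec (\<lambda>e. ?P (e 0))"
    by (intro Dec_intros Rec_hpair Rec_op[OF assms] Rec_intros)
  then have "{z. ?P z} \<in> hsets" by (intro comprehension) (simp_all add: Dec_def)
  moreover have "?P z \<longleftrightarrow> (\<exists>n i. z = hpair (hpair n i) (f n i))" for z
    using hpair_ge by blast
  ultimately show ?thesis by (intro bexI[of _ "{z. ?P z}"]) simp_all
qed

lemma Least_hnat:
  assumes "Sig (\<lambda>e. \<not> P (e 0))" "P a"
  shows "P (LEAST x. P x)" "P b \<Longrightarrow> (LEAST x. P x) \<le> b"
proof -
  obtain m where m: "P m" "\<And>x. x < m \<Longrightarrow> \<not> P x" using least_hnat[of P, OF assms] by blast
  have "(LEAST x. P x) = m" using m by (intro Least_equality) (auto simp: not_less[symmetric])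
  then show "P (LEAST x. P x)" "P b \<Longrightarrow> (LEAST x. P x) \<le> b"
    using m by (auto simp: not_less[symmetric])
qed

section \<open>A strictly increasing chain from an unstable one\<close>

text \<open>Ideals enter here only as recursively enumerated sets; \<open>subchain_directed\<close>
  prepares the later proof that the new sets are ideals.\<close>

locale unstable_chain =
  fixes a :: "hnat \<Rightarrow> hnat \<Rightarrow> hnat"
  assumes Rec_a: "Rec2 a"
    and increasing: "\<And>n k. a n k \<in> range (a (n + 1))"
    and unstable: "\<And>n. \<exists>m. n \<le> m \<and> range (a m) \<noteq> range (a n)"
begin

text \<open>An inclusion of two ranges is not existential, but membership of one element is. So the
  element is fixed before the induction.\<close>

lemma range_mono:
  assumes "m \<le> n"
  shows "range (a m) \<subseteq> range (a n)"
proof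
  fix r
  assume r: "r \<in> range (a m)"
  have "\<exists>l. a (m + d) l = r" for d
  proof (rule Sig_induct[of "\<lambda>d. \<exists>l. a (m + d) l = r"])
    show "Sig (\<lambda>e. \<exists>l. a (m + e 0) l = r)"
      by (intro Sig_ex Dec_Sig Dec_intros Rec_op[OF Rec_a] Rec_intros)
    show "\<exists>l. a (m + 0) l = r" using r by auto
    show "\<exists>l. a (m + (d + 1)) l = r" if ex: "\<exists>l. a (m + d) l = r" for d
    proof -
      obtain l where "a (m + d) l = r" using ex ..
      then have "r \<in> range (a (m + d + 1))" using increasing[of "m + d" l] by simp
      then show ?thesis by (auto simp: add.assoc)
    qed
  qed
  moreover obtain d where "n = m + d" using assms unfolding hnat_le_iff ..
  ultimately obtain l where "a n l = r" by blast
  then show "r \<in> range (a n)" by blast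
qed

text \<open>By stage \<open>s\<close>, the number \<open>q\<close> may code an element outside the \<open>u\<close>-th ideal; a candidate
  \<open>q \<ge> s\<close> is accepted untested, which makes the search terminate.\<close>

definition candidate :: "hnat \<Rightarrow> hnat \<Rightarrow> hnat \<Rightarrow> bool" where
  "candidate s u q \<longleftrightarrow> u < q \<and> (s \<le> q \<or> (\<exists>m. m \<le> q \<and> (\<exists>k. k \<le> q \<and> q = hpair m k \<and>
    (\<forall>u'. u' \<le> u \<longrightarrow> (\<forall>l. l \<le> s \<longrightarrow> a m k \<noteq> a u' l)))))"

definition next_index :: "hnat \<Rightarrow> hnat \<Rightarrow> hnat" where
  "next_index s u = (LEAST q. candidate s u q)"

lemma Dec_candidate: "Dec (\<lambda>e. candidate (e i) (e j) (e l))" "Dec (\<lambda>e. candidate s u (e l))"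
  unfolding candidate_def by (intro Dec_intros Rec_hpair Rec_op[OF Rec_a] Rec_intros)+

lemma next_index: "candidate s u (next_index s u)" "candidate s u q \<Longrightarrow> next_index s u \<le> q"
proof -
  \<comment> \<open>The number \<open>s + u + 1\<close> passes untested, being at least
    \<open>s\<close>.\<close>
  have "u < s + u + 1" "s \<le> s + u + 1"
    using hnat_zero_le[of s] by (simp_all add: hnat_less_add_1) (simp add: hnat_zero_le add.assoc)
  then have ex: "candidate s u (s + u + 1)" by (simp add: candidate_def)
  have sig: "Sig (\<lambda>e. \<not> candidate s u (e 0))" using Dec_candidate(2) by (simp add: Dec_def)
  show "candidate s u (next_index s u)" "candidate s u q \<Longrightarrow> next_index s u \<le> q"
    unfolding next_index_def
    using Least_hnat[of "candidate s u", OF sig ex] by blast+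
qed

text \<open>A candidate for the larger data is one for the smaller. For this the test in
  \<open>candidate\<close> runs over all indices up to \<open>u\<close> and not just over
  \<open>u\<close>.\<close>

lemma next_index_mono:
  assumes "s \<le> s'" "u \<le> u'"
  shows "next_index s u \<le> next_index s' u'"
proof (rule next_index(2))
  show "candidate s u (next_index s' u')"
    using next_index(1)[of s' u'] assms unfolding candidate_def by (meson le_less_trans order_trans)
qed

lemma Rec_next_index: "Rec2 next_index"
proof -
  have "next_index s u = q \<longleftrightarrow> candidate s u q \<and> (\<forall>q'. q' < q \<longrightarrow> \<not> candidate s u q')" for s u q
    using next_index[of s u] by (metis antisym_conv3 leD)
  moreover have "Sig (\<lambda>e. candidate (e i) (e j) (e l) \<and>
      (\<forall>q'. q' < e l \<longrightarrow> \<not> candidate (e i) (e j) q'))" for i j l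
    by (intro Dec_Sig Dec_intros Dec_candidate Rec_intros)
  ultimately show ?thesis by (simp add: Rec2_def)
qed

text \<open>Iteration transforms a single number, so the stage travels along in a pair. Pairing is
  not onto: \<open>F\<close> sends all other numbers to 0, and a bounded search for the components
  keeps its graph decidable.\<close>

lemma ex_index:
  obtains g where "\<And>s. g 0 s = 0" "\<And>n s. g (n + 1) s = next_index s (g n s)"
    "Rec2 g"
proof -
  define R where "R z v \<longleftrightarrow> (\<exists>s. s \<le> z \<and> (\<exists>u. u \<le> z \<and> z = hpair s u \<and> v = hpair s (next_index s u))) \<or>
      v = 0 \<and> \<not> (\<exists>s. s \<le> z \<and> (\<exists>u. u \<le> z \<and> z = hpair s u))" for z v
  have R_pair: "R (hpair s u) v \<longleftrightarrow> v = hpair s (next_index s u)" for s u v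
    using hpair_ge(1)[of s u] hpair_ge(2)[of u s] by (auto simp: R_def hpair_inject)
  have R_ex: "\<exists>!v. R z v" for z
  proof (cases "\<exists>s u. z = hpair s u")
    case True
    then show ?thesis using R_pair by auto
  next
    case False
    then show ?thesis by (auto simp: R_def)
  qed
  define F where "F z = (THE v. R z v)" for z
  have F: "F z = v \<longleftrightarrow> R z v" for z v
    unfolding F_def using R_ex[of z] by (metis theI')
  have SF: "Rec1 F"
    unfolding Rec1_def F R_def
    by (intro allI Dec_Sig Dec_intros Rec_hpair Rec_op[OF Rec_next_index] Rec_intros)
  obtain G where G: "\<And>x. G 0 x = x" "\<And>n x. G (n + 1) x = F (G n x)" "Rec2 G"
    using ex_iteration[OF SF] by blast
  have ex: "\<exists>v. G n (hpair s 0) = hpair s v" for n s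
  proof (rule Sig_induct[of "\<lambda>n. \<exists>v. G n (hpair s 0) = hpair s v"])
    show "Sig (\<lambda>e. \<exists>v. G (e 0) (hpair s 0) = hpair s v)"
      by (intro Sig_ex Dec_Sig Dec_intros Rec_hpair Rec_op[OF G(3)] Rec_intros)
  qed (use G(1,2) F R_pair in auto)
  define g where "g n s = (THE v. G n (hpair s 0) = hpair s v)" for n s
  have g: "G n (hpair s 0) = hpair s v \<longleftrightarrow> g n s = v" for n s v
    using ex[of n s] by (auto simp: g_def hpair_inject)
  show ?thesis
  proof
    show "g 0 s = 0" for s using G(1) g by blast
    show "g (n + 1) s = next_index s (g n s)" for n s
    proof -
      have "G n (hpair s 0) = hpair s (g n s)" using g by blast
      then have "G (n + 1) (hpair s 0) = hpair s (next_index s (g n s))"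
        using G(2) F R_pair by simp
      then show ?thesis using g by blast
    qed
    show "Rec2 g"
      unfolding Rec2_def g[symmetric]
      by (intro allI Dec_Sig Dec_intros Rec_hpair Rec_op[OF G(3)] Rec_intros)
  qed
qed

definition index :: "hnat \<Rightarrow> hnat \<Rightarrow> hnat" where
  "index = (SOME g. (\<forall>s. g 0 s = 0) \<and> (\<forall>n s. g (n + 1) s = next_index s (g n s)) \<and>
    Rec2 g)"

lemma index: "index 0 s = 0" "index (n + 1) s = next_index s (index n s)"
    "Rec2 index"
proof -
  have "\<exists>g. (\<forall>s. g 0 s = 0) \<and> (\<forall>n s. g (n + 1) s = next_index s (g n s)) \<and>
    Rec2 g"
    using ex_index by metis
  from someI_ex[OF this, folded index_def]
  show "index 0 s = 0" "index (n + 1) s = next_index s (index n s)"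
    "Rec2 index" by blast+
qed

lemma index_mono:
  assumes "s \<le> s'"
  shows "index n s \<le> index n s'"
proof (rule Sig_induct[of "\<lambda>n. index n s \<le> index n s'"])
  show "Sig (\<lambda>e. index (e 0) s \<le> index (e 0) s')"
    by (intro Dec_Sig Dec_intros Rec_op[OF index(3)] Rec_intros)
qed (use assms in \<open>auto simp: index next_index_mono\<close>)

lemma index_less: "index n s < index (n + 1) s"
  using next_index(1)[of s "index n s"] by (simp add: index(2) candidate_def)

text \<open>This is the only use of \<open>\<Sigma>\<^sup>0\<^sub>2\<close>-induction: the approximations to each index stay bounded.\<close>

lemma index_bounded: "\<exists>b. \<forall>s. index n s \<le> b"
proof -
  \<comment> \<open>Read off from a graph that is a set, the inequality becomes a bounded formula,
    as \<open>Sig2_induct\<close> demands.\<close>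
  obtain X where X: "X \<in> hsets" "\<And>z. z \<in> X \<longleftrightarrow> (\<exists>n i. z = hpair (hpair n i) (index n i))"
    using graph_set[OF index(3)] by blast
  define Q where "Q n b s \<longleftrightarrow> (\<exists>v. v < b + 1 \<and> hpair (hpair n s) v \<in> X)" for n b s
  have Q: "Q n b s \<longleftrightarrow> index n s \<le> b" for n b s
    unfolding Q_def X(2) hpair_inject hnat_less_add_1 by blast
  have "\<exists>b. \<forall>s. Q n b s"
  proof (rule Sig2_induct[of Q])
    show "Def0 (\<lambda>e. Q (e 2) (e 1) (e 0))"
      unfolding Q_def hpair_def by (intro Def0_intros Def0_mem X(1))
    show "\<exists>b. \<forall>s. Q 0 b s" by (auto simp: Q index(1))
  next
    fix n
    assume "\<exists>b. \<forall>s. Q n b s"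
    then obtain b where b: "\<And>s. index n s \<le> b" unfolding Q by blast
    obtain m where m: "b \<le> m" "range (a m) \<noteq> range (a b)" using unstable by blast
    then have "\<not> range (a m) \<subseteq> range (a b)" using range_mono[of b m] by blast
    then obtain k where mk: "b \<le> m" "a m k \<notin> range (a b)" using m(1) by blast
    have "m \<noteq> b" using mk(2) by blast
    then have "b < hpair m k" using mk(1) hpair_ge(1)[of m k] by order
    \<comment> \<open>The element \<open>a m k\<close> lies outside ideal \<open>b\<close>, hence
      outside all ideals up to \<open>index n s\<close>, whatever the stage. Its code is therefore a
      candidate at every stage and caps the search.\<close>
    have "index (n + 1) s \<le> hpair m k" for s
    proof -
      have "a m k \<noteq> a u' l" if "u' \<le> index n s" for u' l
        using mk(2) range_mono[of u' b] that b[of s] by (metis order_trans rangeI subsetD)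
      then have "candidate s (index n s) (hpair m k)"
        unfolding candidate_def using hpair_ge(1)[of m k] hpair_ge(2)[of k m] b[of s] \<open>b < hpair m k\<close>
        by (blast intro: le_less_trans)
      then show ?thesis unfolding index(2) by (rule next_index(2))
    qed
    then show "\<exists>b. \<forall>s. Q (n + 1) b s" unfolding Q by blast
  qed
  then show ?thesis unfolding Q .
qed

text \<open>Failing to be a bound is an existential condition, so there is a least bound. It is
  attained, since otherwise its predecessor would be a bound too.\<close>

lemma index_max: "\<exists>s0. \<forall>s. index n s \<le> index n s0"
proof -
  obtain b where b: "\<forall>s. index n s \<le> b" using index_bounded by blast
  have "Sig (\<lambda>e. \<exists>s. \<not> index n s \<le> e 0)"
    by (intro Sig_ex Dec_Sig Dec_intros Rec_op[OF index(3)] Rec_intros)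
  then have "Sig (\<lambda>e. \<not> (\<forall>s. index n s \<le> e 0))" by simp
  from least_hnat[of "\<lambda>b. \<forall>s. index n s \<le> b", OF this b]
  obtain m where m: "\<And>s. index n s \<le> m" "\<And>x. x < m \<Longrightarrow> \<exists>s. \<not> index n s \<le> x" by blast
  have "\<exists>s. index n s = m"
  proof (rule ccontr)
    assume none: "\<nexists>s. index n s = m"
    then have lt: "index n s < m" for s using m(1)[of s] by (metis le_neq_trans)
    show False
    proof (cases "m = 0")
      case True
      then show False using lt[of 0] hnat_basic(7) by simp
    next
      case False
      then obtain m' where "m = m' + 1" using hnat_cases by blast
      then show False using lt m(2)[of m'] by (auto simp: hnat_less_add_1)
    qed
  qed
  then show ?thesis using m(1) by blast
qed

text \<open>Once both indices are final and the stage exceeds the second one, this index must pass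
  the actual test at every later stage. Its element then avoids ever longer initial segments of the
  ideals up to the first index, hence these ideals altogether.\<close>

lemma ex_new_element: "\<exists>r s. r \<in> range (a (index (n + 1) s)) \<and> (\<forall>s. r \<notin> range (a (index n s)))"
proof -
  obtain s0 where s0: "\<And>s. index n s \<le> index n s0" using index_max by blast
  obtain s1 where s1: "\<And>s. index (n + 1) s \<le> index (n + 1) s1" using index_max by blast
  let ?p = "index n s0" and ?q = "index (n + 1) s1"
  \<comment> \<open>The part \<open>?q + 1\<close> rules out that \<open>?q\<close> is accepted
    untested.\<close>
  let ?t = "max (max s0 s1) (?q + 1)"
  have pq: "\<exists>m k. m \<le> ?q \<and> ?q = hpair m k \<and> (\<forall>u'. u' \<le> ?p \<longrightarrow> (\<forall>l. l \<le> t \<longrightarrow> a m k \<noteq> a u' l))"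
    if t: "?t \<le> t" for t
  proof -
    have "s0 \<le> t" "s1 \<le> t" "?q + 1 \<le> t" using t by simp_all
    then have "index n t = ?p" "index (n + 1) t = ?q"
      using s0[of t] s1[of t] index_mono by (blast intro: antisym)+
    then have "candidate t ?p ?q" using next_index(1)[of t "index n t"] by (simp add: index(2))
    moreover have "\<not> t \<le> ?q" using \<open>?q + 1 \<le> t\<close> by (simp add: hnat_add_1_le not_le)
    ultimately show ?thesis unfolding candidate_def by blast
  qed
  obtain m k where mk: "m \<le> ?q" "?q = hpair m k" using pq[of ?t] by blast
  have "a m k \<notin> range (a (index n s))" for s
  proof
    assume "a m k \<in> range (a (index n s))"
    then obtain l where l: "a m k = a (index n s) l" by blast
    \<comment> \<open>An occurrence at position \<open>l\<close> would be seen by the test at stage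
      \<open>max ?t l\<close>, which concerns the same \<open>m\<close> and \<open>k\<close> because
      pairing is injective.\<close>
    obtain m' k' where mk': "?q = hpair m' k'"
      "\<And>u' l'. u' \<le> ?p \<Longrightarrow> l' \<le> max ?t l \<Longrightarrow> a m' k' \<noteq> a u' l'"
      using pq[of "max ?t l"] by auto
    then have "m' = m" "k' = k" using mk(2) by (simp_all add: hpair_inject)
    then show False using mk'(2)[of "index n s" l] s0[of s] l by simp
  qed
  moreover have "a m k \<in> range (a ?q)" using range_mono[OF mk(1)] by blast
  ultimately show ?thesis by blast
qed

text \<open>Enumerates the union over all stages along pairs of a stage and a position. Numbers that
  are no pairs repeat an element of the stage 0 ideal, so that the union does not change.\<close>

definition subchain :: "hnat \<Rightarrow> hnat \<Rightarrow> hnat" where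
  "subchain n i = (if \<exists>s k. i = hpair s k then THE x. \<exists>s k. i = hpair s k \<and> x = a (index n s) k
    else a (index n 0) 0)"

lemma subchain_hpair: "subchain n (hpair s k) = a (index n s) k"
  by (auto simp: subchain_def hpair_inject)

lemma subchain_default: "\<nexists>s k. i = hpair s k \<Longrightarrow> subchain n i = a (index n 0) 0"
  unfolding subchain_def by simp

lemma subchain_cases: "\<exists>s k. subchain n i = a (index n s) k"
  by (metis subchain_hpair subchain_default)

lemma range_subchain: "r \<in> range (subchain n) \<longleftrightarrow> (\<exists>s. r \<in> range (a (index n s)))"
proof
  assume "r \<in> range (subchain n)"
  then obtain i where "r = subchain n i" by blast
  moreover obtain s k where "subchain n i = a (index n s) k" using subchain_cases by blast
  ultimately show "\<exists>s. r \<in> range (a (index n s))" by auto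
next
  assume "\<exists>s. r \<in> range (a (index n s))"
  then obtain s k where "r = subchain n (hpair s k)" by (auto simp: subchain_hpair)
  then show "r \<in> range (subchain n)" by blast
qed

lemma Rec_subchain: "Rec2 subchain"
proof -
  let ?pair = "\<lambda>i. \<exists>s. s \<le> i \<and> (\<exists>k. k \<le> i \<and> i = hpair s k)"
  have "subchain n i = x \<longleftrightarrow>
      (\<exists>s. s \<le> i \<and> (\<exists>k. k \<le> i \<and> i = hpair s k \<and> a (index n s) k = x)) \<or>
      \<not> ?pair i \<and> a (index n 0) 0 = x" for n i x
  proof (cases "\<exists>s k. i = hpair s k")
    case True
    then obtain s k where i: "i = hpair s k" by blast
    show ?thesis unfolding i subchain_hpair hpair_inject using hpair_ge(1)[of s k] hpair_ge(2)[of k s] by blast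
  next
    case False
    then show ?thesis unfolding subchain_default[OF False] by blast
  qed
  moreover have "Sig (\<lambda>e. (\<exists>s. s \<le> e j \<and> (\<exists>k. k \<le> e j \<and> e j = hpair s k \<and> a (index (e i) s) k = e l)) \<or>
      \<not> ?pair (e j) \<and> a (index (e i) 0) 0 = e l)" for i j l
    by (intro Dec_Sig Dec_intros Rec_hpair Rec_op[OF Rec_a] Rec_op[OF index(3)] Rec_intros)
  ultimately show ?thesis by (simp add: Rec2_def)
qed

lemma subchain_increasing: "range (subchain n) \<subseteq> range (subchain (n + 1))"
proof
  fix r
  assume "r \<in> range (subchain n)"
  then obtain s where "r \<in> range (a (index n s))" unfolding range_subchain ..
  then have "r \<in> range (a (index (n + 1) s))"
    using range_mono[OF less_imp_le[OF index_less]] by blast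
  then show "r \<in> range (subchain (n + 1))" unfolding range_subchain ..
qed

lemma subchain_strict: "\<not> range (subchain (n + 1)) \<subseteq> range (subchain n)"
proof
  assume sub: "range (subchain (n + 1)) \<subseteq> range (subchain n)"
  obtain r where r: "\<exists>s. r \<in> range (a (index (n + 1) s))" "\<not> (\<exists>s. r \<in> range (a (index n s)))"
    using ex_new_element[of n] by metis
  have "r \<in> range (subchain (n + 1))" unfolding range_subchain by (rule r(1))
  then have "r \<in> range (subchain n)" by (rule subsetD[OF sub])
  then show False using r(2) unfolding range_subchain by (rule notE[rotated])
qed

text \<open>Indices increase with the stage, so two elements found at different stages both lie in
  the ideal of the later stage, where linear combinations can be formed.\<close>

lemma subchain_directed:
  "\<exists>s i' j'. subchain n i = a (index n s) i' \<and> subchain n j = a (index n s) j'"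
proof -
  obtain s k s' k' where "subchain n i = a (index n s) k" "subchain n j = a (index n s') k'"
    using subchain_cases by metis
  moreover have "range (a (index n s)) \<subseteq> range (a (index n (max s s')))"
    "range (a (index n s')) \<subseteq> range (a (index n (max s s')))"
    by (intro range_mono index_mono; simp)+
  ultimately have "subchain n i \<in> range (a (index n (max s s')))"
    "subchain n j \<in> range (a (index n (max s s')))" by auto
  then show ?thesis by blast
qed

end

section \<open>The theorem\<close>

lemma val_pair [simp]: "val ambient (pair s t) e = hpair (val ambient s e) (val ambient t e)"
  by (simp add: pair_def hpair_def)

definition double_seq :: "hnat set \<Rightarrow> hnat set \<Rightarrow> bool" where
  "double_seq R C \<longleftrightarrow>
    (\<forall>w\<in>C. \<exists>n i x. x \<in> R \<and> w = hpair (hpair n i) x) \<and>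
    (\<forall>n i. \<exists>x. hpair (hpair n i) x \<in> C) \<and>
    (\<forall>n i x y. hpair (hpair n i) x \<in> C \<and> hpair (hpair n i) y \<in> C \<longrightarrow> x = y)"

definition ideal_seq :: "hnat set \<Rightarrow> hnat set \<Rightarrow> hnat set \<Rightarrow> hnat set \<Rightarrow> hnat \<Rightarrow> bool" where
  "ideal_seq R P T C n \<longleftrightarrow> (\<forall>i j r s. r \<in> R \<and> s \<in> R \<longrightarrow> (\<exists>k a b c u v.
    hpair (hpair n i) a \<in> C \<and> hpair (hpair n j) b \<in> C \<and> hpair (hpair n k) c \<in> C \<and>
    hpair (hpair a r) u \<in> T \<and> hpair (hpair b s) v \<in> T \<and> hpair (hpair u v) c \<in> P))"

definition chain_set :: "hnat set \<Rightarrow> hnat set \<Rightarrow> hnat set \<Rightarrow> hnat set \<Rightarrow> bool" where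
  "chain_set R P T C \<longleftrightarrow> double_seq R C \<and> (\<forall>n. ideal_seq R P T C n)"

lemma sat_double_sequence: "sat ambient double_sequence e E \<longleftrightarrow> double_seq (E ''R'') (E ''C'')"
  by (simp add: double_sequence_def double_seq_def app2_def Let_def Ball_def) blast

lemma sat_is_ideal:
  "sat ambient (is_ideal (V ''n'')) e E \<longleftrightarrow>
    ideal_seq (E ''R'') (E ''P'') (E ''T'') (E ''C'') (e ''n'')"
  by (simp add: is_ideal_def ideal_seq_def app2_def Let_def del: ex_simps) blast

lemma sat_chain_of_ideals:
  "sat ambient chain_of_ideals e E \<longleftrightarrow> chain_set (E ''R'') (E ''P'') (E ''T'') (E ''C'')"
  by (simp add: chain_of_ideals_def chain_set_def sat_is_ideal sat_double_sequence)

lemma sat_ideal_subset: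
  assumes "vars m \<inter> {''k'', ''a'', ''l''} = {}" "vars n \<inter> {''k'', ''a'', ''l''} = {}"
  shows "sat ambient (ideal_subset m n) e E \<longleftrightarrow>
    (\<forall>k a. hpair (hpair (val ambient m e) k) a \<in> E ''C'' \<longrightarrow>
      (\<exists>l. hpair (hpair (val ambient n e) l) a \<in> E ''C''))"
proof -
  have m: "val ambient m (e(''k'' := k, ''a'' := a)) = val ambient m e" for k a
    using assms(1) by (intro val_cong) auto
  have n: "val ambient n (e(''k'' := k, ''a'' := a, ''l'' := l)) = val ambient n e" for k a l
    using assms(2) by (intro val_cong) auto
  show ?thesis
    by (simp add: ideal_subset_def in_ideal_def app2_def Let_def m n)
qed

lemma chain_set_fun:
  assumes "chain_set R P T C"
  obtains a where "\<And>n i x. hpair (hpair n i) x \<in> C \<longleftrightarrow> a n i = x"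
proof
  fix n i x
  have "\<exists>!x. hpair (hpair n i) x \<in> C" using assms unfolding chain_set_def double_seq_def by blast
  then show "hpair (hpair n i) x \<in> C \<longleftrightarrow> (THE x. hpair (hpair n i) x \<in> C) = x"
    by (metis theI')
qed

lemma sat_ideal_subset_range:
  assumes "\<And>n i x. hpair (hpair n i) x \<in> E ''C'' \<longleftrightarrow> a n i = x"
    and "vars s \<inter> {''k'', ''a'', ''l''} = {}" "vars t \<inter> {''k'', ''a'', ''l''} = {}"
  shows "sat ambient (ideal_subset s t) e E \<longleftrightarrow>
    range (a (val ambient s e)) \<subseteq> range (a (val ambient t e))"
  unfolding sat_ideal_subset[OF assms(2,3)] assms(1) image_subset_iff image_iff by (metis UNIV_I)

lemma ex_strictly_increasing:
  assumes C: "C \<in> hsets" "chain_set R P T C"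
    and a: "\<And>n i x. hpair (hpair n i) x \<in> C \<longleftrightarrow> a n i = x"
    and inc: "\<And>n k. a n k \<in> range (a (n + 1))"
    and unst: "\<And>n. \<exists>m. n \<le> m \<and> range (a m) \<noteq> range (a n)"
  shows "\<exists>D\<in>hsets. \<exists>d. chain_set R P T D \<and> (\<forall>n i x. hpair (hpair n i) x \<in> D \<longleftrightarrow> d n i = x) \<and>
    (\<forall>n. range (d n) \<subseteq> range (d (n + 1)) \<and> \<not> range (d (n + 1)) \<subseteq> range (d n))"
proof -
  \<comment> \<open>The graph of \<open>a\<close> is the set \<open>C\<close> itself.\<close>
  have "Rec2 a" unfolding Rec2_def a[symmetric] hpair_def
    by (intro allI Def0_Sig Def0_mem C(1) Tm_intros)
  then interpret unstable_chain a
    using inc unst by unfold_locales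
  obtain D where D: "D \<in> hsets" "\<And>z. z \<in> D \<longleftrightarrow> (\<exists>n i. z = hpair (hpair n i) (subchain n i))"
    using graph_set[OF Rec_subchain] by blast
  have d: "hpair (hpair n i) x \<in> D \<longleftrightarrow> subchain n i = x" for n i x
    unfolding D(2) hpair_inject by blast
  have carrier: "a n i \<in> R" for n i
  proof -
    have "hpair (hpair n i) (a n i) \<in> C" using a by blast
    then show ?thesis using C(2) unfolding chain_set_def double_seq_def by (auto simp: hpair_inject)
  qed
  have ideal: "\<exists>k u v. hpair (hpair (a n i) r) u \<in> T \<and> hpair (hpair (a n j) s) v \<in> T \<and>
      hpair (hpair u v) (a n k) \<in> P" if "r \<in> R" "s \<in> R" for n i j r s
    using C(2) that unfolding chain_set_def ideal_seq_def a by blast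
  have "\<exists>k u v. hpair (hpair (subchain n i) r) u \<in> T \<and> hpair (hpair (subchain n j) s) v \<in> T \<and>
      hpair (hpair u v) (subchain n k) \<in> P" if rs: "r \<in> R" "s \<in> R" for n i j r s
  proof -
    obtain t i' j' where t: "subchain n i = a (index n t) i'" "subchain n j = a (index n t) j'"
      using subchain_directed by blast
    obtain k u v where "hpair (hpair (a (index n t) i') r) u \<in> T"
      "hpair (hpair (a (index n t) j') s) v \<in> T" "hpair (hpair u v) (a (index n t) k) \<in> P"
      using ideal[OF rs] by blast
    \<comment> \<open>The combination is element \<open>k\<close> of the ideal at stage
      \<open>t\<close>, which the union lists at position \<open>hpair t k\<close>.\<close>
    then show ?thesis unfolding t subchain_hpair[symmetric, of _ t k] by blast
  qed
  moreover have "\<forall>w\<in>D. \<exists>n i x. x \<in> R \<and> w = hpair (hpair n i) x"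
    using D(2) subchain_cases carrier by metis
  ultimately have "chain_set R P T D"
    unfolding chain_set_def double_seq_def ideal_seq_def d by blast
  then show ?thesis using D(1) d subchain_increasing subchain_strict by blast
qed

lemma valid_chain_theorem: "valid ambient chain_theorem"
proof -
  have main: "sat ambient stabilises e E"
    if E: "E ''C'' \<in> hsets" and chain: "sat ambient chain_of_ideals e E"
      and inc: "sat ambient increasing e E"
      and no: "\<And>D. D \<in> hsets \<Longrightarrow> \<not> (sat ambient chain_of_ideals e (E(''C'' := D)) \<and>
        sat ambient strictly_increasing e (E(''C'' := D)))" for e E
  proof (rule ccontr)
    let ?C = "E ''C''"
    assume unst: "\<not> sat ambient stabilises e E"
    have C: "chain_set (E ''R'') (E ''P'') (E ''T'') ?C" using chain by (simp add: sat_chain_of_ideals)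
    obtain a where a: "\<And>n i x. hpair (hpair n i) x \<in> ?C \<longleftrightarrow> a n i = x"
      using chain_set_fun[OF C] by blast
    note sub = sat_ideal_subset_range[of E a, OF a]
    have inc': "a n k \<in> range (a (n + 1))" for n k
    proof -
      have "range (a n) \<subseteq> range (a (n + 1))"
        using inc by (simp add: increasing_def sub)
      then show ?thesis by blast
    qed
    have unst': "\<exists>m. n \<le> m \<and> range (a m) \<noteq> range (a n)" for n
    proof -
      have "\<exists>m. (n < m \<or> n = m) \<and> \<not> (range (a m) \<subseteq> range (a n) \<and> range (a n) \<subseteq> range (a m))"
        using unst by (simp add: stabilises_def ideal_eq_def sub Let_def)
      then show ?thesis by (auto simp: le_less)
    qed
    from ex_strictly_increasing[OF E C a inc' unst'] obtain D d where D: "D \<in> hsets"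
      "chain_set (E ''R'') (E ''P'') (E ''T'') D" "\<forall>n i x. hpair (hpair n i) x \<in> D \<longleftrightarrow> d n i = x"
      "\<forall>n. range (d n) \<subseteq> range (d (n + 1)) \<and> \<not> range (d (n + 1)) \<subseteq> range (d n)"
      by (elim bexE exE conjE)
    have sub_D: "hpair (hpair n i) x \<in> (E(''C'' := D)) ''C'' \<longleftrightarrow> d n i = x" for n i x
      using D(3) by simp
    have "sat ambient chain_of_ideals e (E(''C'' := D))" using D(2) by (simp add: sat_chain_of_ideals)
    moreover have "sat ambient strictly_increasing e (E(''C'' := D))"
      using D(4) by (simp add: strictly_increasing_def ideal_psubset_def
          sat_ideal_subset_range[of "E(''C'' := D)" d, OF sub_D])
    ultimately show False using no[OF D(1)] by blast
  qed
  show ?thesis unfolding valid_def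
  proof (intro allI impI)
    fix e E
    show "sat ambient chain_theorem e E"
      using main by simp
  qed
qed

lemma fvN_parts [simp]:
  "fvN (binary_operation F) = {}" "fvN (unary_operation F) = {}" "fvN (associative F) = {}"
  "fvN (commutative F) = {}" "fvN distributive = {}" "fvN double_sequence = {}"
  "fvN (is_ideal (V ''n'')) = {''n''}"
  by (simp_all add: binary_operation_def unary_operation_def associative_def commutative_def
      distributive_def double_sequence_def is_ideal_def app1_def app2_def pair_def Let_def insert_Diff_if)

lemma fvN_subset [simp]:
  "fvN (ideal_subset m n) = (vars m \<union> (vars n - {''l''})) - {''k'', ''a''}"
  by (auto simp: ideal_subset_def in_ideal_def app2_def pair_def Let_def)

lemma fvS_parts [simp]:
  "fvS (binary_operation F) = {''R'', F}" "fvS (unary_operation F) = {''R'', F}"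
  "fvS (associative F) = {F}" "fvS (commutative F) = {F}" "fvS distributive = {''P'', ''T''}"
  "fvS double_sequence = {''R'', ''C''}" "fvS (is_ideal t) = {''R'', ''C'', ''T'', ''P''}"
  "fvS (ideal_subset s t) = {''C''}"
  by (auto simp: binary_operation_def unary_operation_def associative_def commutative_def
      distributive_def double_sequence_def is_ideal_def ideal_subset_def in_ideal_def
      app1_def app2_def Let_def)

lemma closed_chain_theorem: "fvN chain_theorem = {}" "fvS chain_theorem = {}"
  by (simp_all add: insert_Diff_if countable_commutative_ring_def chain_of_ideals_def strictly_increasing_def
      ideal_psubset_def increasing_def stabilises_def ideal_eq_def app1_def app2_def pair_def Let_def)

lemma unreserved_chain_theorem: "unreserved chain_theorem"
  by (simp add: countable_commutative_ring_def binary_operation_def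
      unary_operation_def associative_def commutative_def distributive_def chain_of_ideals_def
      double_sequence_def is_ideal_def strictly_increasing_def ideal_psubset_def ideal_subset_def
      in_ideal_def increasing_def stabilises_def ideal_eq_def app1_def app2_def pair_def Let_def)

theorem theorem5p4:
  shows "RCA0 \<union> ISigma02 \<turnstile>
    AllsS [''R'', ''P'', ''T'', ''M''] (AllsN [''o'', ''e''] (
      countable_commutative_ring \<^bold>\<longrightarrow>
      \<^bold>\<not> ExS ''C'' (chain_of_ideals \<^bold>\<and> strictly_increasing) \<^bold>\<longrightarrow>
      AllS ''C'' (chain_of_ideals \<^bold>\<and> increasing \<^bold>\<longrightarrow> stabilises)))"
proof (rule ccontr)
  assume "\<not> RCA0 \<union> ISigma02 \<turnstile> chain_theorem"
  moreover have "basic_axioms \<subseteq> RCA0 \<union> ISigma02" by (auto simp: RCA0_def)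
  ultimately obtain M :: "hnat struct" where
    M: "\<forall>\<psi>\<in>RCA0 \<union> ISigma02. unreserved \<psi> \<longrightarrow> valid M \<psi>" "\<not> valid M chain_theorem"
    using ex_countermodel[OF infinite_hnat _ _ unreserved_chain_theorem closed_chain_theorem] by blast
  \<comment> \<open>Without sets there would be no assignment to refute the theorem.\<close>
  have "sts M \<noteq> {}" using M(2) unfolding valid_def by blast
  then have "admissible M" using M(1) by (simp add: admissible_def)
  \<comment> \<open>By its choice \<open>ambient\<close> would refute the theorem if any admissible
    structure on this type did.\<close>
  then show False using ambient(2)[OF valid_chain_theorem] M(2) by blast
qed

end
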